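(* Let $d\in\mathbb N$, $1\le q\le\infty$, $\alpha>0$, $\beta\in\mathbb R$, $\alpha+\beta>0$, and let $Q=(Q_j(\cdot,\varphi_j,\widetilde\varphi_j))_{j\in\mathbb Z_+}$ be a family of quasi-interpolation operators with $\widetilde\varphi_j\in\mathcal D'(\mathbb T)$ and $\varphi_j\in\mathcal T_j^1$ for each $j\in\mathbb Z_+$. Suppose that for some $N\ge 0$ and some $s>\max(\alpha+\beta,\alpha)$ there are constants $C_{\widetilde\varphi},C_\varphi,C_{\varphi,\widetilde\varphi,s}$ such that for all $j\in\mathbb Z_+$: $$|\widehat{\widetilde\varphi_j}(\ell)|\le C_{\widetilde\varphi}(1+|2^{-j}\ell|^N)\ \text{ for all }\ell\in\mathbb Z,\qquad |\widehat{\varphi_j}(\ell)|\le C_\varphi\ \text{ for all }\ell\in\mathbb Z,$$ $$|1-\widehat{\varphi_j}(\ell)\widehat{\widetilde\varphi_j}(\ell)|\le C_{\varphi,\widetilde\varphi,s}|2^{-j}\ell|^s\ \text{ for all }\ell\in D_j.$$ Assume also that at least one of the following holds: (i) $\min(\alpha+\beta,\alpha)>N+1/q'$; or (ii) $N=0$ and $\sup_{j\in\mathbb Z_+}\|\widetilde\varphi_j\|_{\widetilde A_{q',j}(\mathbb T)}<\infty$. Then a function $f\in L_1(\mathbb T^d)$ belongs to $A_q^{\alpha,\beta}(\mathbb T^d)$ if and only if it can be represented by the series $$f=\sum_{\mathbf j\in\mathbb Z_+^d}\eta_{\mathbf j}^Q(f)$$ (with $\eta^Q_{\mathbf j}(f)$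 well defined for all $\mathbf j$) converging unconditionally in $A_q^{\widetilde\alpha,\beta}(\mathbb T^d)$ for every $\widetilde\alpha<\alpha$ and satisfying $$\sum_{\mathbf j\in\mathbb Z_+^d}2^{q(\alpha|\mathbf j|_1+\beta|\mathbf j|_\infty)}\|\eta_{\mathbf j}^Q(f)\|_{A_q(\mathbb T^d)}^q<\infty$$ (with the usual modification, a supremum, if $q=\infty$). Moreover, the norm $\|f\|_{A_q^{\alpha,\beta}(\mathbb T^d)}$ is equivalent to the norm $$\|f\|^+_{A_q^{\alpha,\beta}(\mathbb T^d)}:=\Big(\sum_{\mathbf j\in\mathbb Z_+^d}2^{q(\alpha|\mathbf j|_1+\beta|\mathbf j|_\infty)}\|\eta_{\mathbf j}^Q(f)\|_{A_q(\mathbb T^d)}^q\Big)^{1/q}.$$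
   Context: $\mathbb T^d=\mathbb R^d/2\pi\mathbb Z^d$, $\mathbb Z_+=\{0,1,2,\dots\}$, $\frac1q+\frac1{q'}=1$, $\widehat f(\mathbf k)=(2\pi)^{-d}\int_{\mathbb T^d}f(\mathbf x)e^{-\mathrm i(\mathbf k,\mathbf x)}d\mathbf x$. For $\mathbf k\in\mathbb Z_+^d$: $|\mathbf k|_1=\sum_ik_i$, $|\mathbf k|_\infty=\max_ik_i$. Spaces. For $0<q\le\infty$, $\alpha,\beta\in\mathbb R$, the hybrid Wiener space $A_q^{\alpha,\beta}(\mathbb T^d)$ is the set of $f\in L_1(\mathbb T^d)$ with finite $\|f\|_{A_q^{\alpha,\beta}(\mathbb T^d)}=\big(\sum_{\mathbf k\in\mathbb Z^d}\prod_{j=1}^d(1+|k_j|)^{q\alpha}(1+|\mathbf k|)^{q\beta}|\widehat f(\mathbf k)|^q\big)^{1/q}$ (supremum if $q=\infty$), $|\mathbf k|$ being the Euclidean norm; $A_q(\mathbb T^d)=A_q^{0,0}(\mathbb T^d)$, so $\|f\|_{A_q(\mathbb T^d)}=\big(\sum_{\mathbf k}|\widehat f(\mathbf k)|^q\big)^{1/q}$. Norms are considered up to equivalence. Sets and polynomials. $D_j=[-2^{j-1},2^{j-1})\cap\mathbb Z$; $\mathcal T_j^1=\mathrm{span}\{e^{\mathrm i kx}:k\in D_j\}$. $\mathcal D'(\mathbb T)$ is the space of periodic distributions on $\mathbb T$, with Fourier expansions $\widetilde\varphi=\sum_{k\in\mathbb Z}\widehat{\widetilde\varphi}(k)e^{\mathrm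 i kx}$. Amalgam-type norm: $\|\psi\|_{\widetilde A_{r,j}(\mathbb T)}=\sup_{\ell\in D_j}\big(\sum_{\mu\in\mathbb Z}|\widehat\psi(\ell+2^j\mu)|^r\big)^{1/r}$ for $1\le r<\infty$, and $\|\psi\|_{\widetilde A_{\infty,j}(\mathbb T)}=\sup_{k\in\mathbb Z}|\widehat\psi(k)|$ (defined through Fourier coefficients, possibly $+\infty$). Quasi-interpolation operators. For univariate $f$, $Q_j(f,\varphi_j,\widetilde\varphi_j)(x)=2^{-j}\sum_{k\in D_j}(f*\widetilde\varphi_j)(x_k^j)\,\varphi_j(x-x_k^j)$, $x_k^j=\pi k/2^{j-1}$, where $(f*\widetilde\varphi_j)(x)=\sum_{\nu\in\mathbb Z}\widehat f(\nu)\widehat{\widetilde\varphi_j}(\nu)e^{\mathrm i\nu x}$; equivalently $Q_j(f,\varphi_j,\widetilde\varphi_j)(x)=\sum_{\ell\in D_j}\widehat{\varphi_j}(\ell)\big(\sum_{\mu\in\mathbb Z}\widehat f(\ell+2^j\mu)\widehat{\widetilde\varphi_j}(\ell+2^j\mu)\big)e^{\mathrm i\ell x}$. For functions on $\mathbb T^d$, $Q_j^i$ is the operator $Q_j$ acting in the variable $x_i$, $Q_{-1}^i=0$, and $\eta_{\mathbf j}^Q=\prod_{i=1}^d(Q_{j_i}^i-Q_{j_i-1}^i)$ for $\mathbf j\in\mathbb Z_+^d$. Products are understood through Fourier coefficients: $\prod_iQ_{j_i}^if=\sum_{\boldsymbol\ell\in D_{j_1}\times\dots\times D_{j_d}}\prod_i\widehat{\varphi_{j_i}}(\ell_i)\big(\sum_{\boldsymbol\mu\in\mathbb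 Z^d}\widehat f(\ell_1+2^{j_1}\mu_1,\dots,\ell_d+2^{j_d}\mu_d)\prod_i\widehat{\widetilde\varphi_{j_i}}(\ell_i+2^{j_i}\mu_i)\big)e^{\mathrm i(\boldsymbol\ell,\mathbf x)}$; $\eta_{\mathbf j}^Q(f)$ is called well defined if the inner sums occurring in it converge absolutely. *)

theory Defs
  imports "HOL-Analysis.Analysis"
begin

section \<open>Functions and distributions on the torus\<close>

text \<open>A function on the torus \<open>\<T>\<^sup>d = \<real>\<^sup>d / 2\<pi>\<int>\<^sup>d\<close>
  is a \<open>2\<pi>\<close>-periodic function on \<^typ>\<open>real ^ 'd\<close>, with the cube below as fundamental domain;
  functions that agree almost everywhere are not identified.\<close>

definition torus_cube :: "(real ^ 'd) set" where
  "torus_cube = cbox (\<chi> i. - pi) (\<chi> i. pi)"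

definition L1_torus :: "(real ^ 'd \<Rightarrow> complex) set" where
  "L1_torus = {f. (\<forall>x (n :: int ^ 'd). f (x + (\<chi> i. 2 * pi * of_int (n $ i))) = f x)
                \<and> f absolutely_integrable_on torus_cube}"

definition of_int_vec :: "int ^ 'd \<Rightarrow> real ^ 'd" where
  "of_int_vec k = (\<chi> i. of_int (k $ i))"

definition fourier_coeff :: "(real ^ 'd \<Rightarrow> complex) \<Rightarrow> int ^ 'd \<Rightarrow> complex" where
  "fourier_coeff f k =
     (LINT x:torus_cube|lebesgue. f x * cis (- (of_int_vec k \<bullet> x))) / of_real ((2 * pi) ^ CARD('d))"

definition fourier_coeff1 :: "(real \<Rightarrow> complex) \<Rightarrow> int \<Rightarrow> complex" where
  "fourier_coeff1 \<phi> k =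
     (LINT x:{-pi..pi}|lebesgue. \<phi> x * cis (- (of_int k * x))) / of_real (2 * pi)"

definition nth_deriv :: "nat \<Rightarrow> (real \<Rightarrow> complex) \<Rightarrow> real \<Rightarrow> complex" where
  "nth_deriv m = (\<lambda>\<psi> x. vector_derivative \<psi> (at x)) ^^ m"

definition test_functions :: "(real \<Rightarrow> complex) set" where
  "test_functions = {\<psi>. (\<forall>x. \<psi> (x + 2 * pi) = \<psi> x)
                       \<and> (\<forall>m x. nth_deriv m \<psi> differentiable (at x))}"

text \<open>Periodic distributions: functionals that are linear on the smooth periodic functions and
  continuous for the topology given by the seminorms \<open>sup \<bar>\<psi>\<^sup>(\<^sup>m\<^sup>)\<bar>\<close>. The values outside
  \<^const>\<open>test_functions\<close> are irrelevant.\<close>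

definition periodic_distributions :: "((real \<Rightarrow> complex) \<Rightarrow> complex) set" where
  "periodic_distributions = {u.
     (\<forall>a b. \<forall>\<psi>\<in>test_functions. \<forall>\<theta>\<in>test_functions.
        u (\<lambda>x. a * \<psi> x + b * \<theta> x) = a * u \<psi> + b * u \<theta>) \<and>
     (\<exists>C M. \<forall>\<psi>\<in>test_functions. norm (u \<psi>) \<le> C * (\<Sum>m\<le>M. SUP x. norm (nth_deriv m \<psi> x)))}"

text \<open>The normalisation agrees with \<^const>\<open>fourier_coeff1\<close> if an integrable function \<open>g\<close> is
  identified with the functional \<open>\<psi> \<mapsto> \<integral> g \<psi>\<close> over one period.\<close>

definition dist_coeff :: "((real \<Rightarrow> complex) \<Rightarrow> complex) \<Rightarrow> int \<Rightarrow> complex" where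
  "dist_coeff u k = u (\<lambda>x. cis (- (of_int k * x))) / of_real (2 * pi)"


section \<open>Norms\<close>

text \<open>Used for positive exponents only.\<close>

definition ennreal_powr :: "ennreal \<Rightarrow> real \<Rightarrow> ennreal" where
  "ennreal_powr x p = (if x = \<infinity> then \<infinity> else ennreal (enn2real x powr p))"

text \<open>Exponents \<open>0 < q \<le> \<infinity>\<close> have type \<^typ>\<open>ennreal\<close>. Infinite sums in \<^typ>\<open>ennreal\<close> always
  exist, so all norms below are defined everywhere, possibly with the value \<open>\<infinity>\<close>.\<close>

definition lq_norm :: "ennreal \<Rightarrow> ('i \<Rightarrow> ennreal) \<Rightarrow> ennreal" where
  "lq_norm q a =
     (if q = \<infinity> then (SUP i. a i)
      else ennreal_powr (\<Sum>\<^sub>\<infinity>i\<in>UNIV. ennreal_powr (a i) (enn2real q)) (1 / enn2real q))"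

definition wiener_norm ::
    "ennreal \<Rightarrow> real \<Rightarrow> real \<Rightarrow> (real ^ 'd \<Rightarrow> complex) \<Rightarrow> ennreal" where
  "wiener_norm q \<alpha> \<beta> f =
     lq_norm q (\<lambda>k :: int ^ 'd. ennreal
       ((\<Prod>i\<in>UNIV. (1 + \<bar>of_int (k $ i)\<bar>) powr \<alpha>) * (1 + norm (of_int_vec k)) powr \<beta>
        * norm (fourier_coeff f k)))"

definition wiener_space :: "ennreal \<Rightarrow> real \<Rightarrow> real \<Rightarrow> (real ^ 'd \<Rightarrow> complex) set" where
  "wiener_space q \<alpha> \<beta> = {f \<in> L1_torus. wiener_norm q \<alpha> \<beta> f < \<infinity>}"

definition D_set :: "nat \<Rightarrow> int set" where
  "D_set j = {k. - (2 ^ j / 2) \<le> real_of_int k \<and> real_of_int k < 2 ^ j / 2}"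

definition trig_poly :: "nat \<Rightarrow> (real \<Rightarrow> complex) set" where
  "trig_poly j = {g. \<exists>c. g = (\<lambda>x. \<Sum>k\<in>D_set j. c k * cis (of_int k * x))}"

text \<open>The norm of \<open>\<psi>\<close> in \<open>A\<^sub>r\<^sub>,\<^sub>j\<close> (amalgam type), as a function of the Fourier coefficients of \<open>\<psi>\<close>.\<close>

definition amalgam_norm :: "ennreal \<Rightarrow> nat \<Rightarrow> (int \<Rightarrow> complex) \<Rightarrow> ennreal" where
  "amalgam_norm r j c =
     (if r = \<infinity> then (SUP k. ennreal (norm (c k)))
      else (SUP l\<in>D_set j. lq_norm r (\<lambda>\<mu>. ennreal (norm (c (l + 2 ^ j * \<mu>))))))"


section \<open>Quasi-interpolation operators\<close>

text \<open>The summand, at \<open>\<mu> \<in> \<int>\<^sup>d\<close>, of the inner sum of the product operator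
  \<open>\<Prod>\<^sub>i Q\<^sup>i\<close> of levels \<open>m\<^sub>i\<close> at the frequency \<open>l\<close>.\<close>

definition inner_term ::
    "(nat \<Rightarrow> (real \<Rightarrow> complex) \<Rightarrow> complex) \<Rightarrow> (real ^ 'd \<Rightarrow> complex) \<Rightarrow>
     nat ^ 'd \<Rightarrow> int ^ 'd \<Rightarrow> int ^ 'd \<Rightarrow> complex" where
  "inner_term \<phi>t f m l \<mu> =
     fourier_coeff f (\<chi> i. l $ i + 2 ^ (m $ i) * \<mu> $ i)
     * (\<Prod>i\<in>UNIV. dist_coeff (\<phi>t (m $ i)) (l $ i + 2 ^ (m $ i) * \<mu> $ i))"

definition D_box :: "nat ^ 'd \<Rightarrow> (int ^ 'd) set" where
  "D_box m = {l. \<forall>i. l $ i \<in> D_set (m $ i)}"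

definition quasi_interp ::
    "(nat \<Rightarrow> real \<Rightarrow> complex) \<Rightarrow> (nat \<Rightarrow> (real \<Rightarrow> complex) \<Rightarrow> complex) \<Rightarrow>
     nat ^ 'd \<Rightarrow> (real ^ 'd \<Rightarrow> complex) \<Rightarrow> real ^ 'd \<Rightarrow> complex" where
  "quasi_interp \<phi> \<phi>t m f x =
     (\<Sum>l\<in>D_box m. (\<Prod>i\<in>UNIV. fourier_coeff1 (\<phi> (m $ i)) (l $ i))
        * (\<Sum>\<^sub>\<infinity>\<mu>\<in>UNIV. inner_term \<phi>t f m l \<mu>) * cis (of_int_vec l \<bullet> x))"

text \<open>Expanding \<open>\<Prod>\<^sub>i (Q\<^sup>i\<^bsub>j\<^sub>i\<^esub> - Q\<^sup>i\<^bsub>j\<^sub>i - 1\<^esub>)\<close> gives a sum over the sets \<open>E\<close> of directions in which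
  the second term is chosen; since \<open>Q\<^bsub>-1\<^esub> = 0\<close>, only directions with \<open>j\<^sub>i > 0\<close> contribute.\<close>

definition lower_levels :: "'d set \<Rightarrow> nat ^ 'd \<Rightarrow> nat ^ 'd" where
  "lower_levels E j = (\<chi> i. if i \<in> E then j $ i - 1 else j $ i)"

definition eta ::
    "(nat \<Rightarrow> real \<Rightarrow> complex) \<Rightarrow> (nat \<Rightarrow> (real \<Rightarrow> complex) \<Rightarrow> complex) \<Rightarrow>
     nat ^ 'd \<Rightarrow> (real ^ 'd \<Rightarrow> complex) \<Rightarrow> real ^ 'd \<Rightarrow> complex" where
  "eta \<phi> \<phi>t j f x =
     (\<Sum>E\<in>Pow {i. j $ i > 0}. (-1) ^ card E * quasi_interp \<phi> \<phi>t (lower_levels E j) f x)"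

definition eta_well_defined ::
    "(nat \<Rightarrow> (real \<Rightarrow> complex) \<Rightarrow> complex) \<Rightarrow> nat ^ 'd \<Rightarrow> (real ^ 'd \<Rightarrow> complex) \<Rightarrow> bool" where
  "eta_well_defined \<phi>t j f \<longleftrightarrow>
     (\<forall>E\<in>Pow {i. j $ i > 0}. \<forall>l\<in>D_box (lower_levels E j).
        (\<lambda>\<mu>. norm (inner_term \<phi>t f (lower_levels E j) l \<mu>)) summable_on UNIV)"

definition eta_norm ::
    "ennreal \<Rightarrow> real \<Rightarrow> real \<Rightarrow> (nat \<Rightarrow> real \<Rightarrow> complex) \<Rightarrow>
     (nat \<Rightarrow> (real \<Rightarrow> complex) \<Rightarrow> complex) \<Rightarrow> (real ^ 'd \<Rightarrow> complex) \<Rightarrow> ennreal" where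
  "eta_norm q \<alpha> \<beta> \<phi> \<phi>t f =
     lq_norm q (\<lambda>j :: nat ^ 'd.
       ennreal (2 powr (\<alpha> * real (\<Sum>i\<in>UNIV. j $ i) + \<beta> * real (Max (range (($) j)))))
       * wiener_norm q 0 0 (eta \<phi> \<phi>t j f))"

text \<open>Unconditional convergence of a series to \<open>f\<close> in the norm of the space, as for \<^const>\<open>has_sum\<close>.\<close>

definition has_sum_wiener ::
    "ennreal \<Rightarrow> real \<Rightarrow> real \<Rightarrow> ('i \<Rightarrow> real ^ 'd \<Rightarrow> complex) \<Rightarrow> (real ^ 'd \<Rightarrow> complex) \<Rightarrow> bool" where
  "has_sum_wiener q \<alpha> \<beta> g f \<longleftrightarrow>
     ((\<lambda>F. wiener_norm q \<alpha> \<beta> (\<lambda>x. f x - (\<Sum>j\<in>F. g j x))) \<longlongrightarrow> 0) (finite_subsets_at_top UNIV)"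

end

theory Submission imports Defs begin

text \<open>On the Fourier side, \<open>\<eta>\<^sub>j\<close> acts by a tensor product of one-dimensional symbols
  \<open>\<theta>\<^sub>j(l, k)\<close>, which vanish unless \<open>l\<close> and \<open>k\<close> agree modulo \<open>2\<^sup>j\<^sup>-\<^sup>1\<close>. For \<open>k\<close> below the
  level \<open>j - 1\<close> only \<open>l = k\<close> survives, with size \<open>\<bar>2\<^sup>-\<^sup>jk\<bar>\<^sup>s\<close> by the compatibility condition; for the other
  \<open>k\<close> the smoothness weight beats the aliasing sum. Comparing the dyadic weights at two points costs
  only a product of one-dimensional factors, so the weighted symbol is bounded by a product kernel, and
  a Hoelder-type Schur test bounds the series norm by the Wiener norm. The converse bound is the same Schur
  test for the kernel of the summation over levels. Finally \<open>\<Sum>\<^sub>j \<theta>\<^sub>j(l, k)\<close> telescopes to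
  \<open>1\<close> if \<open>l = k\<close> and to \<open>0\<close> otherwise, and by absolute convergence the sums over \<open>j\<close> and
  \<open>k\<close> may be exchanged.\<close>

section \<open>Sequence norms\<close>

text \<open>Each kernel is therefore factored: one part is measured in \<open>q'\<close> along the
  input frequency, the other in \<open>q\<close> along level and output frequency. The exponents in
  the hypotheses come from the one-dimensional factor max(t^\<alpha>, t^(\<alpha>+\<beta>)) by which
  the weights change when one coordinate is scaled by t. For t \<ge> 1 it has exponent
  max(\<alpha>+\<beta>, \<alpha>), which the order s must beat; for t \<le> 1 it has exponent
  min(\<alpha>+\<beta>, \<alpha>), and the polynomial growth lost to aliasing must stay below it.
  Both inequalities are strict, so a positive exponent is left in each case and the sums over levels
  are geometric, with bounds uniform in \<open>q\<close> including q = \<infinity>. Estimating in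
  \<open>ennreal\<close> makes finiteness a conclusion of the bounds, so the same inequality gives
  membership in a space and the equivalence of norms.\<close>

lemma infsum_ennreal_SUP:
  fixes f :: "'a \<Rightarrow> ennreal"
  shows "infsum f A = (SUP F\<in>{F. finite F \<and> F \<subseteq> A}. sum f F)"
  by (rule nonneg_infsum_complete) simp

lemma infsum_ennreal_le:
  fixes f :: "'a \<Rightarrow> ennreal"
  assumes "\<And>F. finite F \<Longrightarrow> F \<subseteq> A \<Longrightarrow> sum f F \<le> C"
  shows "infsum f A \<le> C"
  unfolding infsum_ennreal_SUP by (intro SUP_least) (use assms in auto)

lemma sum_le_infsum_ennreal:
  fixes f :: "'a \<Rightarrow> ennreal"
  assumes "finite F" "F \<subseteq> A"
  shows "sum f F \<le> infsum f A"
  unfolding infsum_ennreal_SUP by (intro SUP_upper) (use assms in auto)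

lemma le_infsum_ennreal:
  fixes f :: "'a \<Rightarrow> ennreal"
  shows "i \<in> A \<Longrightarrow> f i \<le> infsum f A"
  using sum_le_infsum_ennreal[of "{i}" A f] by simp

lemma infsum_ennreal_add:
  fixes f g :: "'a \<Rightarrow> ennreal"
  shows "infsum (\<lambda>x. f x + g x) A = infsum f A + infsum g A"
  by (intro infsum_add nonneg_summable_on_complete) auto

lemma infsum_sum_ennreal:
  fixes f :: "'a \<Rightarrow> 'b \<Rightarrow> ennreal"
  shows "infsum (\<lambda>x. \<Sum>i\<in>I. f i x) A = (\<Sum>i\<in>I. infsum (f i) A)"
  by (induction I rule: infinite_finite_induct) (auto simp: infsum_ennreal_add)

lemma infsum_mono_ennreal:
  fixes f g :: "'a \<Rightarrow> ennreal"
  shows "(\<And>x. x \<in> A \<Longrightarrow> f x \<le> g x) \<Longrightarrow> infsum f A \<le> infsum g A"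
  by (intro infsum_mono nonneg_summable_on_complete) auto

lemma infsum_cmult_ennreal:
  fixes f :: "'a \<Rightarrow> ennreal"
  shows "infsum (\<lambda>x. c * f x) A = c * infsum f A"
  unfolding infsum_ennreal_SUP
  by (subst SUP_mult_left_ennreal) (simp add: sum_distrib_left)

text \<open>Tonelli for nonnegative terms: every finite set of pairs lies in a finite rectangle, and
  finite sums commute with \<open>infsum\<close> in \<open>ennreal\<close>.\<close>

lemma infsum_Sigma_ennreal:
  fixes f :: "'a \<Rightarrow> 'b \<Rightarrow> ennreal"
  shows "(\<Sum>\<^sub>\<infinity>a\<in>UNIV. \<Sum>\<^sub>\<infinity>b\<in>UNIV. f a b) = (\<Sum>\<^sub>\<infinity>x\<in>UNIV. f (fst x) (snd x))"
proof (intro antisym infsum_ennreal_le)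
  fix F :: "'a set" assume F: "finite F"
  have "(\<Sum>a\<in>F. \<Sum>\<^sub>\<infinity>b\<in>UNIV. f a b) = (\<Sum>\<^sub>\<infinity>b\<in>UNIV. \<Sum>a\<in>F. f a b)"
    by (simp add: infsum_sum_ennreal)
  also have "\<dots> \<le> (\<Sum>\<^sub>\<infinity>x\<in>UNIV. f (fst x) (snd x))"
  proof (rule infsum_ennreal_le)
    fix G :: "'b set" assume G: "finite G"
    have "(\<Sum>b\<in>G. \<Sum>a\<in>F. f a b) = (\<Sum>x\<in>F \<times> G. f (fst x) (snd x))"
      by (subst sum.swap) (simp add: sum.cartesian_product split_beta)
    also have "\<dots> \<le> (\<Sum>\<^sub>\<infinity>x\<in>UNIV. f (fst x) (snd x))"
      using F G by (intro sum_le_infsum_ennreal) auto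
    finally show "(\<Sum>b\<in>G. \<Sum>a\<in>F. f a b) \<le> \<dots>" .
  qed
  finally show "(\<Sum>a\<in>F. \<Sum>\<^sub>\<infinity>b\<in>UNIV. f a b) \<le> (\<Sum>\<^sub>\<infinity>x\<in>UNIV. f (fst x) (snd x))" .
next
  fix H :: "('a \<times> 'b) set" assume H: "finite H"
  have "(\<Sum>x\<in>H. f (fst x) (snd x)) \<le> (\<Sum>x\<in>fst ` H \<times> snd ` H. f (fst x) (snd x))"
    using H by (intro sum_mono2) (auto intro: rev_image_eqI)
  also have "\<dots> = (\<Sum>a\<in>fst ` H. \<Sum>b\<in>snd ` H. f a b)"
    by (simp add: sum.cartesian_product split_beta)
  also have "\<dots> \<le> (\<Sum>a\<in>fst ` H. \<Sum>\<^sub>\<infinity>b\<in>UNIV. f a b)"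
    using H by (intro sum_mono sum_le_infsum_ennreal) auto
  also have "\<dots> \<le> (\<Sum>\<^sub>\<infinity>a\<in>UNIV. \<Sum>\<^sub>\<infinity>b\<in>UNIV. f a b)"
    using H by (intro sum_le_infsum_ennreal) auto
  finally show "(\<Sum>x\<in>H. f (fst x) (snd x)) \<le> (\<Sum>\<^sub>\<infinity>a\<in>UNIV. \<Sum>\<^sub>\<infinity>b\<in>UNIV. f a b)" .
qed

text \<open>Injectivity is asked for only on the support. A projection such as (j, l) to j becomes
  injective there, because aliasing leaves one l per level once the input frequency is
  fixed.\<close>

lemma infsum_le_reindex_ennreal:
  fixes f :: "'a \<Rightarrow> ennreal" and g :: "'b \<Rightarrow> ennreal"
  assumes inj: "inj_on h {i. f i \<noteq> 0}" and le: "\<And>i. f i \<noteq> 0 \<Longrightarrow> f i \<le> g (h i)"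
  shows "infsum f UNIV \<le> infsum g UNIV"
proof (rule infsum_ennreal_le)
  fix F :: "'a set" assume F: "finite F"
  define G where "G = {i\<in>F. f i \<noteq> 0}"
  have "sum f F = sum f G" unfolding G_def using F by (intro sum.mono_neutral_right) auto
  also have "\<dots> \<le> (\<Sum>i\<in>G. g (h i))" by (intro sum_mono le) (auto simp: G_def)
  also have "\<dots> = sum g (h ` G)"
    by (subst sum.reindex) (auto intro: inj_on_subset[OF inj] simp: G_def)
  also have "\<dots> \<le> infsum g UNIV" using F by (intro sum_le_infsum_ennreal) (auto simp: G_def)
  finally show "sum f F \<le> infsum g UNIV" .
qed

section \<open>Powers with values in \<open>ennreal\<close>\<close>

lemma ennreal_powr_ennreal [simp]: "0 \<le> x \<Longrightarrow> ennreal_powr (ennreal x) p = ennreal (x powr p)"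
  by (simp add: ennreal_powr_def)

lemma ennreal_powr_top [simp]: "ennreal_powr top p = top"
  by (simp add: ennreal_powr_def)

lemma ennreal_powr_0 [simp]: "ennreal_powr 0 p = 0"
  by (simp add: ennreal_powr_def)

lemma ennreal_powr_eq_0_iff [simp]: "ennreal_powr x p = 0 \<longleftrightarrow> x = 0"
  by (cases x) (auto simp: ennreal_powr_def)

lemma ennreal_powr_mono: "0 < p \<Longrightarrow> x \<le> y \<Longrightarrow> ennreal_powr x p \<le> ennreal_powr y p"
  by (cases x; cases y) (auto simp: ennreal_powr_def powr_mono2 top_unique)

lemma ennreal_powr_mult: "ennreal_powr (x * y) p = ennreal_powr x p * ennreal_powr y p" if "0 < p"
proof (cases "x = 0 \<or> y = 0")
  case False
  show ?thesis
  proof (cases "x = top \<or> y = top")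
    case True
    thus ?thesis using False by (auto simp: ennreal_mult_top ennreal_top_mult)
  next
    case fin: False
    then obtain a b where "x = ennreal a" "0 \<le> a" "y = ennreal b" "0 \<le> b"
      by (metis enn2real_nonneg ennreal_enn2real less_top)
    thus ?thesis by (simp add: powr_mult flip: ennreal_mult)
  qed
qed (auto simp: that)

lemma ennreal_powr_powr: "ennreal_powr (ennreal_powr x a) b = ennreal_powr x (a * b)"
  by (cases x) (auto simp: ennreal_powr_def powr_powr)

lemma ennreal_powr_1 [simp]: "ennreal_powr x 1 = x"
  by (cases x) (auto simp: ennreal_powr_def)

lemma ennreal_powr_prod:
  "0 < p \<Longrightarrow> ennreal_powr (\<Prod>i\<in>I. f i) p = (\<Prod>i\<in>I. ennreal_powr (f i) p)"
  by (induction I rule: infinite_finite_induct)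
     (simp_all add: ennreal_powr_mult ennreal_powr_ennreal[of 1, simplified])

lemma ennreal_powr_add_le1:
  assumes "0 < p" "p \<le> 1"
  shows "ennreal_powr (x + y) p \<le> ennreal_powr x p + ennreal_powr y p"
proof (cases x; cases y)
  fix a b assume *: "x = ennreal a" "0 \<le> a" "y = ennreal b" "0 \<le> b"
  have "(a + b) powr p \<le> a powr p + b powr p"
  proof (cases "a + b = 0")
    case False
    hence "a + b > 0" using * by simp
    \<comment> \<open>Both ratios lie in [0, 1], where t \<le> t^p for p \<le> 1; on the left they
      add up to 1.\<close>
    have "a / (a+b) \<le> (a/(a+b)) powr p" "b / (a+b) \<le> (b/(a+b)) powr p"
      using powr_mono'[of p 1 "a/(a+b)"] powr_mono'[of p 1 "b/(a+b)"] assms * \<open>a+b>0\<close> by auto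
    hence "a / (a+b) + b / (a+b) \<le> (a/(a+b)) powr p + (b/(a+b)) powr p" by linarith
    also have "\<dots> = (a powr p + b powr p) / (a+b) powr p"
      using * by (simp add: powr_divide add_divide_distrib)
    finally have "1 \<le> (a powr p + b powr p) / (a+b) powr p"
      using \<open>a+b>0\<close> by (simp flip: add_divide_distrib)
    thus ?thesis using \<open>a+b>0\<close> by (simp add: field_simps)
  qed (use * in auto)
  thus ?thesis using * by (simp flip: ennreal_plus)
qed auto

lemma ennreal_powr_add_le:
  assumes "0 < p"
  shows "ennreal_powr (x + y) p \<le> ennreal (2 powr p) * (ennreal_powr x p + ennreal_powr y p)"
proof -
  have "ennreal_powr (x + y) p \<le> ennreal_powr (2 * max x y) p"
    using assms by (intro ennreal_powr_mono) (auto simp: mult_2 intro: add_mono)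
  also have "\<dots> = ennreal (2 powr p) * ennreal_powr (max x y) p"
    using assms ennreal_powr_ennreal[of 2 p] by (simp add: ennreal_powr_mult)
  also have "\<dots> \<le> ennreal (2 powr p) * (ennreal_powr x p + ennreal_powr y p)"
    by (intro mult_left_mono) (auto simp: max_def add_increasing add_increasing2)
  finally show ?thesis .
qed

section \<open>The norm \<open>lq_norm\<close>: monotonicity, mixed norms, embeddings,
  products\<close>

lemma lq_norm_top [simp]: "lq_norm top a = (SUP i. a i)"
  by (simp add: lq_norm_def)

lemma lq_norm_ennreal:
  "0 \<le> p \<Longrightarrow> lq_norm (ennreal p) a = ennreal_powr (\<Sum>\<^sub>\<infinity>i\<in>UNIV. ennreal_powr (a i) p) (1 / p)"
  by (simp add: lq_norm_def)

lemma exponent_cases: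
  fixes q :: ennreal
  assumes "1 \<le> q"
  obtains "q = top" | p where "q = ennreal p" "1 \<le> p"
proof (cases q)
  case (real p)
  thus ?thesis using that(2)[of p] assms by (simp flip: ennreal_1)
qed (use that in auto)

lemma lq_norm_1: "lq_norm 1 a = infsum a UNIV"
  using lq_norm_ennreal[of 1 a] by simp

lemma lq_norm_mono_reindex:
  fixes f :: "'a \<Rightarrow> ennreal" and g :: "'b \<Rightarrow> ennreal"
  assumes q: "1 \<le> q"
    and inj: "inj_on h {i. f i \<noteq> 0}" and le: "\<And>i. f i \<noteq> 0 \<Longrightarrow> f i \<le> g (h i)"
  shows "lq_norm q f \<le> lq_norm q g"
  using q
proof (cases q rule: exponent_cases)
  case 1
  have "f i \<le> (SUP i. g i)" for i
    using le[of i] by (cases "f i = 0") (auto intro: SUP_upper2)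
  thus ?thesis using 1 by (auto intro: SUP_least)
next
  case (2 p)
  have "(\<Sum>\<^sub>\<infinity>i\<in>UNIV. ennreal_powr (f i) p) \<le> (\<Sum>\<^sub>\<infinity>i\<in>UNIV. ennreal_powr (g i) p)"
    using 2 by (intro infsum_le_reindex_ennreal[where h = h]) (auto intro!: inj ennreal_powr_mono le)
  thus ?thesis using 2 by (simp add: lq_norm_ennreal ennreal_powr_mono)
qed

lemma lq_norm_mono: "1 \<le> q \<Longrightarrow> (\<And>i. f i \<le> g i) \<Longrightarrow> lq_norm q f \<le> lq_norm q g"
  by (rule lq_norm_mono_reindex[where h = id]) auto

lemma lq_norm_cmult: "1 \<le> q \<Longrightarrow> lq_norm q (\<lambda>i. c * f i) = c * lq_norm q f"
  by (erule exponent_cases)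
     (auto simp: SUP_mult_left_ennreal lq_norm_ennreal ennreal_powr_mult infsum_cmult_ennreal ennreal_powr_powr)

lemma le_lq_norm: "1 \<le> q \<Longrightarrow> f i \<le> lq_norm q f"
proof (erule exponent_cases)
  fix p :: real assume p: "q = ennreal p" "1 \<le> p"
  have "ennreal_powr (ennreal_powr (f i) p) (1/p) \<le> lq_norm q f"
    using p by (auto simp: lq_norm_ennreal intro!: ennreal_powr_mono le_infsum_ennreal)
  thus "f i \<le> lq_norm q f" using p by (simp add: ennreal_powr_powr)
qed (auto intro: SUP_upper)

text \<open>Iterated norms with one and the same exponent are a norm over pairs, so their order may
  be exchanged. The Schur test depends on this.\<close>

lemma lq_norm_lq_norm:
  assumes "1 \<le> q"
  shows "lq_norm q (\<lambda>a. lq_norm q (\<lambda>b. f a b)) = lq_norm q (\<lambda>x. f (fst x) (snd x))"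
  using assms
proof (cases q rule: exponent_cases)
  case 1
  show ?thesis unfolding 1 lq_norm_top
    by (intro antisym SUP_least) (auto intro: SUP_upper2 SUP_upper2[where i = "(_, _)"])
next
  case (2 p)
  thus ?thesis
    using infsum_Sigma_ennreal[of "\<lambda>a b. ennreal_powr (f a b) p"]
    by (simp add: lq_norm_ennreal ennreal_powr_powr)
qed

lemma lq_norm_swap:
  assumes "1 \<le> q"
  shows "lq_norm q (\<lambda>a. lq_norm q (\<lambda>b. f a b)) = lq_norm q (\<lambda>b. lq_norm q (\<lambda>a. f a b))"
proof -
  have "lq_norm q (\<lambda>x. f (fst x) (snd x)) \<le> lq_norm q (\<lambda>x. f (snd x) (fst x))"
    "lq_norm q (\<lambda>x. f (snd x) (fst x)) \<le> lq_norm q (\<lambda>x. f (fst x) (snd x))"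
    by (rule lq_norm_mono_reindex[where h = prod.swap]; use assms in \<open>auto simp: inj_on_def\<close>)+
  thus ?thesis using assms by (simp add: lq_norm_lq_norm)
qed

text \<open>The factor 2 comes from (x + y)^p \<le> 2^p (x^p + y^p), followed by subadditivity of
  t^(1/p). Norms are compared only up to constants, so the loss is harmless.\<close>

lemma lq_norm_add_le:
  assumes "1 \<le> q"
  shows "lq_norm q (\<lambda>i. f i + g i) \<le> 2 * (lq_norm q f + lq_norm q g)"
  using assms
proof (cases q rule: exponent_cases)
  case 1
  have "f i + g i \<le> 2 * ((SUP i. f i) + (SUP i. g i))" for i
  proof -
    have "f i + g i \<le> (SUP i. f i) + (SUP i. g i)"
      by (intro add_mono SUP_upper) auto
    also have "\<dots> \<le> 2 * \<dots>" by (simp add: mult_2)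
    finally show ?thesis .
  qed
  thus ?thesis using 1 by (auto intro: SUP_least)
next
  case (2 p)
  let ?A = "\<Sum>\<^sub>\<infinity>i\<in>UNIV. ennreal_powr (f i) p" and ?B = "\<Sum>\<^sub>\<infinity>i\<in>UNIV. ennreal_powr (g i) p"
  have "(\<Sum>\<^sub>\<infinity>i\<in>UNIV. ennreal_powr (f i + g i) p) \<le>
        (\<Sum>\<^sub>\<infinity>i\<in>UNIV. ennreal (2 powr p) * (ennreal_powr (f i) p + ennreal_powr (g i) p))"
    using 2 by (intro infsum_mono_ennreal ennreal_powr_add_le) auto
  also have "\<dots> = ennreal (2 powr p) * (?A + ?B)"
    by (simp add: infsum_cmult_ennreal infsum_ennreal_add)
  finally have "lq_norm q (\<lambda>i. f i + g i) \<le> ennreal_powr (ennreal (2 powr p) * (?A + ?B)) (1/p)"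
    using 2 by (auto simp: lq_norm_ennreal intro!: ennreal_powr_mono)
  also have "\<dots> = 2 * ennreal_powr (?A + ?B) (1/p)"
    using 2 by (simp add: ennreal_powr_mult powr_powr)
  also have "\<dots> \<le> 2 * (ennreal_powr ?A (1/p) + ennreal_powr ?B (1/p))"
    using 2 by (intro mult_left_mono ennreal_powr_add_le1) auto
  finally show ?thesis using 2 by (simp add: lq_norm_ennreal)
qed

text \<open>With S the full sum, every term x \<le> S satisfies x^p \<le> x S^(p-1), and summation
  gives S^p. Geometric decay thereby yields bounds that do not depend on \<open>q\<close>.\<close>

lemma lq_norm_le_lq_norm_1:
  assumes "1 \<le> q"
  shows "lq_norm q f \<le> lq_norm 1 f"
  using assms
proof (cases q rule: exponent_cases)
  case 1
  thus ?thesis by (auto intro!: SUP_least le_infsum_ennreal simp: lq_norm_1)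
next
  case (2 p)
  let ?S = "infsum f UNIV"
  have *: "ennreal_powr x p \<le> x * ennreal_powr ?S (p - 1)" if "x \<le> ?S" for x
  proof (cases "x = 0 \<or> ?S = top")
    case True
    thus ?thesis using 2 by (auto simp: ennreal_mult_top)
  next
    case False
    then obtain s where s: "?S = ennreal s" "s \<ge> 0" by (cases ?S) auto
    with that obtain y where y: "x = ennreal y" "y \<ge> 0" by (cases x) (auto simp: top_unique)
    have "y > 0" using False y by (cases "y = 0") auto
    have "y powr p = y * y powr (p - 1)" using \<open>y > 0\<close> by (simp add: powr_mult_base)
    also have "\<dots> \<le> y * s powr (p-1)"
      using that s y 2 by (intro mult_left_mono powr_mono2) auto
    finally show ?thesis using s y by (simp flip: ennreal_mult)
  qed
  have "(\<Sum>\<^sub>\<infinity>i\<in>UNIV. ennreal_powr (f i) p) \<le> (\<Sum>\<^sub>\<infinity>i\<in>UNIV. ennreal_powr ?S (p - 1) * f i)"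
    by (intro infsum_mono_ennreal) (metis * le_infsum_ennreal UNIV_I mult.commute)
  also have "\<dots> = ennreal_powr ?S (p - 1) * ?S" by (rule infsum_cmult_ennreal)
  also have "\<dots> = ennreal_powr ?S p"
    by (cases ?S) (auto simp: ennreal_mult_top powr_mult_base mult.commute simp flip: ennreal_mult)
  finally have "lq_norm q f \<le> ennreal_powr (ennreal_powr ?S p) (1/p)"
    using 2 by (auto simp: lq_norm_ennreal intro!: ennreal_powr_mono)
  thus ?thesis using 2 by (simp add: ennreal_powr_powr lq_norm_1)
qed

text \<open>\<open>g\<close> reads off the one-dimensional datum of direction i from a multi-index.
  By injectivity the multi-indices form a part of a full product, over which a sum of products
  factorises.\<close>

lemma infsum_prod_le_ennreal:
  fixes f :: "'d::finite \<Rightarrow> 'x \<Rightarrow> ennreal" and g :: "'d \<Rightarrow> 'o \<Rightarrow> 'x"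
  assumes inj: "inj (\<lambda>w i. g i w)"
  shows "(\<Sum>\<^sub>\<infinity>w\<in>UNIV. \<Prod>i\<in>UNIV. f i (g i w)) \<le> (\<Prod>i\<in>UNIV. infsum (f i) UNIV)"
proof (rule infsum_ennreal_le)
  fix F :: "'o set" assume F: "finite F"
  have "(\<Sum>w\<in>F. \<Prod>i\<in>UNIV. f i (g i w)) = (\<Sum>v\<in>(\<lambda>w i. g i w) ` F. \<Prod>i\<in>UNIV. f i (v i))"
    by (subst sum.reindex) (auto intro: inj_on_subset[OF inj])
  also have "\<dots> \<le> (\<Sum>v\<in>PiE UNIV (\<lambda>i. g i ` F). \<Prod>i\<in>UNIV. f i (v i))"
    using F by (intro sum_mono2) (auto intro!: finite_PiE)
  also have "\<dots> = (\<Prod>i\<in>UNIV. \<Sum>y\<in>g i ` F. f i y)"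
    using F by (subst prod_sum_PiE) auto
  also have "\<dots> \<le> (\<Prod>i\<in>UNIV. infsum (f i) UNIV)"
    using F by (intro prod_mono_ennreal sum_le_infsum_ennreal) auto
  finally show "(\<Sum>w\<in>F. \<Prod>i\<in>UNIV. f i (g i w)) \<le> (\<Prod>i\<in>UNIV. infsum (f i) UNIV)" .
qed

lemma lq_norm_prod_le:
  fixes f :: "'d::finite \<Rightarrow> 'x \<Rightarrow> ennreal" and g :: "'d \<Rightarrow> 'o \<Rightarrow> 'x"
  assumes q: "1 \<le> q" and inj: "inj (\<lambda>w i. g i w)"
  shows "lq_norm q (\<lambda>w. \<Prod>i\<in>UNIV. f i (g i w)) \<le> (\<Prod>i\<in>UNIV. lq_norm q (f i))"
  using q
proof (cases q rule: exponent_cases)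
  case 1
  thus ?thesis by (auto intro!: SUP_least prod_mono_ennreal SUP_upper)
next
  case (2 p)
  have "ennreal_powr (\<Sum>\<^sub>\<infinity>w\<in>UNIV. \<Prod>i\<in>UNIV. ennreal_powr (f i (g i w)) p) (1/p)
      \<le> ennreal_powr (\<Prod>i\<in>UNIV. \<Sum>\<^sub>\<infinity>x\<in>UNIV. ennreal_powr (f i x) p) (1/p)"
    using 2 infsum_prod_le_ennreal[OF inj, of "\<lambda>i x. ennreal_powr (f i x) p"]
    by (intro ennreal_powr_mono) auto
  thus ?thesis using 2 by (simp add: lq_norm_ennreal ennreal_powr_prod)
qed

section \<open>Conjugate exponents, Hoelder's inequality and the Schur test\<close>

lemma conjugate_exponents_cases:
  fixes q q' :: ennreal
  assumes "1 \<le> q" "1 / q + 1 / q' = 1"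
  obtains "q = 1" "q' = top" | "q = top" "q' = 1"
    | p p' where "q = ennreal p" "q' = ennreal p'" "1 < p" "1 < p'" "1 / p + 1 / p' = 1"
  using assms(1)
proof (cases q rule: exponent_cases)
  case 1
  hence "1 / q' = 1" using assms by simp
  have "q' = 1"
  proof (cases q')
    case (real r)
    have "r > 0" using \<open>1 / q' = 1\<close> real by (cases "r = 0") (auto simp: ennreal_divide_zero)
    thus ?thesis using \<open>1 / q' = 1\<close> real divide_ennreal[of 1 r] by simp
  qed (use \<open>1 / q' = 1\<close> in simp)
  thus ?thesis using that 1 by auto
next
  case (2 p)
  have a: "1 / q = ennreal (1 / p)" using 2 by (simp add: divide_ennreal flip: ennreal_1)
  have "q' \<noteq> 0" using assms by (auto simp: ennreal_divide_zero)
  show ?thesis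
  proof (cases q')
    case (real r)
    have "r > 0" using real \<open>q' \<noteq> 0\<close> by (cases "r = 0") auto
    hence "1 / q' = ennreal (1 / r)" using real by (simp add: divide_ennreal flip: ennreal_1)
    hence *: "1 / p + 1 / r = 1" using assms a 2 \<open>r > 0\<close> by (simp flip: ennreal_plus)
    have "p > 1" using * 2 \<open>r > 0\<close> by (cases "p = 1") auto
    moreover have "r > 1" using * 2 \<open>r > 0\<close> \<open>p > 1\<close> by (smt (verit) divide_le_eq_1_pos le_divide_eq_1_pos divide_pos_pos)
    ultimately show ?thesis using that(3) 2 real * by blast
  next
    case top
    hence "1 / p = 1" using assms a by simp
    hence "p = 1" using 2 by (auto simp: field_simps simp flip: ennreal_1)
    thus ?thesis using that(1) 2 top by simp
  qed
qed

lemma conjugate_exponent_ge_1: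
  fixes q q' :: ennreal
  assumes "1 \<le> q" "1 / q + 1 / q' = 1"
  shows "1 \<le> q'"
  by (rule conjugate_exponents_cases[OF assms]) (auto simp flip: ennreal_1)

lemma Holder_sum:
  fixes a b :: "'i \<Rightarrow> real"
  assumes p: "1 < p" "1 < r" "1 / p + 1 / r = 1" and nn: "\<And>i. a i \<ge> 0" "\<And>i. b i \<ge> 0" and F: "finite F"
  shows "(\<Sum>i\<in>F. a i * b i) \<le> (\<Sum>i\<in>F. a i powr p) powr (1/p) * (\<Sum>i\<in>F. b i powr r) powr (1/r)"
proof -
  define A where "A = (\<Sum>i\<in>F. a i powr p) powr (1/p)"
  define B where "B = (\<Sum>i\<in>F. b i powr r) powr (1/r)"
  have Ap: "A powr p = (\<Sum>i\<in>F. a i powr p)" and Br: "B powr r = (\<Sum>i\<in>F. b i powr r)"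
    unfolding A_def B_def using p by (auto simp: powr_powr sum_nonneg)
  have nnAB: "A \<ge> 0" "B \<ge> 0" unfolding A_def B_def by auto
  show ?thesis
  proof (cases "A = 0 \<or> B = 0")
    case True
    hence "(\<Sum>i\<in>F. a i powr p) = 0 \<or> (\<Sum>i\<in>F. b i powr r) = 0" using Ap Br by auto
    hence "\<forall>i\<in>F. a i * b i = 0" using F by (subst (asm) (1 2) sum_nonneg_eq_0_iff) auto
    hence "(\<Sum>i\<in>F. a i * b i) = 0" by (intro sum.neutral)
    thus ?thesis using nnAB unfolding A_def B_def by simp
  next
    case False
    hence pos: "A > 0" "B > 0" using nnAB by auto
    \<comment> \<open>After normalisation by A and B, Young's inequality bounds the sum by 1/p + 1/r
      = 1.\<close>
    have "(\<Sum>i\<in>F. a i * b i) / (A * B) = (\<Sum>i\<in>F. (a i / A) * (b i / B))"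
      by (simp add: sum_divide_distrib)
    also have "\<dots> \<le> (\<Sum>i\<in>F. (a i / A) powr p / p + (b i / B) powr r / r)"
      using p nn pos by (intro sum_mono Youngs_inequality) auto
    also have "\<dots> = (\<Sum>i\<in>F. a i powr p) / A powr p / p + (\<Sum>i\<in>F. b i powr r) / B powr r / r"
      using nn pos by (simp add: sum.distrib powr_divide sum_divide_distrib)
    also have "\<dots> = 1" using Ap Br pos p by (simp flip: Ap Br)
    finally show ?thesis using pos unfolding A_def B_def by (simp add: field_simps)
  qed
qed

lemma lq_norm_Holder:
  fixes a b :: "'i \<Rightarrow> ennreal"
  assumes "1 \<le> q" "1 / q + 1 / q' = 1"
  shows "(\<Sum>\<^sub>\<infinity>i\<in>UNIV. a i * b i) \<le> lq_norm q' a * lq_norm q b"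
proof (rule conjugate_exponents_cases[OF assms])
  assume *: "q = 1" "q' = top"
  have "(\<Sum>\<^sub>\<infinity>i\<in>UNIV. a i * b i) \<le> (\<Sum>\<^sub>\<infinity>i\<in>UNIV. (SUP i. a i) * b i)"
    by (intro infsum_mono_ennreal mult_right_mono SUP_upper) auto
  thus ?thesis using * by (simp add: lq_norm_1 infsum_cmult_ennreal)
next
  assume *: "q = top" "q' = 1"
  have "(\<Sum>\<^sub>\<infinity>i\<in>UNIV. a i * b i) \<le> (\<Sum>\<^sub>\<infinity>i\<in>UNIV. (SUP i. b i) * a i)"
    by (intro infsum_mono_ennreal, subst mult.commute) (intro mult_right_mono SUP_upper; simp)
  thus ?thesis using * unfolding infsum_cmult_ennreal by (simp add: lq_norm_1 mult.commute[of "infsum a UNIV"])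
next
  fix p r assume *: "q = ennreal p" "q' = ennreal r" "1 < p" "1 < r" "1 / p + 1 / r = 1"
  have q': "1 \<le> q'" using assms by (rule conjugate_exponent_ge_1)
  define A where "A = lq_norm q' a" define B where "B = lq_norm q b"
  have aA: "a i \<le> A" and bB: "b i \<le> B" for i unfolding A_def B_def using assms q' by (auto intro: le_lq_norm)
  \<comment> \<open>The zero case comes first: 0 * top = 0 in \<open>ennreal\<close>, so an infinite
    norm makes the bound trivial only against a nonzero one.\<close>
  show ?thesis
  proof (cases "A = 0 \<or> B = 0")
    case True
    hence "a i * b i = 0" for i using aA[of i] bB[of i] by auto
    thus ?thesis by (simp only: infsum_0) simp
  next
    case False
    show ?thesis
    proof (cases "A = top \<or> B = top")
      case True
      thus ?thesis using False unfolding A_def B_def by (auto simp: ennreal_mult_top ennreal_top_mult)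
    next
      case fin: False
      define u where "u i = enn2real (a i)" for i
      define v where "v i = enn2real (b i)" for i
      have "a i < top" "b i < top" for i
        using aA[of i] bB[of i] fin by (auto simp: less_top top_unique)
      hence uv: "a i = ennreal (u i)" "b i = ennreal (v i)" "u i \<ge> 0" "v i \<ge> 0" for i
        unfolding u_def v_def by auto
      show ?thesis
      proof (rule infsum_ennreal_le)
        fix F :: "'i set" assume F: "finite F"
        have "(\<Sum>i\<in>F. a i * b i) = ennreal (\<Sum>i\<in>F. u i * v i)"
          using uv by (simp add: sum_ennreal flip: ennreal_mult)
        also have "\<dots> \<le> ennreal ((\<Sum>i\<in>F. u i powr r) powr (1/r) * (\<Sum>i\<in>F. v i powr p) powr (1/p))"
          using * uv F by (intro ennreal_leI Holder_sum) auto
        also have "\<dots> = ennreal_powr (\<Sum>i\<in>F. ennreal_powr (a i) r) (1/r) * ennreal_powr (\<Sum>i\<in>F. ennreal_powr (b i) p) (1/p)"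
          using * uv by (simp add: ennreal_mult sum_nonneg)
        also have "\<dots> \<le> lq_norm q' a * lq_norm q b"
          using * F by (auto simp: lq_norm_ennreal intro!: mult_mono ennreal_powr_mono sum_le_infsum_ennreal)
        finally show "(\<Sum>i\<in>F. a i * b i) \<le> lq_norm q' a * lq_norm q b" .
      qed
    qed
  qed
qed

text \<open>Hoelder over the input index pays for \<open>K1\<close> in the conjugate norm and leaves
  the \<open>q\<close>-norm of K2 * y. Exchanging the two \<open>q\<close>-norms pulls
  \<open>y\<close> out of the inner one, where the column norm of \<open>K2\<close> remains.\<close>

lemma lq_norm_kernel_le:
  fixes K1 K2 :: "'o \<Rightarrow> 'i \<Rightarrow> ennreal" and y :: "'i \<Rightarrow> ennreal"
  assumes q: "1 \<le> q" "1 / q + 1 / q' = 1"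
    and A: "\<And>w. lq_norm q' (K1 w) \<le> A" and B: "\<And>i. lq_norm q (\<lambda>w. K2 w i) \<le> B"
  shows "lq_norm q (\<lambda>w. \<Sum>\<^sub>\<infinity>i\<in>UNIV. K1 w i * K2 w i * y i) \<le> A * B * lq_norm q y"
proof -
  have "lq_norm q (\<lambda>w. \<Sum>\<^sub>\<infinity>i\<in>UNIV. K1 w i * K2 w i * y i) \<le> lq_norm q (\<lambda>w. A * lq_norm q (\<lambda>i. K2 w i * y i))"
  proof (rule lq_norm_mono[OF q(1)])
    fix w
    have "(\<Sum>\<^sub>\<infinity>i\<in>UNIV. K1 w i * (K2 w i * y i)) \<le> lq_norm q' (K1 w) * lq_norm q (\<lambda>i. K2 w i * y i)"
      by (rule lq_norm_Holder[OF q])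
    also have "\<dots> \<le> A * lq_norm q (\<lambda>i. K2 w i * y i)" by (intro mult_right_mono A) simp
    finally show "(\<Sum>\<^sub>\<infinity>i\<in>UNIV. K1 w i * K2 w i * y i) \<le> A * lq_norm q (\<lambda>i. K2 w i * y i)"
      by (simp add: mult.assoc)
  qed
  also have "\<dots> = A * lq_norm q (\<lambda>w. lq_norm q (\<lambda>i. K2 w i * y i))"
    using q by (simp add: lq_norm_cmult)
  also have "\<dots> = A * lq_norm q (\<lambda>i. lq_norm q (\<lambda>w. y i * K2 w i))"
    using q by (subst lq_norm_swap) (auto simp: mult.commute)
  also have "\<dots> = A * lq_norm q (\<lambda>i. y i * lq_norm q (\<lambda>w. K2 w i))"
    using q by (simp add: lq_norm_cmult)
  also have "\<dots> \<le> A * lq_norm q (\<lambda>i. y i * B)"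
    using q by (intro mult_left_mono lq_norm_mono B) auto
  also have "\<dots> = A * B * lq_norm q y"
    using lq_norm_cmult[OF q(1), of B y] by (simp add: mult_ac)
  finally show ?thesis .
qed

section \<open>Geometric and polynomial sums\<close>

lemma infsum_nat_ennreal_le_suminf:
  fixes f :: "nat \<Rightarrow> real"
  assumes "summable f" "\<And>n. 0 \<le> f n"
  shows "(\<Sum>\<^sub>\<infinity>n\<in>UNIV. ennreal (f n)) \<le> ennreal (suminf f)"
proof (rule infsum_ennreal_le)
  fix F :: "nat set" assume F: "finite F"
  have "(\<Sum>n\<in>F. ennreal (f n)) = ennreal (sum f F)" using assms by (simp add: sum_ennreal)
  also have "\<dots> \<le> ennreal (suminf f)" using assms F by (intro ennreal_leI sum_le_suminf) auto
  finally show "(\<Sum>n\<in>F. ennreal (f n)) \<le> ennreal (suminf f)" .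
qed

text \<open>\<open>g\<close> numbers the support injectively by the exponent of the geometric bound,
  so a full geometric series dominates the norm for exponent 1, which dominates all others.\<close>

lemma lq_norm_geometric_le:
  fixes f :: "'a \<Rightarrow> ennreal"
  assumes "1 \<le> q" "0 \<le> r" "r < 1" "0 \<le> C"
    and inj: "inj_on g {i. f i \<noteq> 0}" and le: "\<And>i. f i \<noteq> 0 \<Longrightarrow> f i \<le> ennreal (C * r ^ g i)"
  shows "lq_norm q f \<le> ennreal (C / (1 - r))"
proof -
  have "lq_norm q f \<le> lq_norm 1 f" by (rule lq_norm_le_lq_norm_1) fact
  also have "\<dots> \<le> lq_norm 1 (\<lambda>n. ennreal (C * r ^ n))"
    by (rule lq_norm_mono_reindex[OF _ inj]) (use le in auto)
  also have "\<dots> \<le> ennreal (\<Sum>n. C * r ^ n)"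
    unfolding lq_norm_1 using assms
    by (intro infsum_nat_ennreal_le_suminf summable_mult summable_geometric) auto
  also have "(\<Sum>n. C * r ^ n) = C / (1 - r)"
    using assms by (subst suminf_mult) (auto simp: suminf_geometric summable_geometric)
  finally show ?thesis .
qed

lemma dyadic_ratio_powr:
  assumes "a \<le> b"
  shows "(2 ^ a / 2 ^ b :: real) powr \<delta> = (2 powr (-\<delta>)) ^ (b - a)"
proof -
  have "(2 ^ a / 2 ^ b :: real) = 2 powr (real a - real b)"
    by (simp add: powr_diff powr_realpow)
  thus ?thesis using assms by (simp add: powr_powr powr_power of_nat_diff algebra_simps)
qed

text \<open>At the first admissible level the value is at most c^\<delta>, and each later level
  gains a factor 2^(-\<delta>). The position of that level, and with it \<open>u\<close>, disappears
  from the bound.\<close>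

lemma lq_norm_dyadic_decreasing_le:
  assumes q: "1 \<le> q" and pos: "0 < u" "0 < c" "0 < \<delta>"
  shows "lq_norm q (\<lambda>j::nat. ennreal (if u \<le> c * 2 ^ j then (u / 2 ^ j) powr \<delta> else 0))
    \<le> ennreal (c powr \<delta> / (1 - 2 powr (-\<delta>)))"
proof -
  define j0 where "j0 = (LEAST j. u \<le> c * 2 ^ j)"
  have r: "2 powr (-\<delta>) < 1" using pos powr_less_mono[of "-\<delta>" 0 2] by simp
  show ?thesis
  proof (rule lq_norm_geometric_le[where g = "\<lambda>j. j - j0"])
    show "inj_on (\<lambda>j. j - j0) {j. ennreal (if u \<le> c * 2 ^ j then (u / 2 ^ j) powr \<delta> else 0) \<noteq> 0}"
      by (rule inj_onI) (auto simp: j0_def split: if_splits dest!: Least_le[of "\<lambda>j. u \<le> c * 2 ^ j"])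
  next
    fix j assume *: "ennreal (if u \<le> c * 2 ^ j then (u / 2 ^ j) powr \<delta> else 0) \<noteq> 0"
    hence j: "u \<le> c * 2 ^ j" by (auto split: if_splits)
    hence "j0 \<le> j" unfolding j0_def by (rule Least_le)
    have "u \<le> c * 2 ^ j0" unfolding j0_def using j by (rule LeastI)
    hence "u / 2 ^ j \<le> c * (2 ^ j0 / 2 ^ j)" by (simp add: field_simps)
    hence "(u / 2 ^ j) powr \<delta> \<le> (c * (2 ^ j0 / 2 ^ j)) powr \<delta>" using pos by (intro powr_mono2) auto
    also have "\<dots> = c powr \<delta> * (2 powr (-\<delta>)) ^ (j - j0)"
      using pos \<open>j0 \<le> j\<close> by (subst powr_mult) (auto simp: dyadic_ratio_powr)
    finally show "ennreal (if u \<le> c * 2 ^ j then (u / 2 ^ j) powr \<delta> else 0)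
        \<le> ennreal (c powr \<delta> * (2 powr (-\<delta>)) ^ (j - j0))"
      using j by (simp add: ennreal_leI)
  qed (use q r in auto)
qed

text \<open>Mirror image of the preceding bound: levels are counted downwards from the last
  admissible one, which exists because j < 2^j.\<close>

lemma lq_norm_dyadic_increasing_le:
  assumes q: "1 \<le> q" and pos: "0 < u" "0 < c" "0 < \<delta>"
  shows "lq_norm q (\<lambda>j::nat. ennreal (if 2 ^ j \<le> c * u then (2 ^ j / u) powr \<delta> else 0))
    \<le> ennreal (c powr \<delta> / (1 - 2 powr (-\<delta>)))"
proof -
  define S where "S = {j::nat. 2 ^ j \<le> c * u}"
  define J where "J = Max S"
  have fin: "finite S"
  proof (rule finite_subset)
    show "S \<subseteq> {..nat \<lfloor>c * u\<rfloor>}"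
    proof
      fix j assume "j \<in> S"
      hence "real j \<le> c * u"
        using of_nat_less_two_power[of j, where 'a = real] unfolding S_def mem_Collect_eq by linarith
      thus "j \<in> {..nat \<lfloor>c * u\<rfloor>}" by (simp add: le_nat_floor)
    qed
  qed simp
  have r: "2 powr (-\<delta>) < 1" using pos powr_less_mono[of "-\<delta>" 0 2] by simp
  have le: "j \<le> J" if "j \<in> S" for j unfolding J_def using that fin by simp
  show ?thesis
  proof (rule lq_norm_geometric_le[where g = "\<lambda>j. J - j"])
    show "inj_on (\<lambda>j. J - j) {j. ennreal (if 2 ^ j \<le> c * u then (2 ^ j / u) powr \<delta> else 0) \<noteq> 0}"
    proof (rule inj_onI)
      fix i j assume *: "i \<in> {j. ennreal (if 2 ^ j \<le> c * u then (2 ^ j / u) powr \<delta> else 0) \<noteq> 0}"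
         "j \<in> {j. ennreal (if 2 ^ j \<le> c * u then (2 ^ j / u) powr \<delta> else 0) \<noteq> 0}" "J - i = J - j"
      hence "i \<in> S" "j \<in> S" by (auto simp: S_def split: if_splits)
      with le[of i] le[of j] * show "i = j" by auto
    qed
  next
    fix j assume *: "ennreal (if 2 ^ j \<le> c * u then (2 ^ j / u) powr \<delta> else 0) \<noteq> 0"
    hence j: "j \<in> S" by (auto simp: S_def split: if_splits)
    hence "J \<in> S" unfolding J_def using fin by (intro Max_in) auto
    have "2 ^ j / u \<le> c * (2 ^ j / 2 ^ J)"
      using \<open>J \<in> S\<close> pos by (simp add: S_def field_simps)
    hence "(2 ^ j / u) powr \<delta> \<le> (c * (2 ^ j / 2 ^ J)) powr \<delta>" using pos by (intro powr_mono2) auto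
    also have "\<dots> = c powr \<delta> * (2 powr (-\<delta>)) ^ (J - j)"
      using pos le[OF j] by (subst powr_mult) (auto simp: dyadic_ratio_powr)
    finally show "ennreal (if 2 ^ j \<le> c * u then (2 ^ j / u) powr \<delta> else 0)
        \<le> ennreal (c powr \<delta> * (2 powr (-\<delta>)) ^ (J - j))"
      using j by (simp add: ennreal_leI S_def)
  qed (use q r in auto)
qed

lemma lq_norm_single_le:
  assumes "1 \<le> q"
  shows "lq_norm q (\<lambda>k. if k = l then c else 0) \<le> c"
proof -
  have "lq_norm q (\<lambda>k. if k = l then c else 0) \<le> lq_norm 1 (\<lambda>k. if k = l then c else 0)"
    by (rule lq_norm_le_lq_norm_1) fact
  also have "\<dots> = (\<Sum>\<^sub>\<infinity>k\<in>{l}. if k = l then c else 0)"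
    unfolding lq_norm_1 by (rule infsum_cong_neutral) auto
  finally show ?thesis by simp
qed

text \<open>For finite q = p the p-th powers decay with exponent 1 + \<epsilon> p and are summable
  over the integers; for q = top the value 1/q = 0 leaves a bounded function.\<close>

lemma lq_norm_polynomial_decay:
  assumes q: "1 \<le> q" and \<epsilon>: "0 < \<epsilon>"
  shows "lq_norm q (\<lambda>\<mu>::int. ennreal ((1 + \<bar>of_int \<mu>\<bar>) powr (- (enn2real (1 / q) + \<epsilon>)))) < top"
  using q
proof (cases q rule: exponent_cases)
  case 1
  have "ennreal ((1 + \<bar>of_int \<mu>\<bar>) powr (- (enn2real (1 / q) + \<epsilon>))) \<le> 1" for \<mu> :: int
    using \<epsilon> 1 powr_mono[of "-\<epsilon>" 0 "1 + \<bar>of_int \<mu>\<bar>"]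
    by (simp add: add_nonneg_eq_0_iff)
  hence "(SUP \<mu>. ennreal ((1 + \<bar>of_int \<mu>\<bar>) powr (- (enn2real (1 / q) + \<epsilon>)))) \<le> 1"
    by (intro SUP_least) auto
  thus ?thesis using 1 by (auto intro: le_less_trans)
next
  case (2 p)
  have p: "enn2real (1 / q) = 1 / p" using 2 by (simp add: divide_ennreal[of 1, simplified])
  define f where "f n = (1 + real n) powr (- (1 + \<epsilon> * p))" for n
  have f_nonneg: "0 \<le> f n" for n by (simp add: f_def)
  have "summable (\<lambda>n. real n powr (- (1 + \<epsilon> * p)))"
    using \<epsilon> 2 by (subst summable_real_powr_iff) (simp add: mult_pos_pos)
  hence "summable f" unfolding f_def
    by (subst (asm) summable_Suc_iff[symmetric]) (simp add: add.commute)
  have "(\<Sum>\<^sub>\<infinity>\<mu>\<in>UNIV. ennreal_powr (ennreal ((1 + \<bar>of_int \<mu>\<bar>) powr (- (enn2real (1 / q) + \<epsilon>)))) p)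
      = (\<Sum>\<^sub>\<infinity>\<mu>::int\<in>UNIV. ennreal (f (nat \<bar>\<mu>\<bar>)))"
    unfolding p using 2 by (intro infsum_cong) (auto simp: f_def powr_powr left_diff_distrib)
  \<comment> \<open>Sign and absolute value encode an integer injectively, which turns the two-sided
    sum into two copies of a one-sided one.\<close>
  also have "\<dots> \<le> (\<Sum>\<^sub>\<infinity>x\<in>(UNIV :: (bool \<times> nat) set). ennreal (f (snd x)))"
    by (rule infsum_le_reindex_ennreal[where h = "\<lambda>\<mu>. (\<mu> \<ge> 0, nat \<bar>\<mu>\<bar>)"]) (auto simp: inj_on_def)
  also have "\<dots> = (\<Sum>\<^sub>\<infinity>b\<in>(UNIV :: bool set). \<Sum>\<^sub>\<infinity>n\<in>UNIV. ennreal (f n))"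
    using infsum_Sigma_ennreal[of "\<lambda>(b::bool) n. ennreal (f n)"] by simp
  also have "\<dots> = 2 * (\<Sum>\<^sub>\<infinity>n\<in>UNIV. ennreal (f n))"
    by (simp add: UNIV_bool)
  also have "\<dots> \<le> 2 * ennreal (suminf f)"
    using \<open>summable f\<close> f_nonneg by (intro mult_left_mono infsum_nat_ennreal_le_suminf) auto
  also have "\<dots> = ennreal (2 * suminf f)"
    using \<open>summable f\<close> f_nonneg by (subst ennreal_mult) (auto intro!: suminf_nonneg)
  finally have "lq_norm q (\<lambda>\<mu>::int. ennreal ((1 + \<bar>of_int \<mu>\<bar>) powr (- (enn2real (1 / q) + \<epsilon>))))
      \<le> ennreal_powr (ennreal (2 * suminf f)) (1 / p)"
    using 2 by (simp only: lq_norm_ennreal) (intro ennreal_powr_mono, auto)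
  also have "\<dots> < top"
    using \<open>summable f\<close> f_nonneg by (subst ennreal_powr_ennreal) (auto intro!: suminf_nonneg)
  finally show ?thesis .
qed


section \<open>Mixed weights\<close>

text \<open>Common form of both weights: x_i = 2^(j_i) gives the level weight exactly, x_i = 1 +
  |k_i| gives the frequency weight up to a constant.\<close>

definition mixed_weight :: "real \<Rightarrow> real \<Rightarrow> ('d::finite \<Rightarrow> real) \<Rightarrow> real" where
  "mixed_weight \<alpha> \<beta> x = (\<Prod>i\<in>UNIV. x i powr \<alpha>) * Max (range x) powr \<beta>"

text \<open>Equal to t^\<alpha> max(1, t^\<beta>) for t > 0: the worst growth of the mixed weight
  when one coordinate is scaled by \<open>t\<close>, as the maximum may or may not follow that
  coordinate.\<close>

definition ratio_weight :: "real \<Rightarrow> real \<Rightarrow> real \<Rightarrow> real" where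
  "ratio_weight \<alpha> \<beta> t = max (t powr \<alpha>) (t powr (\<alpha> + \<beta>))"

lemma ratio_weight_nonneg [simp]: "0 \<le> ratio_weight \<alpha> \<beta> t"
  by (simp add: ratio_weight_def le_max_iff_disj)

lemma ratio_weight_ge_1: "1 \<le> t \<Longrightarrow> ratio_weight \<alpha> \<beta> t = t powr max (\<alpha> + \<beta>) \<alpha>"
  using powr_mono[of \<alpha> "\<alpha> + \<beta>" t] powr_mono[of "\<alpha> + \<beta>" \<alpha> t]
  by (auto simp: ratio_weight_def max_def)

lemma ratio_weight_le_1: "0 < t \<Longrightarrow> t \<le> 1 \<Longrightarrow> ratio_weight \<alpha> \<beta> t = t powr min (\<alpha> + \<beta>) \<alpha>"
  using powr_mono'[of \<alpha> "\<alpha> + \<beta>" t] powr_mono'[of "\<alpha> + \<beta>" \<alpha> t]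
  by (auto simp: ratio_weight_def max_def min_def)

text \<open>The larger exponent exceeds the smaller by |\<beta>|, and for 1 < t \<le> c this excess
  costs at most c^|\<beta>|.\<close>

lemma ratio_weight_le:
  assumes t: "0 < t" "t \<le> c" and c: "1 \<le> c"
  shows "ratio_weight \<alpha> \<beta> t \<le> c powr \<bar>\<beta>\<bar> * t powr min (\<alpha> + \<beta>) \<alpha>"
proof (cases "t \<le> 1")
  case True
  have "1 \<le> c powr \<bar>\<beta>\<bar>" using c by (intro ge_one_powr_ge_zero) auto
  thus ?thesis using True t by (simp add: ratio_weight_le_1 mult_ge1_I)
next
  case False
  have "t powr max (\<alpha> + \<beta>) \<alpha> = t powr \<bar>\<beta>\<bar> * t powr min (\<alpha> + \<beta>) \<alpha>"
    by (auto simp flip: powr_add simp: max_def min_def add.commute)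
  also have "\<dots> \<le> c powr \<bar>\<beta>\<bar> * t powr min (\<alpha> + \<beta>) \<alpha>"
    using t by (intro mult_right_mono powr_mono2) auto
  finally show ?thesis using False by (simp add: ratio_weight_ge_1)
qed

text \<open>All factors are at least 1, so the product dominates the ratio at any single
  coordinate.\<close>

lemma Max_le_Max_times_ratios:
  fixes x u :: "'d::finite \<Rightarrow> real"
  assumes "\<And>i. 0 < x i" "\<And>i. 0 < u i"
  shows "Max (range x) \<le> Max (range u) * (\<Prod>i\<in>UNIV. max 1 (x i / u i))"
proof -
  have "x i \<le> Max (range u) * (\<Prod>i\<in>UNIV. max 1 (x i / u i))" for i
  proof -
    have "max 1 (x i / u i) \<le> (\<Prod>j\<in>UNIV. max 1 (x j / u j))"
      using prod_mono2[of UNIV "{i}" "\<lambda>j. max 1 (x j / u j)"] by auto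
    hence "u i * (x i / u i) \<le> Max (range u) * (\<Prod>i\<in>UNIV. max 1 (x i / u i))"
      using assms[of i] by (intro mult_mono) (auto intro: order_trans[OF less_imp_le[OF assms(2)[of i]]])
    thus ?thesis using assms(2)[of i] by simp
  qed
  thus ?thesis by (subst Max_le_iff) auto
qed

text \<open>The powers with exponent \<alpha> split exactly over the directions; only the power of
  the maximum needs an estimate, and each direction contributes to it the factor max(1, t^\<beta>)
  of \<open>ratio_weight\<close>.\<close>

lemma mixed_weight_le:
  fixes x u :: "'d::finite \<Rightarrow> real"
  assumes pos: "\<And>i. 0 < x i" "\<And>i. 0 < u i"
  shows "mixed_weight \<alpha> \<beta> x \<le> mixed_weight \<alpha> \<beta> u * (\<Prod>i\<in>UNIV. ratio_weight \<alpha> \<beta> (x i / u i))"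
proof -
  let ?X = "Max (range x)" and ?U = "Max (range u)"
  have XU: "?X > 0" "?U > 0" using pos by (auto simp: Max_gr_iff)
  have *: "?X powr \<beta> \<le> ?U powr \<beta> * (\<Prod>i\<in>UNIV. ratio_weight \<alpha> \<beta> (x i / u i) / (x i / u i) powr \<alpha>)"
  proof (cases "\<beta> \<ge> 0")
    case True
    have "?X powr \<beta> \<le> (?U * (\<Prod>i\<in>UNIV. max 1 (x i / u i))) powr \<beta>"
      using True XU by (intro powr_mono2 Max_le_Max_times_ratios pos) auto
    also have "\<dots> = ?U powr \<beta> * (\<Prod>i\<in>UNIV. max 1 (x i / u i) powr \<beta>)"
      using XU by (simp add: powr_mult prod_powr_distrib prod_nonneg le_max_iff_disj)
    also have "(\<Prod>i\<in>UNIV. max 1 (x i / u i) powr \<beta>) = (\<Prod>i\<in>UNIV. ratio_weight \<alpha> \<beta> (x i / u i) / (x i / u i) powr \<alpha>)"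
    proof (rule prod.cong)
      fix i
      define t where "t = x i / u i"
      have "t > 0" unfolding t_def using pos by simp
      have "max 1 t powr \<beta> = ratio_weight \<alpha> \<beta> t / t powr \<alpha>"
        by (cases "t \<le> 1")
           (use \<open>t > 0\<close> True in \<open>auto simp: ratio_weight_le_1 ratio_weight_ge_1 powr_add max_def min_def\<close>)
      thus "max 1 (x i / u i) powr \<beta> = ratio_weight \<alpha> \<beta> (x i / u i) / (x i / u i) powr \<alpha>"
        unfolding t_def .
    qed simp
    finally show ?thesis .
  next
    case False
    \<comment> \<open>For negative \<beta> the maximum of \<open>x\<close> must be bounded from
      below, so \<open>x\<close> and \<open>u\<close> exchange roles and the inverse ratios
      enter.\<close>
    have "?U powr (-\<beta>) \<le> (?X * (\<Prod>i\<in>UNIV. max 1 (u i / x i))) powr (-\<beta>)"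
      using False XU by (intro powr_mono2 Max_le_Max_times_ratios pos) auto
    also have "\<dots> = ?X powr (-\<beta>) * (\<Prod>i\<in>UNIV. max 1 (u i / x i) powr (-\<beta>))"
      using XU by (simp add: powr_mult prod_powr_distrib prod_nonneg le_max_iff_disj)
    also have "(\<Prod>i\<in>UNIV. max 1 (u i / x i) powr (-\<beta>)) = (\<Prod>i\<in>UNIV. ratio_weight \<alpha> \<beta> (x i / u i) / (x i / u i) powr \<alpha>)"
    proof (rule prod.cong)
      fix i
      define t where "t = x i / u i"
      have "t > 0" unfolding t_def using pos by simp
      have inv: "(1 / t) powr (-\<beta>) = t powr \<beta>"
        using \<open>t > 0\<close> by (simp add: powr_def ln_div)
      have "max 1 (1 / t) powr (-\<beta>) = ratio_weight \<alpha> \<beta> t / t powr \<alpha>"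
      proof (cases "t \<le> 1")
        case True
        hence "max 1 (1 / t) = 1 / t" "min (\<alpha> + \<beta>) \<alpha> = \<alpha> + \<beta>"
          using \<open>t > 0\<close> False by auto
        thus ?thesis using True \<open>t > 0\<close> by (simp only: inv ratio_weight_le_1 powr_add) simp
      next
        case False
        hence "max 1 (1 / t) = 1" "max (\<alpha> + \<beta>) \<alpha> = \<alpha>"
          using \<open>t > 0\<close> \<open>\<not> \<beta> \<ge> 0\<close> by auto
        thus ?thesis using False \<open>t > 0\<close> by (simp add: ratio_weight_ge_1)
      qed
      moreover have "u i / x i = 1 / t" unfolding t_def by simp
      ultimately show "max 1 (u i / x i) powr (-\<beta>) = ratio_weight \<alpha> \<beta> (x i / u i) / (x i / u i) powr \<alpha>"
        by (simp only: t_def[symmetric])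
    qed simp
    finally have "inverse (?U powr \<beta>) \<le> inverse (?X powr \<beta>) * (\<Prod>i\<in>UNIV. ratio_weight \<alpha> \<beta> (x i / u i) / (x i / u i) powr \<alpha>)"
      by (simp only: powr_minus)
    moreover have "a \<le> b * R" if "inverse b \<le> inverse a * R" "0 < a" "0 < b" for a b R :: real
      using that by (simp add: field_simps)
    ultimately show ?thesis using XU by simp
  qed
  have "mixed_weight \<alpha> \<beta> x = (\<Prod>i\<in>UNIV. u i powr \<alpha>) * (\<Prod>i\<in>UNIV. (x i / u i) powr \<alpha>) * ?X powr \<beta>"
  proof -
    have "x i powr \<alpha> = u i powr \<alpha> * (x i / u i) powr \<alpha>" for i
      using pos[of i] by (simp flip: powr_mult)
    thus ?thesis by (simp add: mixed_weight_def flip: prod.distrib)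
  qed
  also have "\<dots> \<le> (\<Prod>i\<in>UNIV. u i powr \<alpha>) * (\<Prod>i\<in>UNIV. (x i / u i) powr \<alpha>) *
      (?U powr \<beta> * (\<Prod>i\<in>UNIV. ratio_weight \<alpha> \<beta> (x i / u i) / (x i / u i) powr \<alpha>))"
    by (intro mult_left_mono * mult_nonneg_nonneg prod_nonneg) auto
  also have "\<dots> = mixed_weight \<alpha> \<beta> u * (\<Prod>i\<in>UNIV. (x i / u i) powr \<alpha> * (ratio_weight \<alpha> \<beta> (x i / u i) / (x i / u i) powr \<alpha>))"
    unfolding mixed_weight_def prod.distrib by (simp only: mult_ac)
  also have "\<dots> = mixed_weight \<alpha> \<beta> u * (\<Prod>i\<in>UNIV. ratio_weight \<alpha> \<beta> (x i / u i))"
  proof -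
    have "(x i / u i) powr \<alpha> * (ratio_weight \<alpha> \<beta> (x i / u i) / (x i / u i) powr \<alpha>) = ratio_weight \<alpha> \<beta> (x i / u i)" for i
      using pos[of i] by simp
    thus ?thesis by (simp only:)
  qed
  finally show ?thesis .
qed

section \<open>Weights on frequencies and on levels\<close>

definition freq_weight :: "real \<Rightarrow> real \<Rightarrow> int ^ 'd \<Rightarrow> real" where
  "freq_weight \<alpha> \<beta> k = (\<Prod>i\<in>UNIV. (1 + \<bar>real_of_int (k $ i)\<bar>) powr \<alpha>) * (1 + norm (of_int_vec k)) powr \<beta>"

definition level_weight :: "real \<Rightarrow> real \<Rightarrow> nat ^ 'd \<Rightarrow> real" where
  "level_weight \<alpha> \<beta> j = 2 powr (\<alpha> * real (\<Sum>i\<in>UNIV. j $ i) + \<beta> * real (Max (range (($) j))))"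

lemma freq_weight_pos [simp]: "0 < freq_weight \<alpha> \<beta> k"
proof -
  have "0 < 1 + norm (of_int_vec k)" by (intro add_pos_nonneg) auto
  thus ?thesis unfolding freq_weight_def by (intro mult_pos_pos prod_pos) auto
qed

lemma freq_weight_nonneg [simp]: "0 \<le> freq_weight \<alpha> \<beta> k"
  using freq_weight_pos less_imp_le by blast

lemma level_weight_pos [simp]: "0 < level_weight \<alpha> \<beta> j"
  by (simp add: level_weight_def)

lemma level_weight_nonneg [simp]: "0 \<le> level_weight \<alpha> \<beta> j"
  by (simp add: level_weight_def)

lemma level_weight_eq: "level_weight \<alpha> \<beta> j = mixed_weight \<alpha> \<beta> (\<lambda>i. 2 ^ (j $ i))"
proof -
  have "Max (range (\<lambda>i. (2::real) ^ (j $ i))) = 2 ^ Max (range (($) j))"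
    using mono_Max_commute[of "\<lambda>n. (2::real) ^ n" "range (($) j)"]
    by (simp add: mono_def image_image)
  moreover have "(\<Prod>i\<in>UNIV. (2 ^ (j $ i)) powr \<alpha>) = 2 powr (\<alpha> * real (\<Sum>i\<in>UNIV. j $ i))"
    by (simp add: powr_sum sum_distrib_left powr_powr mult.commute flip: powr_realpow)
  ultimately show ?thesis
    by (simp add: level_weight_def mixed_weight_def powr_add powr_powr mult.commute flip: powr_realpow)
qed

lemma norm_bounds_Max:
  fixes k :: "int ^ 'd"
  shows "Max (range (\<lambda>i. 1 + \<bar>real_of_int (k $ i)\<bar>)) \<le> 1 + norm (of_int_vec k)"
    and "1 + norm (of_int_vec k) \<le> CARD('d) * Max (range (\<lambda>i. 1 + \<bar>real_of_int (k $ i)\<bar>))"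
proof -
  have "\<bar>real_of_int (k $ i)\<bar> \<le> norm (of_int_vec k)" for i
    using component_le_norm_cart[of "of_int_vec k" i] by (simp add: of_int_vec_def)
  thus "Max (range (\<lambda>i. 1 + \<bar>real_of_int (k $ i)\<bar>)) \<le> 1 + norm (of_int_vec k)"
    by (subst Max_le_iff) auto
  have "norm (of_int_vec k) \<le> (\<Sum>i\<in>UNIV. \<bar>real_of_int (k $ i)\<bar>)"
    using norm_le_l1_cart[of "of_int_vec k"] by (simp add: of_int_vec_def)
  hence "1 + norm (of_int_vec k) \<le> 1 + (\<Sum>i\<in>UNIV. \<bar>real_of_int (k $ i)\<bar>)" by simp
  also have "\<dots> \<le> (\<Sum>i\<in>(UNIV::'d set). 1 + \<bar>real_of_int (k $ i)\<bar>)"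
    using zero_less_card_finite[where 'a='d] unfolding sum.distrib by simp
  also have "\<dots> \<le> (\<Sum>i\<in>(UNIV::'d set). Max (range (\<lambda>i. 1 + \<bar>real_of_int (k $ i)\<bar>)))"
    by (intro sum_mono Max_ge) auto
  finally show "1 + norm (of_int_vec k) \<le> CARD('d) * Max (range (\<lambda>i. 1 + \<bar>real_of_int (k $ i)\<bar>))" by simp
qed

lemma freq_weight_mixed_weight:
  fixes k :: "int ^ 'd"
  shows "freq_weight \<alpha> \<beta> k \<le> CARD('d) powr \<bar>\<beta>\<bar> * mixed_weight \<alpha> \<beta> (\<lambda>i. 1 + \<bar>real_of_int (k $ i)\<bar>)"
    and "mixed_weight \<alpha> \<beta> (\<lambda>i. 1 + \<bar>real_of_int (k $ i)\<bar>) \<le> CARD('d) powr \<bar>\<beta>\<bar> * freq_weight \<alpha> \<beta> k"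
proof -
  let ?M = "Max (range (\<lambda>i. 1 + \<bar>real_of_int (k $ i)\<bar>)) :: real" and ?n = "1 + norm (of_int_vec k)"
  let ?d = "real CARD('d)"
  have M: "0 < ?M" by (auto simp: Max_gr_iff intro!: add_pos_nonneg)
  have d: "1 \<le> ?d" using zero_less_card_finite[where 'a='d] by linarith
  have n: "0 < ?n" by (intro add_pos_nonneg) auto
  \<comment> \<open>Comparability is required in both directions because the sign of \<beta> decides
    which one is used.\<close>
  have c: "a powr \<beta> \<le> ?d powr \<bar>\<beta>\<bar> * b powr \<beta>" if ab: "0 < a" "0 < b" "a \<le> ?d * b" "b \<le> ?d * a" for a b
  proof (cases "\<beta> \<ge> 0")
    case True
    have "a powr \<beta> \<le> (?d * b) powr \<beta>" using ab True by (intro powr_mono2) auto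
    thus ?thesis using ab True by (simp add: powr_mult)
  next
    case False
    have "b powr (-\<beta>) \<le> (?d * a) powr (-\<beta>)" using ab False by (intro powr_mono2) auto
    hence "b powr (-\<beta>) \<le> ?d powr \<bar>\<beta>\<bar> * a powr (-\<beta>)" using False ab by (simp add: powr_mult)
    thus ?thesis using ab by (simp add: powr_minus field_simps)
  qed
  have 2: "?n \<le> ?d * ?M" by (rule norm_bounds_Max)
  have 3: "?M \<le> ?d * ?n"
    using order_trans[OF norm_bounds_Max(1)[of k], of "?d * ?n"] mult_right_mono[OF d, of ?n] n by simp
  have P: "0 \<le> (\<Prod>i\<in>UNIV. (1 + \<bar>real_of_int (k $ i)\<bar>) powr \<alpha> :: real)" by (intro prod_nonneg) auto
  show "freq_weight \<alpha> \<beta> k \<le> CARD('d) powr \<bar>\<beta>\<bar> * mixed_weight \<alpha> \<beta> (\<lambda>i. 1 + \<bar>real_of_int (k $ i)\<bar>)"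
    using mult_left_mono[OF c[OF n M 2 3] P]
    unfolding freq_weight_def mixed_weight_def by (simp add: mult_ac)
  show "mixed_weight \<alpha> \<beta> (\<lambda>i. 1 + \<bar>real_of_int (k $ i)\<bar>) \<le> CARD('d) powr \<bar>\<beta>\<bar> * freq_weight \<alpha> \<beta> k"
    using mult_left_mono[OF c[OF M n 3 2] P]
    unfolding freq_weight_def mixed_weight_def by (simp add: mult_ac)
qed

text \<open>Level against input frequency, as needed to bound the blocks by f. The next lemma is the
  opposite comparison, for the reconstruction of f from its blocks.\<close>

lemma level_weight_le_freq_weight:
  fixes k :: "int ^ 'd" and j :: "nat ^ 'd"
  shows "level_weight \<alpha> \<beta> j \<le> CARD('d) powr \<bar>\<beta>\<bar> * freq_weight \<alpha> \<beta> k *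
    (\<Prod>i\<in>UNIV. ratio_weight \<alpha> \<beta> (2 ^ (j $ i) / (1 + \<bar>real_of_int (k $ i)\<bar>)))"
proof -
  let ?u = "\<lambda>i. 1 + \<bar>real_of_int (k $ i)\<bar> :: real"
  have u: "0 < ?u i" for i by (intro add_pos_nonneg) auto
  have "level_weight \<alpha> \<beta> j \<le> mixed_weight \<alpha> \<beta> ?u * (\<Prod>i\<in>UNIV. ratio_weight \<alpha> \<beta> (2 ^ (j $ i) / ?u i))"
    unfolding level_weight_eq by (intro mixed_weight_le u) auto
  also have "\<dots> \<le> CARD('d) powr \<bar>\<beta>\<bar> * freq_weight \<alpha> \<beta> k * (\<Prod>i\<in>UNIV. ratio_weight \<alpha> \<beta> (2 ^ (j $ i) / ?u i))"
    by (intro mult_right_mono freq_weight_mixed_weight prod_nonneg) auto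
  finally show ?thesis .
qed

lemma freq_weight_le_level_weight:
  fixes k :: "int ^ 'd" and j :: "nat ^ 'd"
  shows "freq_weight \<alpha> \<beta> k \<le> CARD('d) powr \<bar>\<beta>\<bar> * level_weight \<alpha> \<beta> j *
    (\<Prod>i\<in>UNIV. ratio_weight \<alpha> \<beta> ((1 + \<bar>real_of_int (k $ i)\<bar>) / 2 ^ (j $ i)))"
proof -
  let ?u = "\<lambda>i. 1 + \<bar>real_of_int (k $ i)\<bar> :: real"
  have u: "0 < ?u i" for i by (intro add_pos_nonneg) auto
  have "freq_weight \<alpha> \<beta> k \<le> CARD('d) powr \<bar>\<beta>\<bar> * mixed_weight \<alpha> \<beta> ?u"
    by (rule freq_weight_mixed_weight)
  also have "\<dots> \<le> CARD('d) powr \<bar>\<beta>\<bar> * (level_weight \<alpha> \<beta> j * (\<Prod>i\<in>UNIV. ratio_weight \<alpha> \<beta> (?u i / 2 ^ (j $ i))))"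
    unfolding level_weight_eq by (intro mult_left_mono mixed_weight_le u) auto
  finally show ?thesis by (simp add: mult_ac)
qed

text \<open>The comparison of weights at level 0, where the level weight is 1 and every ratio is at
  most 1. It lets the weight of f absorb polynomial growth of order \<open>e\<close> in the
  symbols.\<close>

lemma prod_powr_le_freq_weight:
  fixes k :: "int ^ 'd"
  assumes "0 \<le> e" "e \<le> min (\<alpha> + \<beta>) \<alpha>"
  shows "(\<Prod>i\<in>UNIV. (1 + \<bar>real_of_int (k $ i)\<bar>) powr e) \<le> CARD('d) powr \<bar>\<beta>\<bar> * freq_weight \<alpha> \<beta> k"
proof -
  let ?u = "\<lambda>i. 1 + \<bar>real_of_int (k $ i)\<bar> :: real" and ?m = "min (\<alpha> + \<beta>) \<alpha>"
  have u: "1 \<le> ?u i" for i by simp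
  have "1 \<le> CARD('d) powr \<bar>\<beta>\<bar> * freq_weight \<alpha> \<beta> k * (\<Prod>i\<in>UNIV. ratio_weight \<alpha> \<beta> (1 / ?u i))"
    using level_weight_le_freq_weight[of \<alpha> \<beta> 0 k] by (simp add: level_weight_def)
  also have "(\<Prod>i\<in>UNIV. ratio_weight \<alpha> \<beta> (1 / ?u i)) \<le> (\<Prod>i\<in>UNIV. 1 / ?u i powr e)"
  proof (intro prod_mono conjI)
    fix i
    have "ratio_weight \<alpha> \<beta> (1 / ?u i) = (1 / ?u i) powr ?m"
      using u[of i] by (intro ratio_weight_le_1) (auto simp: field_simps)
    also have "\<dots> \<le> (1 / ?u i) powr e"
      using assms u[of i] by (intro powr_mono') (auto simp: field_simps)
    finally show "ratio_weight \<alpha> \<beta> (1 / ?u i) \<le> 1 / ?u i powr e"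
      using u[of i] by (simp add: powr_divide)
  qed auto
  also have "(\<Prod>i\<in>UNIV. 1 / ?u i powr e) = 1 / (\<Prod>i\<in>UNIV. ?u i powr e)"
    by (simp add: prod_dividef)
  finally have *: "1 \<le> CARD('d) powr \<bar>\<beta>\<bar> * freq_weight \<alpha> \<beta> k * (1 / (\<Prod>i\<in>UNIV. ?u i powr e))"
    by (simp add: mult_left_mono)
  have "0 < (\<Prod>i\<in>UNIV. ?u i powr e)" by (intro prod_pos) (auto intro!: add_pos_nonneg simp: powr_gt_zero)
  thus ?thesis using * by (simp add: field_simps)
qed

section \<open>One-dimensional symbols\<close>

lemma D_set_abs_le: "l \<in> D_set j \<Longrightarrow> \<bar>real_of_int l\<bar> \<le> 2 ^ j / 2"
  by (auto simp: D_set_def)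

lemma D_set_mono: "i \<le> j \<Longrightarrow> D_set i \<subseteq> D_set j"
proof
  fix l assume "i \<le> j" and l: "l \<in> D_set i"
  have "(2::real) ^ i \<le> 2 ^ j" using \<open>i \<le> j\<close> by (intro power_increasing) auto
  with l show "l \<in> D_set j" unfolding D_set_def mem_Collect_eq by linarith
qed

lemma not_in_D_set_abs_ge: "l \<notin> D_set j \<Longrightarrow> 2 ^ j / 2 \<le> \<bar>real_of_int l\<bar>"
  by (auto simp: D_set_def)

lemma finite_D_set [simp]: "finite (D_set j)"
proof (rule finite_subset)
  show "D_set j \<subseteq> {-(2 ^ j)..2 ^ j}"
  proof
    fix l assume "l \<in> D_set j"
    hence "\<bar>real_of_int l\<bar> \<le> 2 ^ j" using D_set_abs_le[of l j] zero_le_power[of "2::real" j] by linarith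
    hence "real_of_int l \<le> real_of_int (2 ^ j)" "real_of_int (- (2 ^ j)) \<le> real_of_int l"
      by (simp_all only: of_int_power of_int_minus of_int_numeral abs_le_iff) linarith+
    thus "l \<in> {-(2 ^ j)..2 ^ j}" by (simp only: of_int_le_iff atLeastAtMost_iff)
  qed
qed simp

text \<open>\<open>D_set j\<close> lies in a half-open interval of length 2^j, so it contains at
  most one element of each residue class.\<close>

lemma D_set_congruent_unique:
  assumes "l \<in> D_set j" "l' \<in> D_set j" "2 ^ j dvd k - l" "2 ^ j dvd k - l'"
  shows "l = l'"
proof (rule ccontr)
  assume "l \<noteq> l'"
  have "2 ^ j dvd (k - l') - (k - l)" using assms dvd_diff by blast
  hence "(2::int) ^ j dvd \<bar>l - l'\<bar>" by simp
  hence "(2::int) ^ j \<le> \<bar>l - l'\<bar>" using \<open>l \<noteq> l'\<close> by (intro zdvd_imp_le) auto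
  moreover have "real_of_int \<bar>l - l'\<bar> < real_of_int (2 ^ j)"
    using assms(1,2) unfolding D_set_def mem_Collect_eq of_int_abs of_int_diff of_int_power of_int_numeral
    by linarith
  hence "\<bar>l - l'\<bar> < 2 ^ j" by (simp only: of_int_less_iff)
  ultimately show False by simp
qed

text \<open>\<open>a\<close> and \<open>b\<close> stand for the Fourier coefficients of
  \<open>\<phi>\<close> and of the distribution \<open>\<phi>t\<close>. The number \<open>e\<close>
  is the order of growth granted to \<open>b\<close>; the damped alias bound \<open>b_le\<close> is
  the form in which either alternative hypothesis is used.\<close>

locale quasi_interp_symbols =
  fixes q q' :: ennreal and \<alpha> \<beta> s e Ca Cs Cb :: real and a b :: "nat \<Rightarrow> int \<Rightarrow> complex"
  assumes q: "1 \<le> q" and conj: "1 / q + 1 / q' = 1"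
    and \<alpha>: "0 < \<alpha>" and \<alpha>\<beta>: "0 < \<alpha> + \<beta>" and s: "max (\<alpha> + \<beta>) \<alpha> < s"
    and e: "0 \<le> e" "e < min (\<alpha> + \<beta>) \<alpha>"
    and a_le: "\<And>j l. norm (a j l) \<le> Ca"
    and ab: "\<And>j l. l \<in> D_set j \<Longrightarrow> norm (1 - a j l * b j l) \<le> Cs * \<bar>of_int l / 2 ^ j\<bar> powr s"
    and b_le: "\<And>j l. l \<in> D_set j \<Longrightarrow>
      lq_norm q' (\<lambda>\<mu>. ennreal (norm (b j (l + 2 ^ j * \<mu>)) * (1 + \<bar>of_int (l + 2 ^ j * \<mu>)\<bar> / 2 ^ j) powr (- e)))
        \<le> ennreal Cb"
    and Cb: "0 \<le> Cb"
begin

lemma q': "1 \<le> q'"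
  using conjugate_exponent_ge_1[OF q conj] .

lemma Ca_nonneg: "0 \<le> Ca"
  using a_le[of 0 0] norm_ge_zero order_trans by blast

lemma Cs_nonneg: "0 \<le> Cs"
proof -
  \<comment> \<open>Frequency 0 gives no information, as the right-hand side vanishes there; level 1
    is the first to contain a nonzero frequency, namely -1.\<close>
  have "0 \<le> Cs * \<bar>of_int (-1) / 2 ^ 1\<bar> powr s"
    by (rule order_trans[OF norm_ge_zero ab]) (simp add: D_set_def)
  thus ?thesis by (simp add: zero_le_mult_iff)
qed

text \<open>\<open>l\<close> is the representative of \<open>k\<close> at level \<open>j\<close>:
  the exponentials with frequencies k and l coincide on the 2^j sampling points.\<close>

definition aliasing :: "nat \<Rightarrow> int \<Rightarrow> int \<Rightarrow> bool" where
  "aliasing j l k \<longleftrightarrow> l \<in> D_set j \<and> 2 ^ j dvd (k - l)"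

lemma aliasing_unique: "aliasing j l k \<Longrightarrow> aliasing j l' k \<Longrightarrow> l = l'"
  unfolding aliasing_def using D_set_congruent_unique by blast

text \<open>Matrix entry of the operator of level \<open>j\<close> on Fourier coefficients, from
  input frequency \<open>k\<close> to output frequency \<open>l\<close>.\<close>

definition Q_symbol :: "nat \<Rightarrow> int \<Rightarrow> int \<Rightarrow> complex" where
  "Q_symbol j l k = (if aliasing j l k then a j l * b j k else 0)"

text \<open>The case j = 0 encodes Q_(-1) = 0; truncated subtraction alone would subtract level 0
  from itself.\<close>

definition eta_symbol :: "nat \<Rightarrow> int \<Rightarrow> int \<Rightarrow> complex" where
  "eta_symbol j l k = Q_symbol j l k - (if j = 0 then 0 else Q_symbol (j - 1) l k)"

lemma eta_symbol_eq_0: "l \<notin> D_set j \<Longrightarrow> eta_symbol j l k = 0"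
  using D_set_mono[of "j - 1" j] by (auto simp: eta_symbol_def Q_symbol_def aliasing_def)

text \<open>The level-\<open>j\<close> symbol is split into a part that is summable with exponent \<open>q'\<close> over the
  aliasing frequencies \<open>k\<close> and a part that decays geometrically in the level.\<close>

definition aliased_decay :: "nat \<Rightarrow> int \<Rightarrow> int \<Rightarrow> real" where
  "aliased_decay j l k = (if aliasing j l k then norm (b j k) * (1 + \<bar>of_int k\<bar> / 2 ^ j) powr (- e) else 0)"

text \<open>\<open>i\<close> is the level of the operator and \<open>j\<close> that of the block;
  the cases i = j and i = j - 1 occur. The weight contributes the exponent min(\<alpha>+\<beta>,
  \<alpha>), of which the growth of \<open>b\<close> takes back \<open>e\<close>.\<close>

definition low_level :: "nat \<Rightarrow> nat \<Rightarrow> int \<Rightarrow> int \<Rightarrow> real" where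
  "low_level i j l k = (if aliasing i l k \<and> 2 ^ j \<le> 4 * (1 + \<bar>real_of_int k\<bar>)
     then (2 ^ j / (1 + \<bar>of_int k\<bar>)) powr (min (\<alpha> + \<beta>) \<alpha> - e) else 0)"

text \<open>Of the \<open>s\<close> powers supplied by the compatibility condition the weight
  consumes max(\<alpha>+\<beta>, \<alpha>). The written factor 1 is the constant \<open>c\<close> of
  \<open>lq_norm_dyadic_decreasing_le\<close>.\<close>

definition high_level :: "nat \<Rightarrow> int \<Rightarrow> int \<Rightarrow> real" where
  "high_level j l k = (if l = k \<and> 1 + \<bar>real_of_int k\<bar> \<le> 1 * 2 ^ j
     then ((1 + \<bar>of_int k\<bar>) / 2 ^ j) powr (s - max (\<alpha> + \<beta>) \<alpha>) else 0)"

text \<open>The diagonal summand is the partner of \<open>high_level\<close>, which lives on l = k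
  and needs a row factor of at least 1 there.\<close>

definition row_kernel :: "nat \<Rightarrow> int \<Rightarrow> int \<Rightarrow> real" where
  "row_kernel j l k = aliased_decay j l k + (if j = 0 then 0 else aliased_decay (j - 1) l k)
     + (if k = l then 1 else 0)"

definition col_kernel :: "nat \<Rightarrow> int \<Rightarrow> int \<Rightarrow> real" where
  "col_kernel j l k = low_level j j l k + (if j = 0 then 0 else low_level (j - 1) j l k) + high_level j l k"

lemma kernel_nonneg [simp]:
  "0 \<le> aliased_decay j l k" "0 \<le> low_level i j l k" "0 \<le> high_level j l k"
  "0 \<le> row_kernel j l k" "0 \<le> col_kernel j l k"
  by (auto simp: aliased_decay_def low_level_def high_level_def row_kernel_def col_kernel_def)

lemma lq_norm_zero [simp]: "lq_norm q' (\<lambda>_::int. 0) = 0"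
  using lq_norm_single_le[OF q', of 0 0] by simp

text \<open>The support lies in the residue class of \<open>l\<close>, which is enumerated by \<mu>;
  after this reindexing the bound is \<open>b_le\<close>.\<close>

lemma lq_norm_aliased_decay_le: "lq_norm q' (\<lambda>k. ennreal (aliased_decay j l k)) \<le> ennreal Cb"
proof (cases "l \<in> D_set j")
  case False
  thus ?thesis by (simp add: aliased_decay_def aliasing_def)
next
  case True
  have "lq_norm q' (\<lambda>k. ennreal (aliased_decay j l k)) \<le>
    lq_norm q' (\<lambda>\<mu>. ennreal (norm (b j (l + 2 ^ j * \<mu>)) * (1 + \<bar>of_int (l + 2 ^ j * \<mu>)\<bar> / 2 ^ j) powr (- e)))"
  proof (rule lq_norm_mono_reindex[OF q', where h = "\<lambda>k. (k - l) div 2 ^ j"])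
    have *: "k = l + 2 ^ j * ((k - l) div 2 ^ j)" if "ennreal (aliased_decay j l k) \<noteq> 0" for k
      using that by (auto simp: aliased_decay_def aliasing_def split: if_splits)
    show "inj_on (\<lambda>k. (k - l) div 2 ^ j) {k. ennreal (aliased_decay j l k) \<noteq> 0}"
    proof (rule inj_onI)
      fix x y assume x: "x \<in> {k. ennreal (aliased_decay j l k) \<noteq> 0}"
        and y: "y \<in> {k. ennreal (aliased_decay j l k) \<noteq> 0}"
        and eq: "(x - l) div 2 ^ j = (y - l) div 2 ^ j"
      have "x = l + 2 ^ j * ((x - l) div 2 ^ j)" "y = l + 2 ^ j * ((y - l) div 2 ^ j)"
        using x y by (auto intro!: *)
      with eq show "x = y" by (simp only:)
    qed
    show "ennreal (aliased_decay j l k) \<le> ennreal (norm (b j (l + 2 ^ j * ((k - l) div 2 ^ j))) *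
        (1 + \<bar>of_int (l + 2 ^ j * ((k - l) div 2 ^ j))\<bar> / 2 ^ j) powr (- e))"
      if "ennreal (aliased_decay j l k) \<noteq> 0" for k
      unfolding *[OF that, symmetric] by (auto simp: aliased_decay_def)
  qed
  also have "\<dots> \<le> ennreal Cb" using True by (rule b_le)
  finally show ?thesis .
qed

lemma row_kernel_bound:
  obtains C where "\<And>j l. lq_norm q' (\<lambda>k. ennreal (row_kernel j l k)) \<le> ennreal C"
proof -
  have "lq_norm q' (\<lambda>k. ennreal (row_kernel j l k)) \<le> 2 * (2 * (ennreal Cb + ennreal Cb) + 1)" for j l
  proof -
    let ?f = "\<lambda>k. ennreal (aliased_decay j l k)"
    let ?g = "\<lambda>k. ennreal (if j = 0 then 0 else aliased_decay (j - 1) l k)"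
    let ?h = "\<lambda>k. if k = l then 1 else 0 :: ennreal"
    have g: "lq_norm q' ?g \<le> ennreal Cb"
      by (cases "j = 0") (simp_all add: lq_norm_aliased_decay_le)
    have "(\<lambda>k. ennreal (row_kernel j l k)) = (\<lambda>k. (?f k + ?g k) + ?h k)"
      by (auto simp: row_kernel_def fun_eq_iff simp flip: ennreal_plus ennreal_1)
    hence "lq_norm q' (\<lambda>k. ennreal (row_kernel j l k)) \<le> 2 * (lq_norm q' (\<lambda>k. ?f k + ?g k) + lq_norm q' ?h)"
      using lq_norm_add_le[OF q'] by simp
    also have "\<dots> \<le> 2 * (2 * (ennreal Cb + ennreal Cb) + 1)"
      by (intro mult_left_mono add_mono lq_norm_single_le[OF q']
            order_trans[OF lq_norm_add_le[OF q']] lq_norm_aliased_decay_le g) auto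
    finally show ?thesis .
  qed
  moreover obtain C where "2 * (2 * (ennreal Cb + ennreal Cb) + 1) = ennreal C"
    by (cases "2 * (2 * (ennreal Cb + ennreal Cb) + 1)") (auto simp: ennreal_mult_eq_top_iff)
  ultimately show ?thesis using that by auto
qed

text \<open>For fixed \<open>k\<close> each level has at most one representative \<open>l\<close>,
  so the pair index collapses to the level and a geometric sum remains. The map \<open>h\<close>
  covers both operator levels of a block.\<close>

lemma lq_norm_low_level_le:
  "lq_norm q (\<lambda>(j, l). ennreal (low_level (h j) j l k)) \<le>
    ennreal (4 powr (min (\<alpha> + \<beta>) \<alpha> - e) / (1 - 2 powr (- (min (\<alpha> + \<beta>) \<alpha> - e))))"
proof -
  have "lq_norm q (\<lambda>(j, l). ennreal (low_level (h j) j l k)) \<le>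
    lq_norm q (\<lambda>j. ennreal (if 2 ^ j \<le> 4 * (1 + \<bar>real_of_int k\<bar>)
       then (2 ^ j / (1 + \<bar>of_int k\<bar>)) powr (min (\<alpha> + \<beta>) \<alpha> - e) else 0))"
    by (rule lq_norm_mono_reindex[OF q, where h = fst])
       (auto simp: low_level_def inj_on_def split: if_splits dest: aliasing_unique)
  also have "\<dots> \<le> ennreal (4 powr (min (\<alpha> + \<beta>) \<alpha> - e) / (1 - 2 powr (- (min (\<alpha> + \<beta>) \<alpha> - e))))"
    using e by (intro lq_norm_dyadic_increasing_le q) (auto intro: add_pos_nonneg)
  finally show ?thesis .
qed

lemma col_kernel_bound:
  obtains C where "\<And>k. lq_norm q (\<lambda>(j, l). ennreal (col_kernel j l k)) \<le> ennreal C"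
proof -
  let ?L = "4 powr (min (\<alpha> + \<beta>) \<alpha> - e) / (1 - 2 powr (- (min (\<alpha> + \<beta>) \<alpha> - e)))"
  let ?H = "1 powr (s - max (\<alpha> + \<beta>) \<alpha>) / (1 - 2 powr (- (s - max (\<alpha> + \<beta>) \<alpha>)))"
  have "lq_norm q (\<lambda>(j, l). ennreal (col_kernel j l k)) \<le> 2 * (2 * (ennreal ?L + ennreal ?L) + ennreal ?H)" for k
  proof -
    let ?f = "\<lambda>(j, l). ennreal (low_level j j l k)"
    let ?g = "\<lambda>(j, l). ennreal (low_level (j - 1) j l k)"
    let ?h = "\<lambda>(j, l). ennreal (high_level j l k)"
    have h: "lq_norm q ?h \<le> ennreal ?H"
    proof -
      have "lq_norm q ?h \<le> lq_norm q (\<lambda>j. ennreal (if 1 + \<bar>real_of_int k\<bar> \<le> 1 * 2 ^ j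
           then ((1 + \<bar>of_int k\<bar>) / 2 ^ j) powr (s - max (\<alpha> + \<beta>) \<alpha>) else 0))"
        by (rule lq_norm_mono_reindex[OF q, where h = fst])
           (auto simp: high_level_def inj_on_def split: if_splits)
      also have "\<dots> \<le> ennreal ?H"
        using s by (intro lq_norm_dyadic_decreasing_le q) (auto intro: add_pos_nonneg)
      finally show ?thesis .
    qed
    have "lq_norm q (\<lambda>(j, l). ennreal (col_kernel j l k)) \<le> lq_norm q (\<lambda>x. (?f x + ?g x) + ?h x)"
      by (intro lq_norm_mono q) (auto simp: col_kernel_def simp flip: ennreal_plus intro!: ennreal_leI)
    also have "\<dots> \<le> 2 * (lq_norm q (\<lambda>x. ?f x + ?g x) + lq_norm q ?h)"
      by (rule lq_norm_add_le[OF q])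
    also have "\<dots> \<le> 2 * (2 * (ennreal ?L + ennreal ?L) + ennreal ?H)"
      by (intro mult_left_mono add_mono h order_trans[OF lq_norm_add_le[OF q]]
          lq_norm_low_level_le[of "\<lambda>j. j"] lq_norm_low_level_le[of "\<lambda>j. j - 1"]) auto
    finally show ?thesis .
  qed
  moreover obtain C where "2 * (2 * (ennreal ?L + ennreal ?L) + ennreal ?H) = ennreal C"
    by (cases "2 * (2 * (ennreal ?L + ennreal ?L) + ennreal ?H)") (auto simp: ennreal_mult_eq_top_iff)
  ultimately show ?thesis using that by auto
qed

lemma norm_Q_symbol_le:
  "norm (Q_symbol j l k) \<le> Ca * aliased_decay j l k * (1 + \<bar>of_int k\<bar> / 2 ^ j) powr e"
proof (cases "aliasing j l k")
  case True
  have "0 < 1 + \<bar>of_int k\<bar> / (2 ^ j :: real)" by (intro add_pos_nonneg) auto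
  hence "norm (b j k) = aliased_decay j l k * (1 + \<bar>of_int k\<bar> / 2 ^ j) powr e"
    using True by (simp add: aliased_decay_def mult.assoc flip: powr_add)
  hence "norm (Q_symbol j l k) = norm (a j l) * (aliased_decay j l k * (1 + \<bar>of_int k\<bar> / 2 ^ j) powr e)"
    using True by (simp add: Q_symbol_def norm_mult)
  also have "\<dots> \<le> Ca * (aliased_decay j l k * (1 + \<bar>of_int k\<bar> / 2 ^ j) powr e)"
    by (intro mult_right_mono a_le) auto
  finally show ?thesis by (simp add: mult.assoc)
qed (use Ca_nonneg in \<open>auto simp: Q_symbol_def\<close>)

text \<open>At levels j and j - 1 such a frequency represents itself, so the leading 1 cancels and
  the difference of two compatibility errors is left; their order \<open>s\<close> beats the growth
  of the weight.\<close>

lemma eta_symbol_high_level: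
  assumes j: "0 < j" and k: "k \<in> D_set (j - 1)"
  shows "norm (eta_symbol j l k) * ratio_weight \<alpha> \<beta> (2 ^ j / (1 + \<bar>of_int k\<bar>))
      \<le> Cs * (1 + 2 powr s) * high_level j l k"
proof (cases "l = k")
  case False
  have "\<not> aliasing j l k" "\<not> aliasing (j - 1) l k"
    using False k D_set_mono[of "j - 1" j] aliasing_unique[of j l k k] aliasing_unique[of "j - 1" l k k]
    by (auto simp: aliasing_def)
  hence "eta_symbol j l k = 0" by (simp add: eta_symbol_def Q_symbol_def)
  thus ?thesis using Cs_nonneg by simp
next
  case True
  let ?u = "1 + \<bar>real_of_int k\<bar>"
  have k': "k \<in> D_set j" using k D_set_mono[of "j - 1" j] by auto
  have p: "(2::real) ^ j = 2 * 2 ^ (j - 1)" using j by (simp flip: power_Suc)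
  have u1: "1 \<le> ?u" by simp
  have u: "?u \<le> 2 ^ j"
    using D_set_abs_le[OF k] one_le_power[of "2::real" "j - 1"] unfolding p by linarith
  have "eta_symbol j l k = (1 - a (j-1) k * b (j-1) k) - (1 - a j k * b j k)"
    using True k k' j by (simp add: eta_symbol_def Q_symbol_def aliasing_def)
  hence "norm (eta_symbol j l k) \<le> Cs * \<bar>of_int k / 2 ^ (j - 1)\<bar> powr s + Cs * \<bar>of_int k / 2 ^ j\<bar> powr s"
    using norm_triangle_ineq4[of "1 - a (j-1) k * b (j-1) k" "1 - a j k * b j k"] ab[OF k] ab[OF k'] by simp
  \<comment> \<open>|k| / 2^(j-1) is twice |k| / 2^j, whence the summand 2^s in the
    constant.\<close>
  also have "\<dots> \<le> Cs * (2 * (?u / 2 ^ j)) powr s + Cs * (?u / 2 ^ j) powr s"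
    using s \<alpha> Cs_nonneg p by (intro add_mono mult_left_mono powr_mono2) (auto simp: field_simps)
  also have "\<dots> = Cs * (1 + 2 powr s) * (?u / 2 ^ j) powr s"
    by (subst powr_mult) (auto simp: algebra_simps)
  finally have "norm (eta_symbol j l k) \<le> Cs * (1 + 2 powr s) * (?u / 2 ^ j) powr s" .
  moreover have rw: "ratio_weight \<alpha> \<beta> (2 ^ j / ?u) = (?u / 2 ^ j) powr (- max (\<alpha> + \<beta>) \<alpha>)"
  proof -
    have "ratio_weight \<alpha> \<beta> (2 ^ j / ?u) = (2 ^ j / ?u) powr max (\<alpha> + \<beta>) \<alpha>"
      using u u1 by (intro ratio_weight_ge_1) (simp add: field_simps)
    thus ?thesis by (simp add: powr_minus flip: inverse_powr)
  qed
  ultimately have "norm (eta_symbol j l k) * ratio_weight \<alpha> \<beta> (2 ^ j / ?u)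
      \<le> Cs * (1 + 2 powr s) * (?u / 2 ^ j) powr s * (?u / 2 ^ j) powr (- max (\<alpha> + \<beta>) \<alpha>)"
    unfolding rw by (intro mult_right_mono powr_ge_zero)
  also have "Cs * (1 + 2 powr s) * (?u / 2 ^ j) powr s * (?u / 2 ^ j) powr (- max (\<alpha> + \<beta>) \<alpha>)
     = Cs * (1 + 2 powr s) * (?u / 2 ^ j) powr (s - max (\<alpha> + \<beta>) \<alpha>)"
    by (simp add: powr_diff powr_minus divide_inverse)
  also have "(?u / 2 ^ j) powr (s - max (\<alpha> + \<beta>) \<alpha>) = high_level j l k"
    using True u by (simp add: high_level_def)
  finally show ?thesis .
qed

text \<open>A frequency outside D_(j-1) satisfies |k| \<ge> 2^j / 4, so the ratio in the weight is
  at most 4 and the smaller exponent governs it. The two operators are estimated separately, without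
  cancellation.\<close>

lemma eta_symbol_low_level:
  assumes j: "j = 0 \<or> k \<notin> D_set (j - 1)"
  shows "norm (eta_symbol j l k) * ratio_weight \<alpha> \<beta> (2 ^ j / (1 + \<bar>of_int k\<bar>))
      \<le> Ca * 10 powr e * 4 powr \<bar>\<beta>\<bar> *
        (aliased_decay j l k * low_level j j l k
         + (if j = 0 then 0 else aliased_decay (j - 1) l k * low_level (j - 1) j l k))"
proof -
  let ?u = "1 + \<bar>real_of_int k\<bar>" and ?m = "min (\<alpha> + \<beta>) \<alpha>"
  define y where "y = 2 ^ j / ?u"
  have u: "1 \<le> ?u" by simp
  have ju: "2 ^ j \<le> 4 * ?u"
  proof (cases "j = 0")
    case False
    have "(2::real) ^ j = 2 * 2 ^ (j - 1)" using False by (simp flip: power_Suc)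
    thus ?thesis using not_in_D_set_abs_ge[of k "j - 1"] j False by simp
  qed simp
  have y: "0 < y" "y \<le> 4" unfolding y_def using ju u by (auto simp: field_simps)
  have r: "ratio_weight \<alpha> \<beta> y \<le> 4 powr \<bar>\<beta>\<bar> * y powr ?m"
    using y by (intro ratio_weight_le) auto
  have *: "norm (Q_symbol i l k) * ratio_weight \<alpha> \<beta> y
      \<le> Ca * 10 powr e * 4 powr \<bar>\<beta>\<bar> * (aliased_decay i l k * low_level i j l k)"
    if i: "i = j \<or> i = j - 1" for i
  proof (cases "aliasing i l k")
    case True
    have "(2::real) ^ j \<le> 2 * 2 ^ i" using i by (cases j) auto
    hence "\<bar>real_of_int k\<bar> * 2 ^ j \<le> \<bar>real_of_int k\<bar> * (2 * 2 ^ i)" by (intro mult_left_mono) auto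
    hence "1 + \<bar>real_of_int k\<bar> / 2 ^ i \<le> 1 + 2 * \<bar>real_of_int k\<bar> / 2 ^ j"
      by (simp add: field_simps)
    also have "\<dots> = (2 ^ j + 2 * \<bar>real_of_int k\<bar>) / 2 ^ j" by (simp add: add_divide_distrib)
    \<comment> \<open>By 2^j \<le> 4 * ?u the numerator is at most 6 * ?u; 10 is a roomy
      constant.\<close>
    also have "\<dots> \<le> 10 * ?u / 2 ^ j" using ju by (intro divide_right_mono) auto
    also have "\<dots> = 10 / y" unfolding y_def by simp
    finally have "(1 + \<bar>of_int k\<bar> / 2 ^ i) powr e \<le> (10 / y) powr e"
      using e by (intro powr_mono2) (auto intro!: add_nonneg_nonneg)
    also have "\<dots> = 10 powr e * y powr (- e)"
      using y by (subst powr_divide) (auto simp: powr_minus divide_inverse)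
    finally have 1: "norm (Q_symbol i l k) \<le> Ca * aliased_decay i l k * (10 powr e * y powr (- e))"
      using Ca_nonneg by (intro order_trans[OF norm_Q_symbol_le] mult_left_mono) auto
    have "norm (Q_symbol i l k) * ratio_weight \<alpha> \<beta> y
      \<le> Ca * aliased_decay i l k * (10 powr e * y powr (- e)) * (4 powr \<bar>\<beta>\<bar> * y powr ?m)"
      using Ca_nonneg by (intro mult_mono 1 r) auto
    also have "\<dots> = Ca * 10 powr e * 4 powr \<bar>\<beta>\<bar> * (aliased_decay i l k * (y powr (- e) * y powr ?m))"
      by (simp only: mult_ac)
    also have "y powr (- e) * y powr ?m = low_level i j l k"
      using True ju unfolding low_level_def y_def by (simp flip: powr_add)
    finally show ?thesis .
  qed (use Ca_nonneg in \<open>simp add: Q_symbol_def\<close>)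
  have "norm (eta_symbol j l k) * ratio_weight \<alpha> \<beta> y \<le>
      norm (Q_symbol j l k) * ratio_weight \<alpha> \<beta> y
       + (if j = 0 then 0 else norm (Q_symbol (j - 1) l k) * ratio_weight \<alpha> \<beta> y)"
    unfolding eta_symbol_def
    using mult_right_mono[OF norm_triangle_ineq4[of "Q_symbol j l k" "Q_symbol (j - 1) l k"], of "ratio_weight \<alpha> \<beta> y"]
    by (simp add: distrib_right)
  also have "\<dots> \<le> Ca * 10 powr e * 4 powr \<bar>\<beta>\<bar> * (aliased_decay j l k * low_level j j l k)
      + (if j = 0 then 0 else Ca * 10 powr e * 4 powr \<bar>\<beta>\<bar> * (aliased_decay (j - 1) l k * low_level (j - 1) j l k))"
    using *[of j] *[of "j - 1"] by (intro add_mono) auto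
  finally show ?thesis unfolding y_def by (cases "j = 0") (simp_all add: distrib_left)
qed

lemma eta_symbol_bound:
  obtains C where "0 \<le> C"
    "\<And>j l k. norm (eta_symbol j l k) * ratio_weight \<alpha> \<beta> (2 ^ j / (1 + \<bar>of_int k\<bar>))
      \<le> C * (row_kernel j l k * col_kernel j l k)"
proof
  let ?A = "Cs * (1 + 2 powr s)" and ?B = "Ca * 10 powr e * 4 powr \<bar>\<beta>\<bar>"
  have AB: "0 \<le> ?A" "0 \<le> ?B" using Cs_nonneg Ca_nonneg by auto
  show "0 \<le> ?A + ?B" using AB by simp
  fix j l k
  let ?x = "norm (eta_symbol j l k) * ratio_weight \<alpha> \<beta> (2 ^ j / (1 + \<bar>of_int k\<bar>))"
  show "?x \<le> (?A + ?B) * (row_kernel j l k * col_kernel j l k)"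
  proof (cases "j = 0 \<or> k \<notin> D_set (j - 1)")
    case True
    have "?x \<le> ?B * (aliased_decay j l k * low_level j j l k
         + (if j = 0 then 0 else aliased_decay (j - 1) l k * low_level (j - 1) j l k))"
      using True by (rule eta_symbol_low_level)
    also have "\<dots> \<le> ?B * (row_kernel j l k * col_kernel j l k)"
      unfolding row_kernel_def col_kernel_def
      by (intro mult_left_mono AB) (auto simp: distrib_left distrib_right intro!: add_nonneg_nonneg)
    also have "\<dots> \<le> (?A + ?B) * (row_kernel j l k * col_kernel j l k)"
      using AB by (intro mult_right_mono) auto
    finally show ?thesis .
  next
    case False
    hence "?x \<le> ?A * high_level j l k" by (intro eta_symbol_high_level) auto
    \<comment> \<open>On the diagonal the row kernel is at least 1, elsewhere
      \<open>high_level\<close> is 0.\<close>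
    also have "high_level j l k \<le> row_kernel j l k * col_kernel j l k"
    proof (cases "k = l")
      case True
      hence "1 * high_level j l k \<le> row_kernel j l k * col_kernel j l k"
        unfolding row_kernel_def col_kernel_def by (intro mult_mono) auto
      thus ?thesis by simp
    qed (simp add: high_level_def)
    finally have "?x \<le> ?A * (row_kernel j l k * col_kernel j l k)"
      using AB by (simp add: mult_left_mono)
    also have "\<dots> \<le> (?A + ?B) * (row_kernel j l k * col_kernel j l k)"
      using AB by (intro mult_right_mono) auto
    finally show ?thesis .
  qed
qed

lemma eta_symbol_telescope: "(\<Sum>j\<le>n. eta_symbol j l k) = Q_symbol n l k"
  by (induction n) (simp_all add: eta_symbol_def)

text \<open>Eventually \<open>l\<close> lies in D_n and |k - l| < 2^n, so aliasing means l = k, and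
  there the compatibility condition forces the limit 1.\<close>

lemma Q_symbol_tendsto: "(\<lambda>n. Q_symbol n l k) \<longlonglongrightarrow> (if l = k then 1 else 0)"
proof -
  obtain n0 where n0: "\<bar>k - l\<bar> < 2 ^ n0" "2 * \<bar>l\<bar> < 2 ^ n0"
  proof -
    obtain n where "max \<bar>k - l\<bar> (2 * \<bar>l\<bar>) < 2 ^ n"
      using real_arch_pow[of 2 "real_of_int (max \<bar>k - l\<bar> (2 * \<bar>l\<bar>))"]
      by (metis of_int_less_iff of_int_numeral of_int_power one_less_numeral_iff semiring_norm(76))
    thus ?thesis using that by auto
  qed
  have ge: "\<bar>k - l\<bar> < 2 ^ n" "2 * \<bar>l\<bar> < 2 ^ n" if "n \<ge> n0" for n
    using power_increasing[OF that, of "2::int"] n0 by linarith+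
  have D: "l \<in> D_set n" if "n \<ge> n0" for n
  proof -
    have "real_of_int (2 * \<bar>l\<bar>) < real_of_int (2 ^ n)"
      using ge(2)[OF that] by (simp only: of_int_less_iff)
    thus ?thesis by (auto simp: D_set_def abs_if split: if_splits)
  qed
  show ?thesis
  proof (cases "l = k")
    case False
    have "Q_symbol n l k = 0" if "n \<ge> n0" for n
    proof -
      have "\<not> 2 ^ n dvd k - l"
        using ge(1)[OF that] False zdvd_imp_le[of "2 ^ n" "\<bar>k - l\<bar>"] by auto
      thus ?thesis by (simp add: Q_symbol_def aliasing_def)
    qed
    hence "\<forall>\<^sub>F n in sequentially. Q_symbol n l k = 0"
      by (auto simp: eventually_sequentially)
    thus ?thesis using False by (simp add: tendsto_eventually)
  next
    case True
    have "(\<lambda>n. \<bar>of_int k / 2 ^ n\<bar> powr s) \<longlonglongrightarrow> 0"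
    proof -
      have "(\<lambda>n. \<bar>real_of_int k\<bar> * (1/2) ^ n) \<longlonglongrightarrow> \<bar>real_of_int k\<bar> * 0"
        by (intro tendsto_intros LIMSEQ_realpow_zero) auto
      hence "(\<lambda>n. \<bar>real_of_int k / 2 ^ n\<bar>) \<longlonglongrightarrow> 0"
        by (simp add: abs_mult power_divide)
      thus ?thesis
        by (rule tendsto_zero_powrI[OF _ tendsto_const]) (use s \<alpha> in auto)
    qed
    hence lim: "(\<lambda>n. Cs * \<bar>of_int k / 2 ^ n\<bar> powr s) \<longlonglongrightarrow> Cs * 0" by (intro tendsto_intros)
    have "(\<lambda>n. Q_symbol n l k - 1) \<longlonglongrightarrow> 0"
    proof (rule Lim_null_comparison)
      show "(\<lambda>n. Cs * \<bar>of_int k / 2 ^ n\<bar> powr s) \<longlonglongrightarrow> 0" using lim by simp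
      show "\<forall>\<^sub>F n in sequentially. norm (Q_symbol n l k - 1) \<le> Cs * \<bar>of_int k / 2 ^ n\<bar> powr s"
        unfolding eventually_sequentially
      proof (intro exI allI impI)
        fix n assume "n \<ge> n0"
        thus "norm (Q_symbol n l k - 1) \<le> Cs * \<bar>of_int k / 2 ^ n\<bar> powr s"
          using ab[of k n] D[of n] True by (simp add: Q_symbol_def aliasing_def norm_minus_commute)
      qed
    qed
    thus ?thesis using True by (simp add: LIM_zero_iff)
  qed
qed

end

section \<open>Norm estimates for the coefficients\<close>

lemma inj_vec_components: "inj (\<lambda>(k :: 'a ^ 'd) i. k $ i)"
  by (auto simp: inj_def vec_eq_iff fun_eq_iff)

lemma inj_vec_pair_components: "inj (\<lambda>(w :: ('a ^ 'd) \<times> ('b ^ 'd)) i. (fst w $ i, snd w $ i))"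
  by (auto simp: inj_def vec_eq_iff fun_eq_iff prod_eq_iff)

lemma summable_on_if_ennreal_finite:
  fixes f :: "'a \<Rightarrow> real"
  assumes "(\<Sum>\<^sub>\<infinity>x\<in>UNIV. ennreal (f x)) < top" "\<And>x. 0 \<le> f x"
  shows "f summable_on UNIV"
proof (rule nonneg_bdd_above_summable_on)
  show "bdd_above (sum f ` {F. F \<subseteq> UNIV \<and> finite F})"
  proof (rule bdd_aboveI2)
    fix F :: "'a set" assume "F \<in> {F. F \<subseteq> UNIV \<and> finite F}"
    hence "ennreal (sum f F) \<le> (\<Sum>\<^sub>\<infinity>x\<in>UNIV. ennreal (f x))"
      using assms(2) sum_le_infsum_ennreal[of F UNIV "\<lambda>x. ennreal (f x)"] by (simp add: sum_ennreal)
    thus "sum f F \<le> enn2real (\<Sum>\<^sub>\<infinity>x\<in>UNIV. ennreal (f x))"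
      using assms by (metis enn2real_ennreal enn2real_mono sum_nonneg)
  qed
qed (use assms in auto)

lemma infsum_ennreal_eq:
  fixes f :: "'a \<Rightarrow> real"
  assumes "f summable_on UNIV" "\<And>x. 0 \<le> f x"
  shows "(\<Sum>\<^sub>\<infinity>x\<in>UNIV. ennreal (f x)) = ennreal (infsum f UNIV)"
  using assms infsum_nonneg_is_SUPREMUM_ennreal[of f UNIV] by (simp add: infsum_ennreal_SUP sum_ennreal)

lemma level_weight_shift:
  "level_weight \<alpha>' \<beta> j = 2 powr (- ((\<alpha> - \<alpha>') * real (\<Sum>i\<in>UNIV. j $ i))) * level_weight \<alpha> \<beta> j"
  unfolding level_weight_def by (simp add: algebra_simps flip: powr_add)

lemma freq_weight_mono:
  assumes "\<alpha>' \<le> \<alpha>"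
  shows "freq_weight \<alpha>' \<beta> k \<le> freq_weight \<alpha> \<beta> k"
  unfolding freq_weight_def using assms
  by (intro mult_right_mono prod_mono conjI powr_mono) auto

text \<open>On D_j the frequency is at most of the order of the level, so up to a constant the
  weights differ in each direction by a positive power of (1 + |l|) / 2^j. The square root of this
  power serves as both kernels of the Schur test: for fixed l it sums geometrically over levels, for
  fixed (j, l) it is a single entry.\<close>

lemma synthesis_bound:
  fixes q q' :: ennreal
  assumes q: "1 \<le> q" and conj: "1 / q + 1 / q' = 1" and \<alpha>: "0 < \<alpha>" "0 < \<alpha> + \<beta>"
  obtains C where "0 \<le> C"
    "\<And>X :: nat ^ 'd \<Rightarrow> int ^ 'd \<Rightarrow> ennreal. (\<And>j l. l \<notin> D_box j \<Longrightarrow> X j l = 0) \<Longrightarrow>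
      lq_norm q (\<lambda>l. ennreal (freq_weight \<alpha> \<beta> l) * (\<Sum>\<^sub>\<infinity>j\<in>UNIV. X j l))
        \<le> ennreal C * lq_norm q (\<lambda>j. ennreal (level_weight \<alpha> \<beta> j) * lq_norm q (X j))"
proof -
  define m where "m = min (\<alpha> + \<beta>) \<alpha>"
  have m: "m > 0" unfolding m_def using \<alpha> by auto
  have q': "1 \<le> q'" by (rule conjugate_exponent_ge_1[OF q conj])
  \<comment> \<open>The frequency is kept in the index \<open>w\<close>, so that summation over
    levels becomes a kernel between frequencies and pairs. The constant 2 is admissible on D_j,
    where |l| \<le> 2^j / 2 and 1 \<le> 2^j.\<close>
  define \<kappa> :: "int \<Rightarrow> nat \<times> int \<Rightarrow> real" where
    "\<kappa> l w = (if l = snd w \<and> 1 + \<bar>real_of_int l\<bar> \<le> 2 * 2 ^ fst w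
       then ((1 + \<bar>of_int l\<bar>) / 2 ^ fst w) powr (m / 2) else 0)" for l w
  have \<kappa>_nn: "0 \<le> \<kappa> l w" for l w by (simp add: \<kappa>_def)
  define G where "G = 2 powr (m / 2) / (1 - 2 powr (- (m / 2)))"
  have row: "lq_norm r (\<lambda>w. ennreal (\<kappa> l w)) \<le> ennreal G" if "1 \<le> r" for r l
  proof -
    have "lq_norm r (\<lambda>w. ennreal (\<kappa> l w)) \<le> lq_norm r (\<lambda>j. ennreal (if 1 + \<bar>real_of_int l\<bar> \<le> 2 * 2 ^ j
       then ((1 + \<bar>of_int l\<bar>) / 2 ^ j) powr (m / 2) else 0))"
      by (rule lq_norm_mono_reindex[OF that, where h = fst])
         (auto simp: \<kappa>_def inj_on_def split: if_splits)
    also have "\<dots> \<le> ennreal G"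
      unfolding G_def using m by (intro lq_norm_dyadic_decreasing_le that) (auto intro: add_pos_nonneg)
    finally show ?thesis .
  qed
  have col: "lq_norm r (\<lambda>l. ennreal (\<kappa> l w)) \<le> ennreal G" if r: "1 \<le> r" for r w
  proof -
    have "lq_norm r (\<lambda>l. ennreal (\<kappa> l w)) = lq_norm r (\<lambda>l. if l = snd w then ennreal (\<kappa> (snd w) w) else 0)"
      by (intro arg_cong[where f = "lq_norm r"] ext) (auto simp: \<kappa>_def)
    also have "\<dots> \<le> ennreal (\<kappa> (snd w) w)" by (rule lq_norm_single_le[OF r])
    also have "\<dots> \<le> lq_norm r (\<lambda>w'. ennreal (\<kappa> (snd w) w'))" by (rule le_lq_norm[OF r])
    also have "\<dots> \<le> ennreal G" by (rule row[OF r])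
    finally show ?thesis .
  qed
  define c0 where "c0 = real CARD('d) powr \<bar>\<beta>\<bar> * (2 powr \<bar>\<beta>\<bar>) ^ CARD('d)"
  have c0: "0 \<le> c0" by (simp add: c0_def)
  have key: "freq_weight \<alpha> \<beta> l \<le> (\<Prod>i\<in>UNIV. \<kappa> (l $ i) (j $ i, l $ i)) * (\<Prod>i\<in>UNIV. \<kappa> (l $ i) (j $ i, l $ i))
      * (c0 * level_weight \<alpha> \<beta> j)" if l: "l \<in> D_box j" for l :: "int ^ 'd" and j
  proof -
    let ?t = "\<lambda>i. (1 + \<bar>real_of_int (l $ i)\<bar>) / 2 ^ (j $ i)"
    have t: "0 < ?t i" "?t i \<le> 2" for i
    proof -
      have "\<bar>real_of_int (l $ i)\<bar> \<le> 2 ^ (j $ i) / 2" using l by (intro D_set_abs_le) (auto simp: D_box_def)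
      moreover have "(1::real) \<le> 2 ^ (j $ i)" by simp
      ultimately have "1 + \<bar>real_of_int (l $ i)\<bar> \<le> 2 * 2 ^ (j $ i)" by linarith
      thus "?t i \<le> 2" by (simp add: field_simps)
      show "0 < ?t i" by (intro divide_pos_pos add_pos_nonneg) auto
    qed
    have "freq_weight \<alpha> \<beta> l \<le> CARD('d) powr \<bar>\<beta>\<bar> * level_weight \<alpha> \<beta> j * (\<Prod>i\<in>UNIV. ratio_weight \<alpha> \<beta> (?t i))"
      by (rule freq_weight_le_level_weight)
    also have "\<dots> \<le> CARD('d) powr \<bar>\<beta>\<bar> * level_weight \<alpha> \<beta> j * (\<Prod>i\<in>UNIV. 2 powr \<bar>\<beta>\<bar> * ?t i powr m)"
      unfolding m_def using t by (intro mult_left_mono prod_mono conjI ratio_weight_le mult_nonneg_nonneg) auto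
    also have "(\<Prod>i\<in>UNIV. 2 powr \<bar>\<beta>\<bar> * ?t i powr m) = (2 powr \<bar>\<beta>\<bar>) ^ CARD('d) * (\<Prod>i\<in>UNIV. ?t i powr m)"
      by (simp add: prod.distrib)
    also have "(\<Prod>i\<in>UNIV. ?t i powr m) = (\<Prod>i\<in>UNIV. \<kappa> (l $ i) (j $ i, l $ i) * \<kappa> (l $ i) (j $ i, l $ i))"
    proof (intro prod.cong refl)
      fix i
      have "1 + \<bar>real_of_int (l $ i)\<bar> \<le> 2 * 2 ^ (j $ i)" using t(2)[of i] by (simp add: field_simps)
      hence "\<kappa> (l $ i) (j $ i, l $ i) = ?t i powr (m / 2)" by (simp add: \<kappa>_def)
      moreover have "?t i powr m = ?t i powr (m / 2) * ?t i powr (m / 2)" by (simp flip: powr_add)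
      ultimately show "?t i powr m = \<kappa> (l $ i) (j $ i, l $ i) * \<kappa> (l $ i) (j $ i, l $ i)" by (simp only:)
    qed
    finally show ?thesis by (simp add: c0_def prod.distrib mult_ac)
  qed
  show thesis
  proof
    show "0 \<le> G ^ CARD('d) * G ^ CARD('d) * c0"
      using c0 by (simp add: zero_le_mult_iff)
    fix X :: "nat ^ 'd \<Rightarrow> int ^ 'd \<Rightarrow> ennreal"
    assume X: "\<And>j l. l \<notin> D_box j \<Longrightarrow> X j l = 0"
    define K :: "int ^ 'd \<Rightarrow> (nat ^ 'd) \<times> (int ^ 'd) \<Rightarrow> ennreal" where
      "K l w = (\<Prod>i\<in>UNIV. ennreal (\<kappa> (l $ i) (fst w $ i, snd w $ i)))" for l w
    define y where "y w = ennreal c0 * (ennreal (level_weight \<alpha> \<beta> (fst w)) * X (fst w) (snd w))" for w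
    have Krow: "lq_norm q' (K l) \<le> ennreal G ^ CARD('d)" for l
    proof -
      have "lq_norm q' (K l) \<le> (\<Prod>i\<in>(UNIV :: 'd set). lq_norm q' (\<lambda>w. ennreal (\<kappa> (l $ i) w)))"
        unfolding K_def using lq_norm_prod_le[OF q' inj_vec_pair_components, of "\<lambda>i w. ennreal (\<kappa> (l $ i) w)"] .
      also have "\<dots> \<le> (\<Prod>i\<in>(UNIV :: 'd set). ennreal G)" by (intro prod_mono_ennreal row q')
      finally show ?thesis by simp
    qed
    have Kcol: "lq_norm q (\<lambda>l. K l w) \<le> ennreal G ^ CARD('d)" for w
    proof -
      have "lq_norm q (\<lambda>l. K l w) \<le> (\<Prod>i\<in>(UNIV :: 'd set). lq_norm q (\<lambda>l. ennreal (\<kappa> l (fst w $ i, snd w $ i))))"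
        unfolding K_def using lq_norm_prod_le[OF q inj_vec_components, of "\<lambda>i l. ennreal (\<kappa> l (fst w $ i, snd w $ i))"] .
      also have "\<dots> \<le> (\<Prod>i\<in>(UNIV :: 'd set). ennreal G)" by (intro prod_mono_ennreal col q)
      finally show ?thesis by simp
    qed
    have "lq_norm q (\<lambda>l. ennreal (freq_weight \<alpha> \<beta> l) * (\<Sum>\<^sub>\<infinity>j\<in>UNIV. X j l))
        \<le> lq_norm q (\<lambda>l. \<Sum>\<^sub>\<infinity>w\<in>UNIV. K l w * K l w * y w)"
    proof (rule lq_norm_mono[OF q])
      fix l
      have le: "ennreal (freq_weight \<alpha> \<beta> l) * X j l \<le> K l (j, l) * K l (j, l) * y (j, l)" for j
      proof (cases "l \<in> D_box j")
        case True
        have "ennreal (freq_weight \<alpha> \<beta> l) * X j l \<le> ennreal ((\<Prod>i\<in>UNIV. \<kappa> (l $ i) (j $ i, l $ i)) * (\<Prod>i\<in>UNIV. \<kappa> (l $ i) (j $ i, l $ i))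
          * (c0 * level_weight \<alpha> \<beta> j)) * X j l"
          by (intro mult_right_mono ennreal_leI key True) simp
        also have "\<dots> = K l (j, l) * K l (j, l) * y (j, l)"
          using c0 \<kappa>_nn by (simp add: K_def y_def ennreal_mult prod_nonneg prod_ennreal mult.assoc)
        finally show ?thesis .
      qed (simp add: X)
      have "ennreal (freq_weight \<alpha> \<beta> l) * (\<Sum>\<^sub>\<infinity>j\<in>UNIV. X j l) = (\<Sum>\<^sub>\<infinity>j\<in>UNIV. ennreal (freq_weight \<alpha> \<beta> l) * X j l)"
        by (rule infsum_cmult_ennreal[symmetric])
      also have "\<dots> \<le> (\<Sum>\<^sub>\<infinity>w\<in>UNIV. K l w * K l w * y w)"
        by (rule infsum_le_reindex_ennreal[where h = "\<lambda>j. (j, l)"]) (auto simp: inj_on_def le)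
      finally show "ennreal (freq_weight \<alpha> \<beta> l) * (\<Sum>\<^sub>\<infinity>j\<in>UNIV. X j l) \<le> \<dots>" .
    qed
    also have "\<dots> \<le> ennreal G ^ CARD('d) * ennreal G ^ CARD('d) * lq_norm q y"
      by (rule lq_norm_kernel_le[OF q conj Krow Kcol])
    also have "lq_norm q y = ennreal c0 * lq_norm q (\<lambda>j. ennreal (level_weight \<alpha> \<beta> j) * lq_norm q (X j))"
      unfolding y_def using q
      by (simp add: lq_norm_cmult lq_norm_lq_norm[of q "\<lambda>j l. ennreal (level_weight \<alpha> \<beta> j) * X j l", symmetric])
    also have "ennreal G ^ CARD('d) * ennreal G ^ CARD('d) * \<dots> =
      ennreal (G ^ CARD('d) * G ^ CARD('d) * c0) * lq_norm q (\<lambda>j. ennreal (level_weight \<alpha> \<beta> j) * lq_norm q (X j))"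
    proof -
      have "0 \<le> G" unfolding G_def using m powr_less_mono[of "- (m / 2)" 0 2] by simp
      thus ?thesis using c0 by (simp add: ennreal_mult ennreal_power mult.assoc)
    qed
    finally show "lq_norm q (\<lambda>l. ennreal (freq_weight \<alpha> \<beta> l) * (\<Sum>\<^sub>\<infinity>j\<in>UNIV. X j l))
        \<le> ennreal (G ^ CARD('d) * G ^ CARD('d) * c0) * lq_norm q (\<lambda>j. ennreal (level_weight \<alpha> \<beta> j) * lq_norm q (X j))" .
  qed
qed

text \<open>The triangle inequality for series; if the norms are not summable, the right-hand side
  is top.\<close>

lemma ennreal_norm_has_sum_le:
  fixes f :: "'a \<Rightarrow> complex"
  assumes "(f has_sum S) UNIV"
  shows "ennreal (norm S) \<le> (\<Sum>\<^sub>\<infinity>x\<in>UNIV. ennreal (norm (f x)))"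
proof (cases "(\<lambda>x. norm (f x)) summable_on UNIV")
  case True
  have "norm S \<le> infsum (\<lambda>x. norm (f x)) UNIV"
    using assms True by (metis infsumI norm_infsum_bound)
  thus ?thesis using True by (simp add: infsum_ennreal_eq ennreal_leI)
next
  case False
  hence "(\<Sum>\<^sub>\<infinity>x\<in>UNIV. ennreal (norm (f x))) = top"
    using summable_on_if_ennreal_finite[of "\<lambda>x. norm (f x)"] top.not_eq_extremum norm_ge_zero by blast
  thus ?thesis by simp
qed

text \<open>The tail is measured with an exponent \<gamma> strictly below \<alpha>. Passing from
  \<alpha> to \<gamma> gains a power of 2^(-|j|_1) with exponent \<alpha> - \<gamma>, so the tail
  over |j|_1 \<ge> R is uniformly small. Smallness comes from this gap and not from the tail of a
  convergent sum, which is why it also holds for q = \<infinity>.\<close>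

lemma synthesis_tendsto:
  fixes q q' :: ennreal and \<eta> :: "nat ^ 'd \<Rightarrow> int ^ 'd \<Rightarrow> complex"
  assumes q: "1 \<le> q" and conj: "1 / q + 1 / q' = 1" and \<alpha>: "0 < \<alpha>" "0 < \<alpha> + \<beta>" and \<alpha>': "\<alpha>' < \<alpha>"
    and supp: "\<And>j l. l \<notin> D_box j \<Longrightarrow> \<eta> j l = 0"
    and sum: "\<And>l. ((\<lambda>j. \<eta> j l) has_sum c l) UNIV"
    and fin: "lq_norm q (\<lambda>j. ennreal (level_weight \<alpha> \<beta> j) * lq_norm q (\<lambda>l. ennreal (norm (\<eta> j l)))) < top"
  shows "((\<lambda>F. lq_norm q (\<lambda>l. ennreal (freq_weight \<alpha>' \<beta> l * norm (c l - (\<Sum>j\<in>F. \<eta> j l))))) \<longlongrightarrow> 0)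
    (finite_subsets_at_top UNIV)"
proof -
  \<comment> \<open>Every exponent above \<delta> is positive and stays positive after adding
    \<beta>. Choosing \<gamma> at least halfway from \<delta> to \<alpha>, and at least \<alpha>',
    makes \<open>synthesis_bound\<close> applicable to it.\<close>
  define \<delta> where "\<delta> = max 0 (- \<beta>)"
  have \<delta>: "0 \<le> \<delta>" "- \<beta> \<le> \<delta>" "\<delta> < \<alpha>" unfolding \<delta>_def using \<alpha> by auto
  define \<gamma> where "\<gamma> = max \<alpha>' ((\<alpha> + \<delta>) / 2)"
  have "\<alpha>' \<le> \<gamma>" "\<gamma> < \<alpha>" and ge: "(\<alpha> + \<delta>) / 2 \<le> \<gamma>"
    unfolding \<gamma>_def using \<alpha>' \<delta>(3) by simp_all
  moreover from ge \<delta>(1,3) have "0 < \<gamma>" by (simp add: field_simps)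
  moreover from ge \<delta> have "0 < \<gamma> + \<beta>" by (auto simp: field_simps)
  ultimately have \<gamma>: "0 < \<gamma>" "0 < \<gamma> + \<beta>" "\<gamma> < \<alpha>" "\<alpha>' \<le> \<gamma>" by simp_all
  obtain C where C: "0 \<le> C" "\<And>X :: nat ^ 'd \<Rightarrow> int ^ 'd \<Rightarrow> ennreal. (\<And>j l. l \<notin> D_box j \<Longrightarrow> X j l = 0) \<Longrightarrow>
      lq_norm q (\<lambda>l. ennreal (freq_weight \<gamma> \<beta> l) * (\<Sum>\<^sub>\<infinity>j\<in>UNIV. X j l))
        \<le> ennreal C * lq_norm q (\<lambda>j. ennreal (level_weight \<gamma> \<beta> j) * lq_norm q (X j))"
    using synthesis_bound[OF q conj \<gamma>(1,2)] by blast
  obtain T where T: "lq_norm q (\<lambda>j. ennreal (level_weight \<alpha> \<beta> j) * lq_norm q (\<lambda>l. ennreal (norm (\<eta> j l)))) = ennreal T"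
    "0 \<le> T" using fin unfolding less_top_ennreal by auto
  have bound: "lq_norm q (\<lambda>l. ennreal (freq_weight \<alpha>' \<beta> l * norm (c l - (\<Sum>j\<in>F. \<eta> j l))))
      \<le> ennreal (C * 2 powr (- ((\<alpha> - \<gamma>) * real R)) * T)"
    if F: "finite F" "\<And>j. (\<Sum>i\<in>UNIV. j $ i) < R \<Longrightarrow> j \<in> F" for F R
  proof -
    \<comment> \<open>Only the levels outside F remain, all of them with |j|_1 \<ge> R.\<close>
    define X where "X j l = (if j \<in> F then 0 else ennreal (norm (\<eta> j l)))" for j l
    have "lq_norm q (\<lambda>l. ennreal (freq_weight \<alpha>' \<beta> l * norm (c l - (\<Sum>j\<in>F. \<eta> j l))))
        \<le> lq_norm q (\<lambda>l. ennreal (freq_weight \<gamma> \<beta> l) * (\<Sum>\<^sub>\<infinity>j\<in>UNIV. X j l))"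
    proof (rule lq_norm_mono[OF q])
      fix l
      have "((\<lambda>j. if j \<in> F then \<eta> j l else 0) has_sum (\<Sum>j\<in>F. \<eta> j l)) UNIV"
        using has_sum_finite[OF F(1), of "\<lambda>j. \<eta> j l"]
        by (subst has_sum_cong_neutral[where T = F and g = "\<lambda>j. \<eta> j l"]) auto
      hence "((\<lambda>j. - (if j \<in> F then \<eta> j l else 0)) has_sum - (\<Sum>j\<in>F. \<eta> j l)) UNIV"
        by (rule has_sum_uminusI)
      from has_sum_add[OF sum[of l] this]
      have "((\<lambda>j. if j \<in> F then 0 else \<eta> j l) has_sum (c l - (\<Sum>j\<in>F. \<eta> j l))) UNIV"
        by (simp add: if_distrib cong: if_cong)
      from ennreal_norm_has_sum_le[OF this]
      have "ennreal (norm (c l - (\<Sum>j\<in>F. \<eta> j l))) \<le> (\<Sum>\<^sub>\<infinity>j\<in>UNIV. X j l)"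
        by (simp add: X_def if_distrib cong: if_cong)
      moreover have "ennreal (freq_weight \<alpha>' \<beta> l) \<le> ennreal (freq_weight \<gamma> \<beta> l)"
        by (intro ennreal_leI freq_weight_mono \<gamma>)
      ultimately show "ennreal (freq_weight \<alpha>' \<beta> l * norm (c l - (\<Sum>j\<in>F. \<eta> j l)))
          \<le> ennreal (freq_weight \<gamma> \<beta> l) * (\<Sum>\<^sub>\<infinity>j\<in>UNIV. X j l)"
        by (simp add: ennreal_mult mult_mono)
    qed
    also have "\<dots> \<le> ennreal C * lq_norm q (\<lambda>j. ennreal (level_weight \<gamma> \<beta> j) * lq_norm q (X j))"
      by (rule C) (simp add: X_def supp)
    also have "lq_norm q (\<lambda>j. ennreal (level_weight \<gamma> \<beta> j) * lq_norm q (X j)) \<le>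
      lq_norm q (\<lambda>j. ennreal (2 powr (- ((\<alpha> - \<gamma>) * real R))) *
         (ennreal (level_weight \<alpha> \<beta> j) * lq_norm q (\<lambda>l. ennreal (norm (\<eta> j l)))))"
    proof (rule lq_norm_mono[OF q])
      fix j
      show "ennreal (level_weight \<gamma> \<beta> j) * lq_norm q (X j) \<le> ennreal (2 powr (- ((\<alpha> - \<gamma>) * real R))) *
         (ennreal (level_weight \<alpha> \<beta> j) * lq_norm q (\<lambda>l. ennreal (norm (\<eta> j l))))"
      proof (cases "j \<in> F")
        case True
        hence "lq_norm q (X j) = 0 * lq_norm q (\<lambda>l. 0)"
          using lq_norm_cmult[OF q, of 0 "\<lambda>l. 0"] by (simp add: X_def[abs_def])
        thus ?thesis by simp
      next
        case False
        hence "R \<le> (\<Sum>i\<in>UNIV. j $ i)" using F(2)[of j] not_less by blast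
        hence "(\<alpha> - \<gamma>) * real R \<le> (\<alpha> - \<gamma>) * real (\<Sum>i\<in>UNIV. j $ i)"
          using \<gamma> by (intro mult_left_mono of_nat_mono) auto
        hence "2 powr (- ((\<alpha> - \<gamma>) * real (\<Sum>i\<in>UNIV. j $ i))) \<le> 2 powr (- ((\<alpha> - \<gamma>) * real R))"
          by (intro powr_mono) auto
        hence "level_weight \<gamma> \<beta> j \<le> 2 powr (- ((\<alpha> - \<gamma>) * real R)) * level_weight \<alpha> \<beta> j"
          unfolding level_weight_shift[of \<gamma> \<beta> j \<alpha>] by (rule mult_right_mono) simp
        hence "ennreal (level_weight \<gamma> \<beta> j) \<le> ennreal (2 powr (- ((\<alpha> - \<gamma>) * real R))) * ennreal (level_weight \<alpha> \<beta> j)"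
          by (subst ennreal_mult[symmetric]) (auto intro: ennreal_leI)
        thus ?thesis using False by (simp add: X_def[abs_def] mult_right_mono flip: mult.assoc)
      qed
    qed
    also have "\<dots> = ennreal (2 powr (- ((\<alpha> - \<gamma>) * real R))) * ennreal T"
      by (simp only: lq_norm_cmult[OF q] T)
    finally show ?thesis
      using C(1) T(2) by (simp add: mult_left_mono ennreal_mult mult.assoc)
  qed
  have "((\<lambda>R. C * 2 powr (- ((\<alpha> - \<gamma>) * real R)) * T) \<longlongrightarrow> C * 0 * T) sequentially"
  proof (intro tendsto_intros)
    have "(2 powr (- (\<alpha> - \<gamma>))) < (1::real)" using \<gamma> powr_less_mono[of "- (\<alpha> - \<gamma>)" 0 2] by simp
    hence "(\<lambda>R. (2 powr (- (\<alpha> - \<gamma>))) ^ R :: real) \<longlonglongrightarrow> 0" by (intro LIMSEQ_realpow_zero) auto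
    thus "(\<lambda>R. 2 powr (- ((\<alpha> - \<gamma>) * real R)) :: real) \<longlonglongrightarrow> 0"
      by (simp add: powr_power algebra_simps)
  qed
  hence lim: "((\<lambda>R. C * 2 powr (- ((\<alpha> - \<gamma>) * real R)) * T) \<longlongrightarrow> 0) sequentially" by simp
  show ?thesis
  proof (rule order_tendstoI)
    fix \<epsilon> :: ennreal assume "\<epsilon> > 0"
    then obtain x where x: "0 < x" "x < \<epsilon>" using dense by blast
    hence "x < top" using order_less_le_trans top_greatest by blast
    with x obtain r where r: "0 < ennreal r" "ennreal r < \<epsilon>" unfolding less_top_ennreal by auto
    hence "r > 0" by (simp add: ennreal_less_zero_iff)
    from order_tendstoD(2)[OF lim this] obtain R where R: "C * 2 powr (- ((\<alpha> - \<gamma>) * real R)) * T < r"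
      by (auto simp: eventually_sequentially)
    have fin_R: "finite {j :: nat ^ 'd. (\<Sum>i\<in>UNIV. j $ i) < R}"
    proof (rule finite_subset)
      show "{j :: nat ^ 'd. (\<Sum>i\<in>UNIV. j $ i) < R} \<subseteq> (\<lambda>v. \<chi> i. v i) ` PiE UNIV (\<lambda>_. {..R})"
      proof
        fix j :: "nat ^ 'd" assume "j \<in> {j. (\<Sum>i\<in>UNIV. j $ i) < R}"
        moreover have "j $ i \<le> (\<Sum>i\<in>UNIV. j $ i)" for i by (rule member_le_sum) auto
        ultimately have "(\<lambda>i. j $ i) \<in> PiE UNIV (\<lambda>_. {..R})"
          by (auto intro: order_trans[OF _ less_imp_le])
        moreover have "j = (\<chi> i. j $ i)" by simp
        ultimately show "j \<in> (\<lambda>v. \<chi> i. v i) ` PiE UNIV (\<lambda>_. {..R})" by blast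
      qed
    qed (intro finite_imageI finite_PiE finite finite_atMost)
    show "\<forall>\<^sub>F F in finite_subsets_at_top UNIV.
        lq_norm q (\<lambda>l. ennreal (freq_weight \<alpha>' \<beta> l * norm (c l - (\<Sum>j\<in>F. \<eta> j l)))) < \<epsilon>"
      unfolding eventually_finite_subsets_at_top
    proof (intro exI[of _ "{j :: nat ^ 'd. (\<Sum>i\<in>UNIV. j $ i) < R}"] conjI fin_R allI impI)
      fix F assume F: "finite F \<and> {j :: nat ^ 'd. (\<Sum>i\<in>UNIV. j $ i) < R} \<subseteq> F \<and> F \<subseteq> UNIV"
      have "lq_norm q (\<lambda>l. ennreal (freq_weight \<alpha>' \<beta> l * norm (c l - (\<Sum>j\<in>F. \<eta> j l))))
          \<le> ennreal (C * 2 powr (- ((\<alpha> - \<gamma>) * real R)) * T)"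
        using F by (intro bound) auto
      also have "\<dots> \<le> ennreal r" using R by (intro ennreal_leI) simp
      finally show "lq_norm q (\<lambda>l. ennreal (freq_weight \<alpha>' \<beta> l * norm (c l - (\<Sum>j\<in>F. \<eta> j l)))) < \<epsilon>"
        using r by simp
    qed simp
  qed simp
qed

section \<open>Analysis: from coefficients to blocks, and the exchange of sums\<close>

context quasi_interp_symbols
begin

text \<open>Absolute values inside the sum over \<open>k\<close> let the bound serve twice: it
  estimates the block norms, and with \<open>synthesis_bound\<close> it gives the absolute
  convergence behind the exchange of sums.\<close>

lemma analysis_bound:
  obtains C where "0 \<le> C"
    "\<And>c :: int ^ 'd \<Rightarrow> complex. lq_norm q (\<lambda>j :: nat ^ 'd. ennreal (level_weight \<alpha> \<beta> j) *
        lq_norm q (\<lambda>l. \<Sum>\<^sub>\<infinity>k\<in>UNIV. ennreal ((\<Prod>i\<in>UNIV. norm (eta_symbol (j $ i) (l $ i) (k $ i))) * norm (c k))))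
      \<le> ennreal C * lq_norm q (\<lambda>k. ennreal (freq_weight \<alpha> \<beta> k * norm (c k)))"
proof -
  obtain C0 where C0: "0 \<le> C0" "\<And>j l k. norm (eta_symbol j l k) * ratio_weight \<alpha> \<beta> (2 ^ j / (1 + \<bar>of_int k\<bar>))
      \<le> C0 * (row_kernel j l k * col_kernel j l k)"
    using eta_symbol_bound by blast
  obtain A where A: "\<And>j l. lq_norm q' (\<lambda>k. ennreal (row_kernel j l k)) \<le> ennreal A"
    using row_kernel_bound by blast
  obtain B where B: "\<And>k. lq_norm q (\<lambda>(j, l). ennreal (col_kernel j l k)) \<le> ennreal B"
    using col_kernel_bound by blast
  define c0 where "c0 = real CARD('d) powr \<bar>\<beta>\<bar> * C0 ^ CARD('d)"
  have c0: "0 \<le> c0" using C0 by (simp add: c0_def)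
  define K1 :: "(nat ^ 'd) \<times> (int ^ 'd) \<Rightarrow> int ^ 'd \<Rightarrow> ennreal" where
    "K1 w k = (\<Prod>i\<in>UNIV. ennreal (row_kernel (fst w $ i) (snd w $ i) (k $ i)))" for w k
  define K2 :: "(nat ^ 'd) \<times> (int ^ 'd) \<Rightarrow> int ^ 'd \<Rightarrow> ennreal" where
    "K2 w k = (\<Prod>i\<in>UNIV. ennreal (col_kernel (fst w $ i) (snd w $ i) (k $ i)))" for w k
  have K1: "lq_norm q' (K1 w) \<le> ennreal A ^ CARD('d)" for w
  proof -
    have "lq_norm q' (K1 w) \<le> (\<Prod>i\<in>(UNIV :: 'd set). lq_norm q' (\<lambda>k. ennreal (row_kernel (fst w $ i) (snd w $ i) k)))"
      unfolding K1_def
      using lq_norm_prod_le[OF q' inj_vec_components, of "\<lambda>i k. ennreal (row_kernel (fst w $ i) (snd w $ i) k)"] .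
    also have "\<dots> \<le> (\<Prod>i\<in>(UNIV :: 'd set). ennreal A)" by (intro prod_mono_ennreal A)
    finally show ?thesis by simp
  qed
  have K2: "lq_norm q (\<lambda>w. K2 w k) \<le> ennreal B ^ CARD('d)" for k
  proof -
    have "lq_norm q (\<lambda>w. K2 w k) \<le> (\<Prod>i\<in>(UNIV :: 'd set). lq_norm q (\<lambda>(j, l). ennreal (col_kernel j l (k $ i))))"
      unfolding K2_def
      using lq_norm_prod_le[OF q inj_vec_pair_components, of "\<lambda>i (j, l). ennreal (col_kernel j l (k $ i))"] by simp
    also have "\<dots> \<le> (\<Prod>i\<in>(UNIV :: 'd set). ennreal B)" by (intro prod_mono_ennreal B)
    finally show ?thesis by simp
  qed
  have key: "level_weight \<alpha> \<beta> j * (\<Prod>i\<in>UNIV. norm (eta_symbol (j $ i) (l $ i) (k $ i))) \<le>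
      (\<Prod>i\<in>UNIV. row_kernel (j $ i) (l $ i) (k $ i)) * (\<Prod>i\<in>UNIV. col_kernel (j $ i) (l $ i) (k $ i))
      * (c0 * freq_weight \<alpha> \<beta> k)" for j :: "nat ^ 'd" and l k :: "int ^ 'd"
  proof -
    let ?e = "\<lambda>i. norm (eta_symbol (j $ i) (l $ i) (k $ i))"
    let ?r = "\<lambda>i. ratio_weight \<alpha> \<beta> (2 ^ (j $ i) / (1 + \<bar>of_int (k $ i)\<bar>))"
    have "level_weight \<alpha> \<beta> j * (\<Prod>i\<in>UNIV. ?e i) \<le>
        (real CARD('d) powr \<bar>\<beta>\<bar> * freq_weight \<alpha> \<beta> k * (\<Prod>i\<in>UNIV. ?r i)) * (\<Prod>i\<in>UNIV. ?e i)"
      by (intro mult_right_mono level_weight_le_freq_weight prod_nonneg) auto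
    also have "\<dots> = real CARD('d) powr \<bar>\<beta>\<bar> * freq_weight \<alpha> \<beta> k * (\<Prod>i\<in>UNIV. ?e i * ?r i)"
      by (simp add: prod.distrib mult_ac)
    also have "\<dots> \<le> real CARD('d) powr \<bar>\<beta>\<bar> * freq_weight \<alpha> \<beta> k *
        (\<Prod>i\<in>UNIV. C0 * (row_kernel (j $ i) (l $ i) (k $ i) * col_kernel (j $ i) (l $ i) (k $ i)))"
      by (intro mult_left_mono prod_mono conjI C0 mult_nonneg_nonneg) auto
    finally show ?thesis by (simp add: c0_def prod.distrib mult_ac)
  qed
  show thesis
  proof
    \<comment> \<open>\<open>A\<close> and \<open>B\<close> are obtained without a sign; the passage
      through \<open>ennreal\<close> replaces negative values by 0 and gives a nonnegative
      constant.\<close>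
    show "0 \<le> enn2real (ennreal A ^ CARD('d) * ennreal B ^ CARD('d) * ennreal c0)" by simp
    fix c :: "int ^ 'd \<Rightarrow> complex"
    define y where "y k = ennreal c0 * ennreal (freq_weight \<alpha> \<beta> k * norm (c k))" for k
    let ?f = "\<lambda>j l k. ennreal ((\<Prod>i\<in>UNIV. norm (eta_symbol (j $ i) (l $ i) (k $ i))) * norm (c k))"
    have "lq_norm q (\<lambda>j :: nat ^ 'd. ennreal (level_weight \<alpha> \<beta> j) * lq_norm q (\<lambda>l. \<Sum>\<^sub>\<infinity>k\<in>UNIV. ?f j l k))
      = lq_norm q (\<lambda>w. ennreal (level_weight \<alpha> \<beta> (fst w)) * (\<Sum>\<^sub>\<infinity>k\<in>UNIV. ?f (fst w) (snd w) k))"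
      using q lq_norm_lq_norm[of q "\<lambda>j l. ennreal (level_weight \<alpha> \<beta> j) * (\<Sum>\<^sub>\<infinity>k\<in>UNIV. ?f j l k)"]
      by (simp add: lq_norm_cmult)
    also have "\<dots> \<le> lq_norm q (\<lambda>w. \<Sum>\<^sub>\<infinity>k\<in>UNIV. K1 w k * K2 w k * y k)"
    proof (rule lq_norm_mono[OF q])
      fix w :: "(nat ^ 'd) \<times> (int ^ 'd)"
      obtain j l where w: "w = (j, l)" by (cases w)
      have "ennreal (level_weight \<alpha> \<beta> j) * (\<Sum>\<^sub>\<infinity>k\<in>UNIV. ?f j l k) = (\<Sum>\<^sub>\<infinity>k\<in>UNIV. ennreal (level_weight \<alpha> \<beta> j) * ?f j l k)"
        by (rule infsum_cmult_ennreal[symmetric])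
      also have "\<dots> \<le> (\<Sum>\<^sub>\<infinity>k\<in>UNIV. K1 w k * K2 w k * y k)"
      proof (rule infsum_mono_ennreal)
        fix k
        have "ennreal (level_weight \<alpha> \<beta> j) * ?f j l k =
            ennreal (level_weight \<alpha> \<beta> j * (\<Prod>i\<in>UNIV. norm (eta_symbol (j $ i) (l $ i) (k $ i))) * norm (c k))"
          by (simp add: ennreal_mult prod_nonneg mult.assoc)
        also have "\<dots> \<le> ennreal ((\<Prod>i\<in>UNIV. row_kernel (j $ i) (l $ i) (k $ i)) * (\<Prod>i\<in>UNIV. col_kernel (j $ i) (l $ i) (k $ i))
      * (c0 * freq_weight \<alpha> \<beta> k) * norm (c k))"
          by (intro ennreal_leI mult_right_mono key) auto
        also have "\<dots> = K1 w k * K2 w k * y k"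
          using c0 by (simp add: K1_def K2_def y_def w ennreal_mult prod_nonneg prod_ennreal mult.assoc)
        finally show "ennreal (level_weight \<alpha> \<beta> j) * ?f j l k \<le> K1 w k * K2 w k * y k" .
      qed
      finally show "ennreal (level_weight \<alpha> \<beta> (fst w)) * (\<Sum>\<^sub>\<infinity>k\<in>UNIV. ?f (fst w) (snd w) k) \<le> \<dots>"
        by (simp add: w)
    qed
    also have "\<dots> \<le> ennreal A ^ CARD('d) * ennreal B ^ CARD('d) * lq_norm q y"
      by (rule lq_norm_kernel_le[OF q conj K1 K2])
    also have "lq_norm q y = ennreal c0 * lq_norm q (\<lambda>k. ennreal (freq_weight \<alpha> \<beta> k * norm (c k)))"
      unfolding y_def by (rule lq_norm_cmult[OF q])
    also have "ennreal A ^ CARD('d) * ennreal B ^ CARD('d) * (ennreal c0 * lq_norm q (\<lambda>k. ennreal (freq_weight \<alpha> \<beta> k * norm (c k))))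
      = ennreal (enn2real (ennreal A ^ CARD('d) * ennreal B ^ CARD('d) * ennreal c0)) * lq_norm q (\<lambda>k. ennreal (freq_weight \<alpha> \<beta> k * norm (c k)))"
    proof -
      have "ennreal A ^ CARD('d) * ennreal B ^ CARD('d) * ennreal c0 < top"
        by (auto simp: ennreal_mult_less_top power_less_top_ennreal)
      thus ?thesis by (simp add: mult.assoc)
    qed
    finally show "lq_norm q (\<lambda>j :: nat ^ 'd. ennreal (level_weight \<alpha> \<beta> j) * lq_norm q (\<lambda>l. \<Sum>\<^sub>\<infinity>k\<in>UNIV. ?f j l k))
      \<le> ennreal (enn2real (ennreal A ^ CARD('d) * ennreal B ^ CARD('d) * ennreal c0)) * lq_norm q (\<lambda>k. ennreal (freq_weight \<alpha> \<beta> k * norm (c k)))" .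
  qed
qed

text \<open>On an alias class |b| is its damped version times (1 + |k| / 2^m)^e, and the product of
  these powers is absorbed by the weight because e < min(\<alpha>+\<beta>, \<alpha>). Hoelder
  between the alias bound and the norm of \<open>c\<close> then applies. This is the source of
  well-definedness.\<close>

lemma aliased_sum_summable:
  fixes c :: "int ^ 'd \<Rightarrow> complex" and m :: "nat ^ 'd"
  assumes fin: "lq_norm q (\<lambda>k. ennreal (freq_weight \<alpha> \<beta> k * norm (c k))) < top"
  shows "(\<lambda>k. (\<Prod>i\<in>UNIV. if aliasing (m $ i) (l $ i) (k $ i) then norm (b (m $ i) (k $ i)) else 0) * norm (c k))
    summable_on UNIV"
proof (rule summable_on_if_ennreal_finite)
  let ?f = "\<lambda>k. (\<Prod>i\<in>UNIV. if aliasing (m $ i) (l $ i) (k $ i) then norm (b (m $ i) (k $ i)) else 0) * norm (c k)"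
  let ?D = "real CARD('d) powr \<bar>\<beta>\<bar>"
  have le: "?f k \<le> (\<Prod>i\<in>UNIV. aliased_decay (m $ i) (l $ i) (k $ i)) * (?D * (freq_weight \<alpha> \<beta> k * norm (c k)))" for k
  proof -
    have "(\<Prod>i\<in>UNIV. if aliasing (m $ i) (l $ i) (k $ i) then norm (b (m $ i) (k $ i)) else 0)
       \<le> (\<Prod>i\<in>UNIV. aliased_decay (m $ i) (l $ i) (k $ i) * (1 + \<bar>real_of_int (k $ i)\<bar>) powr e)"
    proof (intro prod_mono conjI)
      fix i
      let ?x = "1 + \<bar>real_of_int (k $ i)\<bar> / 2 ^ (m $ i)"
      have x: "0 < ?x" by (intro add_pos_nonneg) auto
      have "\<bar>real_of_int (k $ i)\<bar> / 2 ^ (m $ i) \<le> \<bar>real_of_int (k $ i)\<bar> / 1"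
        by (intro divide_left_mono) auto
      hence "?x powr e \<le> (1 + \<bar>real_of_int (k $ i)\<bar>) powr e"
        using x e by (intro powr_mono2) auto
      hence "aliased_decay (m $ i) (l $ i) (k $ i) * ?x powr e \<le> aliased_decay (m $ i) (l $ i) (k $ i) * (1 + \<bar>real_of_int (k $ i)\<bar>) powr e"
        by (intro mult_left_mono) auto
      moreover have "(if aliasing (m $ i) (l $ i) (k $ i) then norm (b (m $ i) (k $ i)) else 0) = aliased_decay (m $ i) (l $ i) (k $ i) * ?x powr e"
        using x by (simp add: aliased_decay_def mult.assoc flip: powr_add)
      ultimately show "(if aliasing (m $ i) (l $ i) (k $ i) then norm (b (m $ i) (k $ i)) else 0) \<le>
          aliased_decay (m $ i) (l $ i) (k $ i) * (1 + \<bar>real_of_int (k $ i)\<bar>) powr e" by (simp only:)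
    qed auto
    also have "\<dots> = (\<Prod>i\<in>UNIV. aliased_decay (m $ i) (l $ i) (k $ i)) * (\<Prod>i\<in>UNIV. (1 + \<bar>real_of_int (k $ i)\<bar>) powr e)"
      by (rule prod.distrib)
    also have "\<dots> \<le> (\<Prod>i\<in>UNIV. aliased_decay (m $ i) (l $ i) (k $ i)) * (?D * freq_weight \<alpha> \<beta> k)"
      using e by (intro mult_left_mono prod_powr_le_freq_weight prod_nonneg) auto
    finally have "?f k \<le> (\<Prod>i\<in>UNIV. aliased_decay (m $ i) (l $ i) (k $ i)) * (?D * freq_weight \<alpha> \<beta> k) * norm (c k)"
      by (rule mult_right_mono) simp
    thus ?thesis by (simp add: mult.assoc)
  qed
  have "(\<Sum>\<^sub>\<infinity>k\<in>UNIV. ennreal (?f k)) \<le> (\<Sum>\<^sub>\<infinity>k\<in>UNIV. (\<Prod>i\<in>UNIV. ennreal (aliased_decay (m $ i) (l $ i) (k $ i))) *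
      (ennreal ?D * ennreal (freq_weight \<alpha> \<beta> k * norm (c k))))"
  proof (rule infsum_mono_ennreal)
    fix k
    show "ennreal (?f k) \<le> (\<Prod>i\<in>UNIV. ennreal (aliased_decay (m $ i) (l $ i) (k $ i))) *
      (ennreal ?D * ennreal (freq_weight \<alpha> \<beta> k * norm (c k)))"
      using ennreal_leI[OF le[of k]] by (simp add: ennreal_mult prod_nonneg prod_ennreal)
  qed
  also have "\<dots> \<le> lq_norm q' (\<lambda>k. \<Prod>i\<in>UNIV. ennreal (aliased_decay (m $ i) (l $ i) (k $ i)))
      * lq_norm q (\<lambda>k. ennreal ?D * ennreal (freq_weight \<alpha> \<beta> k * norm (c k)))"
    by (rule lq_norm_Holder[OF q conj])
  also have "\<dots> \<le> ennreal Cb ^ CARD('d) * (ennreal ?D * lq_norm q (\<lambda>k. ennreal (freq_weight \<alpha> \<beta> k * norm (c k))))"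
  proof (intro mult_mono)
    have "lq_norm q' (\<lambda>k :: int ^ 'd. \<Prod>i\<in>UNIV. ennreal (aliased_decay (m $ i) (l $ i) (k $ i)))
        \<le> (\<Prod>i\<in>(UNIV :: 'd set). lq_norm q' (\<lambda>k. ennreal (aliased_decay (m $ i) (l $ i) k)))"
      using lq_norm_prod_le[OF q' inj_vec_components, of "\<lambda>i k. ennreal (aliased_decay (m $ i) (l $ i) k)"] .
    also have "\<dots> \<le> (\<Prod>i\<in>(UNIV :: 'd set). ennreal Cb)" by (intro prod_mono_ennreal lq_norm_aliased_decay_le)
    finally show "lq_norm q' (\<lambda>k. \<Prod>i\<in>UNIV. ennreal (aliased_decay (m $ i) (l $ i) (k $ i))) \<le> ennreal Cb ^ CARD('d)"
      by simp
  qed (auto simp: lq_norm_cmult[OF q])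
  also have "\<dots> < top"
    using fin by (auto simp: ennreal_mult_less_top power_less_top_ennreal)
  finally show "(\<Sum>\<^sub>\<infinity>k\<in>UNIV. ennreal (?f k)) < top" .
qed (auto intro!: mult_nonneg_nonneg prod_nonneg)

text \<open>Once summability is given, the sum may be evaluated along any cofinal sequence of finite
  sets. Along cubes of levels it factorises over the directions, and each factor telescopes.\<close>

lemma has_sum_prod_eta_symbol:
  fixes l k :: "int ^ 'd"
  assumes "(\<lambda>j :: nat ^ 'd. \<Prod>i\<in>UNIV. eta_symbol (j $ i) (l $ i) (k $ i)) summable_on UNIV"
  shows "((\<lambda>j :: nat ^ 'd. \<Prod>i\<in>UNIV. eta_symbol (j $ i) (l $ i) (k $ i)) has_sum (if l = k then 1 else 0)) UNIV"
proof -
  let ?g = "\<lambda>j :: nat ^ 'd. \<Prod>i\<in>UNIV. eta_symbol (j $ i) (l $ i) (k $ i)"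
  define box :: "nat \<Rightarrow> (nat ^ 'd) set" where "box n = (\<lambda>v. \<chi> i. v i) ` PiE UNIV (\<lambda>_. {..n})" for n
  have box_iff: "j \<in> box n \<longleftrightarrow> (\<forall>i. j $ i \<le> n)" for j n
  proof
    assume "\<forall>i. j $ i \<le> n"
    hence "(\<lambda>i. j $ i) \<in> PiE UNIV (\<lambda>_. {..n})" by auto
    moreover have "j = (\<chi> i. j $ i)" by simp
    ultimately show "j \<in> box n" unfolding box_def by blast
  qed (auto simp: box_def)
  have fin: "finite (box n)" for n unfolding box_def by (intro finite_imageI finite_PiE finite finite_atMost)
  have "filterlim box (finite_subsets_at_top UNIV) sequentially"
    unfolding filterlim_finite_subsets_at_top
  proof (intro allI impI)
    fix X :: "(nat ^ 'd) set" assume X: "finite X \<and> X \<subseteq> UNIV"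
    define n0 where "n0 = Max (insert 0 ((\<lambda>(j, i). j $ i) ` (X \<times> UNIV)))"
    have n0: "j $ i \<le> n0" if "j \<in> X" for j i
      unfolding n0_def using X that by (intro Max_ge) (auto intro!: image_eqI[of _ _ "(j, i)"])
    have "X \<subseteq> box n" if "n \<ge> n0" for n
      unfolding box_iff subset_iff using n0 that order_trans by blast
    thus "\<forall>\<^sub>F n in sequentially. finite (box n) \<and> X \<subseteq> box n \<and> box n \<subseteq> UNIV"
      using fin by (auto simp: eventually_sequentially)
  qed
  moreover have "(sum ?g \<longlongrightarrow> infsum ?g UNIV) (finite_subsets_at_top UNIV)"
    using assms has_sum_infsum unfolding has_sum_def by blast
  ultimately have "(\<lambda>n. sum ?g (box n)) \<longlonglongrightarrow> infsum ?g UNIV"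
    by (rule filterlim_compose[rotated])
  moreover have "sum ?g (box n) = (\<Prod>i\<in>UNIV. Q_symbol n (l $ i) (k $ i))" for n
  proof -
    have "sum ?g (box n) = (\<Sum>v\<in>PiE (UNIV :: 'd set) (\<lambda>_. {..n}). \<Prod>i\<in>UNIV. eta_symbol (v i) (l $ i) (k $ i))"
      unfolding box_def by (subst sum.reindex) (auto simp: inj_on_def fun_eq_iff vec_eq_iff)
    also have "\<dots> = (\<Prod>i\<in>UNIV. \<Sum>j\<in>{..n}. eta_symbol j (l $ i) (k $ i))"
      by (subst prod_sum_PiE) auto
    finally show ?thesis by (simp add: eta_symbol_telescope)
  qed
  moreover have "(\<lambda>n. \<Prod>i\<in>UNIV. Q_symbol n (l $ i) (k $ i)) \<longlonglongrightarrow> (\<Prod>i\<in>UNIV. if l $ i = k $ i then 1 else 0)"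
    by (intro tendsto_prod Q_symbol_tendsto)
  ultimately have "infsum ?g UNIV = (\<Prod>i\<in>UNIV. if l $ i = k $ i then 1 else 0)"
    using LIMSEQ_unique by (simp only:) blast
  also have "\<dots> = (if l = k then 1 else 0)"
    by (auto simp: vec_eq_iff)
  finally show ?thesis using has_sum_infsum[OF assms] by simp
qed

text \<open>For a fixed output frequency the double series over levels and input frequencies
  converges absolutely: its weighted total is one entry of a sequence bounded by analysis followed
  by synthesis. Summing over levels first leaves only k = l, summing over k first gives the block
  coefficients.\<close>

lemma has_sum_eta_coeff:
  fixes c :: "int ^ 'd \<Rightarrow> complex"
  assumes fin: "lq_norm q (\<lambda>k. ennreal (freq_weight \<alpha> \<beta> k * norm (c k))) < top"
  shows "((\<lambda>j :: nat ^ 'd. \<Sum>\<^sub>\<infinity>k\<in>UNIV. (\<Prod>i\<in>UNIV. eta_symbol (j $ i) (l $ i) (k $ i)) * c k) has_sum c l) UNIV"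
proof -
  define F where "F w = (\<Prod>i\<in>UNIV. eta_symbol (fst w $ i) (l $ i) (snd w $ i)) * c (snd w)"
    for w :: "(nat ^ 'd) \<times> (int ^ 'd)"
  let ?X = "\<lambda>(j :: nat ^ 'd) l. \<Sum>\<^sub>\<infinity>k\<in>UNIV. ennreal ((\<Prod>i\<in>UNIV. norm (eta_symbol (j $ i) (l $ i) (k $ i))) * norm (c k))"
  obtain C1 where C1: "lq_norm q (\<lambda>j :: nat ^ 'd. ennreal (level_weight \<alpha> \<beta> j) * lq_norm q (?X j))
      \<le> ennreal C1 * lq_norm q (\<lambda>k. ennreal (freq_weight \<alpha> \<beta> k * norm (c k)))"
    by (rule analysis_bound) blast
  obtain C2 where C2: "\<And>X :: nat ^ 'd \<Rightarrow> int ^ 'd \<Rightarrow> ennreal. (\<And>j l. l \<notin> D_box j \<Longrightarrow> X j l = 0) \<Longrightarrow>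
      lq_norm q (\<lambda>l. ennreal (freq_weight \<alpha> \<beta> l) * (\<Sum>\<^sub>\<infinity>j\<in>UNIV. X j l))
        \<le> ennreal C2 * lq_norm q (\<lambda>j. ennreal (level_weight \<alpha> \<beta> j) * lq_norm q (X j))"
    by (rule synthesis_bound[OF q conj \<alpha> \<alpha>\<beta>]) blast
  have X0: "?X j l = 0" if l: "l \<notin> D_box j" for j l
  proof -
    obtain i where i: "l $ i \<notin> D_set (j $ i)" using l by (auto simp: D_box_def)
    hence "(\<Prod>i\<in>UNIV. norm (eta_symbol (j $ i) (l $ i) (k $ i))) = 0" for k
      by (intro prod_zero bexI[of _ i]) (auto simp: i eta_symbol_eq_0)
    thus ?thesis by (simp only: mult_zero_left ennreal_0 infsum_0_simp)
  qed
  have "ennreal (freq_weight \<alpha> \<beta> l) * (\<Sum>\<^sub>\<infinity>j\<in>UNIV. ?X j l) \<le>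
      lq_norm q (\<lambda>l. ennreal (freq_weight \<alpha> \<beta> l) * (\<Sum>\<^sub>\<infinity>j\<in>UNIV. ?X j l))"
    by (rule le_lq_norm[OF q])
  also have "\<dots> \<le> ennreal C2 * lq_norm q (\<lambda>j. ennreal (level_weight \<alpha> \<beta> j) * lq_norm q (?X j))"
    by (rule C2[OF X0])
  also have "\<dots> \<le> ennreal C2 * (ennreal C1 * lq_norm q (\<lambda>k. ennreal (freq_weight \<alpha> \<beta> k * norm (c k))))"
    by (intro mult_left_mono C1) simp
  also have "\<dots> < top" using fin by (auto simp: ennreal_mult_less_top)
  finally have fX: "(\<Sum>\<^sub>\<infinity>j\<in>UNIV. ?X j l) < top"
    using freq_weight_pos[of \<alpha> \<beta> l] by (auto simp: ennreal_mult_less_top)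
  have "(\<Sum>\<^sub>\<infinity>w\<in>UNIV. ennreal (norm (F w))) = (\<Sum>\<^sub>\<infinity>j\<in>UNIV. ?X j l)"
    using infsum_Sigma_ennreal[of "\<lambda>j k. ennreal ((\<Prod>i\<in>UNIV. norm (eta_symbol (j $ i) (l $ i) (k $ i))) * norm (c k))"]
    by (simp add: F_def norm_mult prod_norm)
  hence abs: "(\<lambda>w. norm (F w)) summable_on UNIV"
    using fX by (intro summable_on_if_ennreal_finite) auto
  hence S: "(F has_sum infsum F UNIV) UNIV"
    by (intro has_sum_infsum abs_summable_summable[OF abs])
  have F_j: "(\<lambda>k. F (j, k)) summable_on UNIV" for j
  proof -
    have "F summable_on (\<lambda>k. (j, k)) ` UNIV"
      by (rule summable_on_subset_banach[OF abs_summable_summable[OF abs] subset_UNIV])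
    thus ?thesis by (subst (asm) summable_on_reindex) (auto simp: inj_on_def o_def)
  qed
  have F_k: "(\<lambda>j. F (j, k)) summable_on UNIV" for k
  proof -
    have "F summable_on (\<lambda>j. (j, k)) ` UNIV"
      by (rule summable_on_subset_banach[OF abs_summable_summable[OF abs] subset_UNIV])
    thus ?thesis by (subst (asm) summable_on_reindex) (auto simp: inj_on_def o_def)
  qed
  have inner: "((\<lambda>j. F (j, k)) has_sum (if l = k then c k else 0)) UNIV" for k
  proof (cases "c k = 0")
    case False
    \<comment> \<open>Summability of the bare symbol product is obtained by dividing by c k, hence
      the separate case c k = 0.\<close>
    have "(\<lambda>j. F (j, k) * inverse (c k)) summable_on UNIV"
      by (intro summable_on_cmult_left F_k)
    hence "(\<lambda>j :: nat ^ 'd. \<Prod>i\<in>UNIV. eta_symbol (j $ i) (l $ i) (k $ i)) summable_on UNIV"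
      using False by (simp add: F_def mult.assoc)
    from has_sum_cmult_left[OF has_sum_prod_eta_symbol[OF this], of "c k"]
    show ?thesis by (simp add: F_def if_distrib[of "\<lambda>x. x * c k"] cong: if_cong)
  qed (simp add: F_def)
  have outer: "((\<lambda>j. \<Sum>\<^sub>\<infinity>k\<in>UNIV. F (j, k)) has_sum infsum F UNIV) UNIV"
    by (rule has_sum_SigmaD[where B = "\<lambda>_. UNIV" and f = F]) (use S F_j in \<open>auto intro: has_sum_infsum\<close>)
  have "((\<lambda>k. if l = k then c k else 0) has_sum infsum F UNIV) UNIV"
  proof (rule has_sum_SigmaD[where B = "\<lambda>_. UNIV" and f = "\<lambda>(k, j). F (j, k)"])
    have "((\<lambda>w. F (prod.swap w)) has_sum infsum F UNIV) UNIV"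
      using S has_sum_reindex_bij_betw[of prod.swap UNIV UNIV F] by (simp add: bij_swap)
    thus "((\<lambda>(k, j). F (j, k)) has_sum infsum F UNIV) (UNIV \<times> UNIV)"
      by (simp add: prod.swap_def case_prod_beta')
  qed (use inner in auto)
  hence "infsum F UNIV = (\<Sum>\<^sub>\<infinity>k\<in>UNIV. if l = k then c k else 0)" by (simp add: infsumI)
  also have "\<dots> = (\<Sum>\<^sub>\<infinity>k\<in>{l}. if l = k then c k else 0)" by (rule infsum_cong_neutral) auto
  finally have "infsum F UNIV = c l" by simp
  with outer show ?thesis by (simp add: F_def)
qed

end

section \<open>Fourier coefficients of trigonometric polynomials\<close>

lemma integral_cis_period:
  "(\<integral>y. indicator {-pi..pi} y *\<^sub>R cis (of_int n * y) \<partial>lborel) = (if n = 0 then 2 * pi else 0)"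
proof (cases "n = 0")
  case True
  thus ?thesis by (simp add: scaleR_conv_of_real)
next
  case False
  let ?F = "\<lambda>y. cis (of_int n * y) / (\<i> * of_int n)"
  have "(\<integral>y. indicator {-pi..pi} y *\<^sub>R cis (of_int n * y) \<partial>lborel) = ?F pi - ?F (- pi)"
  proof (rule integral_FTC_atLeastAtMost)
    show "(?F has_vector_derivative cis (of_int n * x)) (at x within {- pi..pi})" for x
    proof -
      have "((\<lambda>z. exp (\<i> * of_int n * z) / (\<i> * of_int n)) has_field_derivative exp (\<i> * of_int n * of_real x)) (at (of_real x))"
        using False by (auto intro!: derivative_eq_intros)
      from has_vector_derivative_real_field[OF this] show ?thesis
        by (simp add: cis_conv_exp mult.assoc)
    qed
    show "continuous_on {- pi..pi} (\<lambda>x. cis (of_int n * x))"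
      unfolding cis_conv_exp by (intro continuous_intros)
  qed simp
  also have "\<dots> = 0"
  proof -
    \<comment> \<open>The endpoint arguments differ by 2 pi n, so the antiderivative takes the same
      value at both.\<close>
    have "cis (of_int n * pi) = cis (of_int n * (- pi)) * cis (2 * pi * of_int n)"
      unfolding cis_mult by (rule arg_cong[where f = cis]) (simp add: algebra_simps)
    also have "cis (2 * pi * of_int n) = 1" by (rule cis_multiple_2pi) simp
    finally have "cis (of_int n * pi) = cis (of_int n * (- pi))" by (simp only: mult_1_right)
    thus ?thesis by (simp only: diff_self)
  qed
  finally show ?thesis using False by simp
qed

lemma indicator_torus_cube: "(indicator torus_cube x :: real) = (\<Prod>b\<in>Basis. indicator {-pi..pi} (x \<bullet> b))"
proof -
  have "(\<chi> i. - pi) \<bullet> b = - pi" "(\<chi> i. pi) \<bullet> b = pi" if "b \<in> Basis" for b :: "real ^ 'a"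
    using that by (auto simp: Basis_vec_def inner_axis)
  hence "x \<in> torus_cube \<longleftrightarrow> (\<forall>b\<in>Basis. x \<bullet> b \<in> {-pi..pi})"
    unfolding torus_cube_def cbox_def by auto
  thus ?thesis by (auto simp: indicator_def)
qed

lemma cis_sum: "finite A \<Longrightarrow> cis (\<Sum>i\<in>A. f i) = (\<Prod>i\<in>A. cis (f i))"
  by (induction A rule: finite_induct) (auto simp: cis_mult[symmetric])

text \<open>Lebesgue measure is the image of a product of lines over \<open>Basis\<close>, and the
  exponential cut off to the cube is a product of one-dimensional functions, so the integral
  factorises.\<close>

lemma integral_torus_cis:
  fixes n :: "int ^ 'd"
  shows "(LINT x:torus_cube|lebesgue. cis (of_int_vec n \<bullet> x)) = (if n = 0 then of_real ((2 * pi) ^ CARD('d)) else 0)"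
proof -
  interpret product_sigma_finite "\<lambda>_ :: real ^ 'd. lborel :: real measure" ..
  define g :: "real ^ 'd \<Rightarrow> real \<Rightarrow> complex" where
    "g b y = indicator {-pi..pi} y *\<^sub>R cis ((of_int_vec n \<bullet> b) * y)" for b y
  have g_meas: "g b \<in> borel_measurable borel" for b
    unfolding g_def cis_conv_exp by measurable
  have g_int: "integrable lborel (g b)" for b
  proof (rule integrableI_bounded_set[where A = "{-pi..pi}" and B = 1])
    show "AE x\<in>{-pi..pi} in lborel. norm (g b x) \<le> 1"
      by (auto simp: g_def)
  qed (use g_meas in \<open>auto simp: g_def ennreal_less_top\<close>)
  have eq: "indicator torus_cube x *\<^sub>R cis (of_int_vec n \<bullet> x) = (\<Prod>b\<in>Basis. g b (x \<bullet> b))" for x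
  proof -
    have "cis (of_int_vec n \<bullet> x) = (\<Prod>b\<in>Basis. cis ((of_int_vec n \<bullet> b) * (x \<bullet> b)))"
      by (subst euclidean_inner) (simp add: cis_sum)
    thus ?thesis
      by (simp add: g_def indicator_torus_cube prod.distrib scaleR_conv_of_real)
  qed
  have meas: "(\<lambda>x. indicator torus_cube x *\<^sub>R cis (of_int_vec n \<bullet> x)) \<in> borel_measurable borel"
    unfolding torus_cube_def cis_conv_exp by measurable
  have "(LINT x:torus_cube|lebesgue. cis (of_int_vec n \<bullet> x)) = (\<integral>x. indicator torus_cube x *\<^sub>R cis (of_int_vec n \<bullet> x) \<partial>lborel)"
    unfolding set_lebesgue_integral_def using meas by (intro integral_completion) simp
  also have "\<dots> = (\<integral>x. (\<Prod>b\<in>Basis. g b (x \<bullet> b)) \<partial>(distr (\<Pi>\<^sub>M b\<in>(Basis :: (real ^ 'd) set). lborel) borel (\<lambda>f. \<Sum>b\<in>Basis. f b *\<^sub>R b)))"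
    unfolding eq by (simp flip: lborel_eq)
  also have "\<dots> = (\<integral>f. (\<Prod>b\<in>Basis. g b ((\<Sum>b\<in>Basis. f b *\<^sub>R b) \<bullet> b)) \<partial>(\<Pi>\<^sub>M b\<in>(Basis :: (real ^ 'd) set). lborel))"
    using g_meas by (intro integral_distr) (auto intro!: borel_measurable_prod measurable_compose[OF _ g_meas])
  also have "\<dots> = (\<integral>f. (\<Prod>b\<in>Basis. g b (f b)) \<partial>(\<Pi>\<^sub>M b\<in>(Basis :: (real ^ 'd) set). lborel))"
    by (intro Bochner_Integration.integral_cong prod.cong refl) (simp add: inner_sum_left_Basis)
  also have "\<dots> = (\<Prod>b\<in>Basis. integral\<^sup>L lborel (g b))"
    by (intro product_integral_prod g_int) simp
  also have "\<dots> = (\<Prod>i\<in>(UNIV :: 'd set). integral\<^sup>L lborel (g (axis i 1)))"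
  proof -
    have B: "(Basis :: (real ^ 'd) set) = (\<lambda>i. axis i 1) ` UNIV" by (auto simp: Basis_vec_def)
    have inj: "inj (\<lambda>i :: 'd. axis i (1::real))" by (auto simp: inj_def axis_eq_axis)
    show ?thesis unfolding B by (subst prod.reindex[OF inj]) (simp add: o_def)
  qed
  also have "\<dots> = (\<Prod>i\<in>(UNIV :: 'd set). if n $ i = 0 then 2 * pi else 0)"
    by (simp add: g_def[abs_def] inner_axis of_int_vec_def integral_cis_period if_distrib cong: if_cong)
  also have "\<dots> = (if n = 0 then of_real ((2 * pi) ^ CARD('d)) else 0)"
    by (auto simp: vec_eq_iff)
  finally show ?thesis .
qed

lemma set_integrable_mult_cis:
  assumes "set_integrable lebesgue torus_cube f"
  shows "set_integrable lebesgue torus_cube (\<lambda>x. f x * cis (- (v \<bullet> x)))"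
proof -
  have c: "(\<lambda>x. cis (- (v \<bullet> x))) \<in> borel_measurable lebesgue"
    unfolding cis_conv_exp by (rule measurable_completion) measurable
  show ?thesis
    unfolding set_integrable_def
  proof (rule Bochner_Integration.integrable_bound[OF assms[unfolded set_integrable_def]])
    have "(\<lambda>x. (indicator torus_cube x *\<^sub>R f x) * cis (- (v \<bullet> x))) \<in> borel_measurable lebesgue"
      using assms c unfolding set_integrable_def by (intro borel_measurable_times) auto
    thus "(\<lambda>x. indicator torus_cube x *\<^sub>R (f x * cis (- (v \<bullet> x)))) \<in> borel_measurable lebesgue"
      by simp
  qed (auto simp: norm_mult)
qed

lemma set_integrable_cis: "set_integrable lebesgue torus_cube (\<lambda>x. cis (v \<bullet> x))"
  unfolding torus_cube_def cis_conv_exp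
  by (intro absolutely_integrable_continuous continuous_intros)

lemma fourier_coeff_diff:
  assumes "set_integrable lebesgue torus_cube f" "set_integrable lebesgue torus_cube g"
  shows "fourier_coeff (\<lambda>x. f x - g x) k = fourier_coeff f k - fourier_coeff g k"
  using set_integrable_mult_cis[OF assms(1)] set_integrable_mult_cis[OF assms(2)]
  by (simp add: fourier_coeff_def left_diff_distrib set_integral_diff(2) diff_divide_distrib)

lemma set_integrable_sum_mult:
  assumes "\<And>i. i \<in> I \<Longrightarrow> set_integrable lebesgue torus_cube (g i)"
  shows "set_integrable lebesgue torus_cube (\<lambda>x. \<Sum>i\<in>I. c i * g i x :: complex)"
proof -
  have "integrable lebesgue (\<lambda>x. \<Sum>i\<in>I. c i * (indicator torus_cube x *\<^sub>R g i x))"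
    using assms unfolding set_integrable_def
    by (intro Bochner_Integration.integrable_sum integrable_mult_right)
  thus ?thesis by (simp add: set_integrable_def scaleR_sum_right)
qed

lemma fourier_coeff_sum_mult:
  assumes "\<And>i. i \<in> I \<Longrightarrow> set_integrable lebesgue torus_cube (g i)"
  shows "fourier_coeff (\<lambda>x. \<Sum>i\<in>I. c i * g i x) k = (\<Sum>i\<in>I. c i * fourier_coeff (g i) k)"
proof -
  have int: "integrable lebesgue (\<lambda>x. indicator torus_cube x *\<^sub>R (g i x * cis (- (of_int_vec k \<bullet> x))))" if "i \<in> I" for i
    using set_integrable_mult_cis[OF assms[OF that]] unfolding set_integrable_def .
  have "(LINT x:torus_cube|lebesgue. (\<Sum>i\<in>I. c i * g i x) * cis (- (of_int_vec k \<bullet> x)))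
    = (\<integral>x. (\<Sum>i\<in>I. c i * (indicator torus_cube x *\<^sub>R (g i x * cis (- (of_int_vec k \<bullet> x))))) \<partial>lebesgue)"
    unfolding set_lebesgue_integral_def
    by (intro Bochner_Integration.integral_cong) (auto simp: scaleR_sum_right sum_distrib_right mult.assoc)
  also have "\<dots> = (\<Sum>i\<in>I. c i * (LINT x:torus_cube|lebesgue. g i x * cis (- (of_int_vec k \<bullet> x))))"
    unfolding set_lebesgue_integral_def
    using int by (subst Bochner_Integration.integral_sum)
      (auto intro!: integrable_mult_right sum.cong simp del: mult_scaleR_right)
  finally show ?thesis by (simp add: fourier_coeff_def sum_divide_distrib)
qed

lemma fourier_coeff_cis:
  fixes l k :: "int ^ 'd"
  shows "fourier_coeff (\<lambda>x. cis (of_int_vec l \<bullet> x)) k = (if k = l then 1 else 0)"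
proof -
  have "cis (of_int_vec l \<bullet> x) * cis (- (of_int_vec k \<bullet> x)) = cis (of_int_vec (l - k) \<bullet> x)" for x
  proof -
    have "of_int_vec (l - k) = of_int_vec l - of_int_vec k" by (simp add: of_int_vec_def vec_eq_iff)
    thus ?thesis by (simp add: cis_mult inner_diff_left)
  qed
  thus ?thesis by (auto simp: fourier_coeff_def integral_torus_cis)
qed

lemma fourier_coeff_trig_sum:
  assumes "finite S"
  shows "fourier_coeff (\<lambda>x. \<Sum>l\<in>S. \<gamma> l * cis (of_int_vec l \<bullet> x)) k = (if k \<in> S then \<gamma> k else 0)"
  using assms by (subst fourier_coeff_sum_mult) (auto simp: set_integrable_cis fourier_coeff_cis if_distrib cong: if_cong)

lemma finite_D_box [simp]: "finite (D_box m)"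
proof (rule finite_subset)
  show "D_box m \<subseteq> (\<lambda>v. \<chi> i. v i) ` PiE UNIV (\<lambda>i. D_set (m $ i))"
  proof
    fix l assume "l \<in> D_box m"
    hence "(\<lambda>i. l $ i) \<in> PiE UNIV (\<lambda>i. D_set (m $ i))" by (auto simp: D_box_def)
    moreover have "l = (\<chi> i. l $ i)" by simp
    ultimately show "l \<in> (\<lambda>v. \<chi> i. v i) ` PiE UNIV (\<lambda>i. D_set (m $ i))" by blast
  qed
qed (intro finite_imageI finite_PiE finite finite_D_set)

lemma set_integrable_quasi_interp: "set_integrable lebesgue torus_cube (quasi_interp \<phi> \<phi>t m f)"
  unfolding quasi_interp_def[abs_def] by (intro set_integrable_sum_mult set_integrable_cis)

lemma set_integrable_eta: "set_integrable lebesgue torus_cube (eta \<phi> \<phi>t j f)"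
  unfolding eta_def[abs_def] by (intro set_integrable_sum_mult set_integrable_quasi_interp)

lemma fourier_coeff_quasi_interp:
  "fourier_coeff (quasi_interp \<phi> \<phi>t m f) l =
     (if l \<in> D_box m then (\<Prod>i\<in>UNIV. fourier_coeff1 (\<phi> (m $ i)) (l $ i)) * (\<Sum>\<^sub>\<infinity>\<mu>\<in>UNIV. inner_term \<phi>t f m l \<mu>) else 0)"
  unfolding quasi_interp_def[abs_def] by (rule fourier_coeff_trig_sum) simp

lemma fourier_coeff_eta:
  "fourier_coeff (eta \<phi> \<phi>t j f) l =
     (\<Sum>E\<in>Pow {i. j $ i > 0}. (-1) ^ card E * fourier_coeff (quasi_interp \<phi> \<phi>t (lower_levels E j) f) l)"
  unfolding eta_def[abs_def] by (intro fourier_coeff_sum_mult set_integrable_quasi_interp)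

lemma fourier_coeff_eta_eq_0:
  assumes "l \<notin> D_box j"
  shows "fourier_coeff (eta \<phi> \<phi>t j f) l = 0"
proof -
  have "l \<notin> D_box (lower_levels E j)" for E
    using assms D_set_mono[of "j $ i - 1" "j $ i" for i]
    by (auto simp: D_box_def lower_levels_def split: if_splits)
  thus ?thesis by (simp add: fourier_coeff_eta fourier_coeff_quasi_interp)
qed

lemma wiener_norm_eq: "wiener_norm q \<alpha> \<beta> f = lq_norm q (\<lambda>k. ennreal (freq_weight \<alpha> \<beta> k * norm (fourier_coeff f k)))"
  by (simp add: wiener_norm_def freq_weight_def)

lemma wiener_norm_0_eq: "wiener_norm q 0 0 f = lq_norm q (\<lambda>k. ennreal (norm (fourier_coeff f k)))"
proof -
  have "freq_weight 0 0 k = 1" for k :: "int ^ 'a"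
  proof -
    have "1 + norm (of_int_vec k) \<noteq> 0" using norm_ge_zero[of "of_int_vec k"] by linarith
    thus ?thesis by (simp add: freq_weight_def add_nonneg_eq_0_iff)
  qed
  thus ?thesis by (simp add: wiener_norm_eq)
qed

lemma eta_norm_eq:
  "eta_norm q \<alpha> \<beta> \<phi> \<phi>t f = lq_norm q (\<lambda>j. ennreal (level_weight \<alpha> \<beta> j) *
     lq_norm q (\<lambda>l. ennreal (norm (fourier_coeff (eta \<phi> \<phi>t j f) l))))"
  by (simp add: eta_norm_def level_weight_def wiener_norm_0_eq)

lemma wiener_norm_diff_sum:
  assumes "f \<in> L1_torus"
  shows "wiener_norm q \<alpha> \<beta> (\<lambda>x. f x - (\<Sum>j\<in>F. eta \<phi> \<phi>t j f x)) =
    lq_norm q (\<lambda>k. ennreal (freq_weight \<alpha> \<beta> k * norm (fourier_coeff f k - (\<Sum>j\<in>F. fourier_coeff (eta \<phi> \<phi>t j f) k))))"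
proof -
  have "fourier_coeff (\<lambda>x. f x - (\<Sum>j\<in>F. eta \<phi> \<phi>t j f x)) k
      = fourier_coeff f k - (\<Sum>j\<in>F. fourier_coeff (eta \<phi> \<phi>t j f) k)" for k
  proof -
    have "fourier_coeff (\<lambda>x. \<Sum>j\<in>F. eta \<phi> \<phi>t j f x) k = (\<Sum>j\<in>F. fourier_coeff (eta \<phi> \<phi>t j f) k)"
      using fourier_coeff_sum_mult[of F "\<lambda>j. eta \<phi> \<phi>t j f" "\<lambda>_. 1", OF set_integrable_eta] by simp
    moreover have "set_integrable lebesgue torus_cube (\<lambda>x. \<Sum>j\<in>F. eta \<phi> \<phi>t j f x)"
      using set_integrable_sum_mult[of F "\<lambda>j. eta \<phi> \<phi>t j f" "\<lambda>_. 1", OF set_integrable_eta] by simp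
    moreover have "set_integrable lebesgue torus_cube f"
      using assms by (simp add: L1_torus_def)
    ultimately show ?thesis by (simp add: fourier_coeff_diff)
  qed
  thus ?thesis by (simp add: wiener_norm_eq)
qed

section \<open>The quasi-interpolation series\<close>

lemma has_sum_sum:
  fixes f :: "'a \<Rightarrow> 'b \<Rightarrow> 'c :: topological_comm_monoid_add"
  assumes "\<And>i. i \<in> I \<Longrightarrow> (f i has_sum S i) A"
  shows "((\<lambda>x. \<Sum>i\<in>I. f i x) has_sum (\<Sum>i\<in>I. S i)) A"
  using assms by (induction I rule: infinite_finite_induct) (auto intro: has_sum_add)

context quasi_interp_symbols
begin

text \<open>\<open>h\<close> enumerates the frequencies congruent to \<open>l\<close> in every
  direction. Off its range some symbol factor vanishes, so the inner sums over \<mu> become sums of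
  matrix entries over all \<open>k\<close>, a form in which different levels can be
  subtracted.\<close>

lemma Q_symbol_coeff:
  fixes c :: "int ^ 'd \<Rightarrow> complex" and m :: "nat ^ 'd" and l :: "int ^ 'd"
  defines "h \<equiv> \<lambda>\<mu> :: int ^ 'd. \<chi> i. l $ i + 2 ^ (m $ i) * \<mu> $ i"
  assumes fin: "lq_norm q (\<lambda>k. ennreal (freq_weight \<alpha> \<beta> k * norm (c k))) < top"
  shows "l \<in> D_box m \<Longrightarrow> (\<lambda>\<mu>. norm (c (h \<mu>) * (\<Prod>i\<in>UNIV. b (m $ i) (h \<mu> $ i)))) summable_on UNIV"
    and "(\<lambda>k. (\<Prod>i\<in>UNIV. Q_symbol (m $ i) (l $ i) (k $ i)) * c k) summable_on UNIV"
    and "(\<Sum>\<^sub>\<infinity>k\<in>UNIV. (\<Prod>i\<in>UNIV. Q_symbol (m $ i) (l $ i) (k $ i)) * c k) =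
      (if l \<in> D_box m then (\<Prod>i\<in>UNIV. a (m $ i) (l $ i)) *
         (\<Sum>\<^sub>\<infinity>\<mu>\<in>UNIV. c (h \<mu>) * (\<Prod>i\<in>UNIV. b (m $ i) (h \<mu> $ i))) else 0)"
proof -
  define g where "g k = c k * (\<Prod>i\<in>UNIV. b (m $ i) (k $ i))" for k :: "int ^ 'd"
  let ?Q = "\<lambda>k. (\<Prod>i\<in>UNIV. Q_symbol (m $ i) (l $ i) (k $ i)) * c k"
  let ?A = "\<Prod>i\<in>UNIV. a (m $ i) (l $ i)"
  let ?B = "\<lambda>k. (\<Prod>i\<in>UNIV. if aliasing (m $ i) (l $ i) (k $ i) then norm (b (m $ i) (k $ i)) else 0) * norm (c k)"
  have B: "?B summable_on UNIV" by (rule aliased_sum_summable[OF fin])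
  have inj: "inj h" by (auto simp: h_def inj_def vec_eq_iff)
  have range_iff: "k \<in> range h \<longleftrightarrow> (\<forall>i. 2 ^ (m $ i) dvd k $ i - l $ i)" for k
  proof
    assume dvd: "\<forall>i. 2 ^ (m $ i) dvd k $ i - l $ i"
    hence "k = h (\<chi> i. (k $ i - l $ i) div 2 ^ (m $ i))" by (simp add: h_def vec_eq_iff)
    thus "k \<in> range h" by blast
  qed (auto simp: h_def)
  have "(\<lambda>k. norm (?Q k)) summable_on UNIV"
  proof (rule summable_on_comparison_test)
    show "(\<lambda>k. (\<Prod>i\<in>(UNIV :: 'd set). Ca) * ?B k) summable_on UNIV"
      by (intro summable_on_cmult_right B)
    fix k
    have "norm (?Q k) = (\<Prod>i\<in>UNIV. norm (Q_symbol (m $ i) (l $ i) (k $ i))) * norm (c k)"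
      by (simp add: norm_mult prod_norm)
    also have "\<dots> \<le> (\<Prod>i\<in>UNIV. Ca * (if aliasing (m $ i) (l $ i) (k $ i) then norm (b (m $ i) (k $ i)) else 0)) * norm (c k)"
      by (intro mult_right_mono prod_mono conjI)
         (auto simp: Q_symbol_def norm_mult intro!: mult_right_mono a_le)
    finally show "norm (?Q k) \<le> (\<Prod>i\<in>(UNIV :: 'd set). Ca) * ?B k"
      by (simp add: prod.distrib mult.assoc del: prod_constant)
  qed auto
  thus "?Q summable_on UNIV" by (rule abs_summable_summable)
  show "(\<lambda>\<mu>. norm (c (h \<mu>) * (\<Prod>i\<in>UNIV. b (m $ i) (h \<mu> $ i)))) summable_on UNIV" if l: "l \<in> D_box m"
  proof -
    have "?B summable_on range h" using B by (rule summable_on_subset_banach) simp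
    hence "(\<lambda>\<mu>. ?B (h \<mu>)) summable_on UNIV"
      by (subst (asm) summable_on_reindex[OF inj]) (simp add: o_def)
    moreover have "?B (h \<mu>) = norm (c (h \<mu>) * (\<Prod>i\<in>UNIV. b (m $ i) (h \<mu> $ i)))" for \<mu>
    proof -
      have "aliasing (m $ i) (l $ i) (h \<mu> $ i)" for i
        using l by (auto simp: aliasing_def D_box_def h_def)
      thus ?thesis by (simp add: norm_mult prod_norm)
    qed
    ultimately show ?thesis by simp
  qed
  show "infsum ?Q UNIV = (if l \<in> D_box m then ?A *
         (\<Sum>\<^sub>\<infinity>\<mu>\<in>UNIV. c (h \<mu>) * (\<Prod>i\<in>UNIV. b (m $ i) (h \<mu> $ i))) else 0)"
  proof (cases "l \<in> D_box m")
    case True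
    have "infsum ?Q UNIV = infsum (\<lambda>k. ?A * g k) (range h)"
    proof (rule infsum_cong_neutral)
      fix k assume "k \<in> UNIV - range h"
      then obtain i where "\<not> 2 ^ (m $ i) dvd k $ i - l $ i" using range_iff by blast
      hence "Q_symbol (m $ i) (l $ i) (k $ i) = 0" by (simp add: Q_symbol_def aliasing_def)
      hence "(\<Prod>i\<in>UNIV. Q_symbol (m $ i) (l $ i) (k $ i)) = 0" by (intro prod_zero) auto
      thus "?Q k = 0" by simp
    next
      fix k assume "k \<in> UNIV \<inter> range h"
      hence "aliasing (m $ i) (l $ i) (k $ i)" for i
        using True range_iff by (auto simp: aliasing_def D_box_def)
      thus "?Q k = ?A * g k" by (simp add: Q_symbol_def g_def prod.distrib mult_ac)
    qed auto
    also have "\<dots> = ?A * infsum g (range h)" by (rule infsum_cmult_right')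
    also have "infsum g (range h) = infsum (g \<circ> h) UNIV" by (rule infsum_reindex[OF inj])
    finally show ?thesis using True by (simp add: g_def o_def)
  next
    case False
    then obtain i where "l $ i \<notin> D_set (m $ i)" by (auto simp: D_box_def)
    hence "Q_symbol (m $ i) (l $ i) (k $ i) = 0" for k by (simp add: Q_symbol_def aliasing_def)
    hence "(\<Prod>i\<in>UNIV. Q_symbol (m $ i) (l $ i) (k $ i)) = 0" for k by (intro prod_zero) auto
    hence "?Q k = 0" for k by (simp only: mult_zero_left)
    thus ?thesis using False by (simp only: infsum_0_simp if_False)
  qed
qed

text \<open>Expansion of a product of differences over the sets of directions taking the lower
  level. A set containing a direction with j_i = 0 contributes a zero factor, in accordance with the
  index range of \<open>eta\<close>.\<close>

lemma prod_eta_symbol_eq: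
  fixes j :: "nat ^ 'd"
  shows "(\<Prod>i\<in>UNIV. eta_symbol (j $ i) (l $ i) (k $ i)) =
    (\<Sum>E\<in>Pow {i. j $ i > 0}. (-1) ^ card E * (\<Prod>i\<in>UNIV. Q_symbol (lower_levels E j $ i) (l $ i) (k $ i)))"
proof -
  let ?f1 = "\<lambda>i. Q_symbol (j $ i) (l $ i) (k $ i)"
  let ?f2 = "\<lambda>i. if j $ i = 0 then 0 else Q_symbol (j $ i - 1) (l $ i) (k $ i)"
  have "(\<Prod>i\<in>UNIV. eta_symbol (j $ i) (l $ i) (k $ i)) =
      (\<Sum>E\<in>Pow UNIV. (-1) ^ card E * (\<Prod>i\<in>E. ?f2 i) * (\<Prod>i\<in>UNIV - E. ?f1 i))"
    unfolding eta_symbol_def by (rule prod_diff_conv_sum) simp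
  also have "\<dots> = (\<Sum>E\<in>Pow {i. j $ i > 0}. (-1) ^ card E * (\<Prod>i\<in>E. ?f2 i) * (\<Prod>i\<in>UNIV - E. ?f1 i))"
  proof (rule sum.mono_neutral_right)
    show "\<forall>E\<in>Pow UNIV - Pow {i. j $ i > 0}. (-1) ^ card E * (\<Prod>i\<in>E. ?f2 i) * (\<Prod>i\<in>UNIV - E. ?f1 i) = 0"
    proof
      fix E assume "E \<in> Pow UNIV - Pow {i. j $ i > 0}"
      then obtain i where "i \<in> E" "j $ i = 0" by auto
      hence "(\<Prod>i\<in>E. ?f2 i) = 0" by (intro prod_zero bexI[of _ i]) auto
      thus "(-1) ^ card E * (\<Prod>i\<in>E. ?f2 i) * (\<Prod>i\<in>UNIV - E. ?f1 i) = 0" by (simp only: mult_zero_left mult_zero_right)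
    qed
  qed auto
  also have "\<dots> = (\<Sum>E\<in>Pow {i. j $ i > 0}. (-1) ^ card E * (\<Prod>i\<in>UNIV. Q_symbol (lower_levels E j $ i) (l $ i) (k $ i)))"
  proof (rule sum.cong[OF refl])
    fix E assume E: "E \<in> Pow {i. j $ i > 0}"
    have "(\<Prod>i\<in>UNIV. Q_symbol (lower_levels E j $ i) (l $ i) (k $ i)) =
        (\<Prod>i\<in>UNIV - E. Q_symbol (lower_levels E j $ i) (l $ i) (k $ i)) * (\<Prod>i\<in>E. Q_symbol (lower_levels E j $ i) (l $ i) (k $ i))"
      by (rule prod.subset_diff) auto
    also have "(\<Prod>i\<in>UNIV - E. Q_symbol (lower_levels E j $ i) (l $ i) (k $ i)) = (\<Prod>i\<in>UNIV - E. ?f1 i)"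
      by (rule prod.cong) (auto simp: lower_levels_def)
    also have "(\<Prod>i\<in>E. Q_symbol (lower_levels E j $ i) (l $ i) (k $ i)) = (\<Prod>i\<in>E. ?f2 i)"
      using E by (intro prod.cong) (auto simp: lower_levels_def)
    finally show "(-1) ^ card E * (\<Prod>i\<in>E. ?f2 i) * (\<Prod>i\<in>UNIV - E. ?f1 i) =
        (-1) ^ card E * (\<Prod>i\<in>UNIV. Q_symbol (lower_levels E j $ i) (l $ i) (k $ i))"
      by (simp only: mult_ac)
  qed
  finally show ?thesis .
qed

lemma eta_symbol_coeff:
  fixes c :: "int ^ 'd \<Rightarrow> complex" and j :: "nat ^ 'd"
  assumes fin: "lq_norm q (\<lambda>k. ennreal (freq_weight \<alpha> \<beta> k * norm (c k))) < top"
  shows "((\<lambda>k. (\<Prod>i\<in>UNIV. eta_symbol (j $ i) (l $ i) (k $ i)) * c k) has_sum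
      (\<Sum>E\<in>Pow {i. j $ i > 0}. (-1) ^ card E *
         (\<Sum>\<^sub>\<infinity>k\<in>UNIV. (\<Prod>i\<in>UNIV. Q_symbol (lower_levels E j $ i) (l $ i) (k $ i)) * c k))) UNIV"
  unfolding prod_eta_symbol_eq sum_distrib_right mult.assoc
  by (intro has_sum_sum has_sum_cmult_right has_sum_infsum Q_symbol_coeff(2)[OF fin])

end

text \<open>Every frequency weight is positive, so the norm controls each single coefficient of the
  remainder, whatever the exponent.\<close>

lemma has_sum_fourier_coeff_if_has_sum_wiener:
  assumes q: "1 \<le> q" and f: "f \<in> L1_torus" and sum: "has_sum_wiener q \<alpha>' \<beta> (\<lambda>j. eta \<phi> \<phi>t j f) f"
  shows "((\<lambda>j. fourier_coeff (eta \<phi> \<phi>t j f) l) has_sum fourier_coeff f l) UNIV"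
proof -
  let ?r = "\<lambda>F. fourier_coeff f l - (\<Sum>j\<in>F. fourier_coeff (eta \<phi> \<phi>t j f) l)"
  have lim: "((\<lambda>F. lq_norm q (\<lambda>k. ennreal (freq_weight \<alpha>' \<beta> k * norm (fourier_coeff f k - (\<Sum>j\<in>F. fourier_coeff (eta \<phi> \<phi>t j f) k)))))
      \<longlongrightarrow> 0) (finite_subsets_at_top UNIV)"
    using sum by (simp add: has_sum_wiener_def wiener_norm_diff_sum[OF f])
  have "((\<lambda>F. ennreal (freq_weight \<alpha>' \<beta> l * norm (?r F))) \<longlongrightarrow> 0) (finite_subsets_at_top UNIV)"
  proof (rule tendsto_sandwich[OF _ _ tendsto_const lim])
    show "\<forall>\<^sub>F F in finite_subsets_at_top UNIV. ennreal (freq_weight \<alpha>' \<beta> l * norm (?r F)) \<le>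
       lq_norm q (\<lambda>k. ennreal (freq_weight \<alpha>' \<beta> k * norm (fourier_coeff f k - (\<Sum>j\<in>F. fourier_coeff (eta \<phi> \<phi>t j f) k))))"
      by (intro always_eventually allI) (rule le_lq_norm[OF q])
  qed simp
  hence "((\<lambda>F. freq_weight \<alpha>' \<beta> l * norm (?r F)) \<longlongrightarrow> 0) (finite_subsets_at_top UNIV)"
    by (subst (asm) ennreal_0[symmetric], subst (asm) tendsto_ennreal_iff) auto
  hence "((\<lambda>F. inverse (freq_weight \<alpha>' \<beta> l) * (freq_weight \<alpha>' \<beta> l * norm (?r F))) \<longlongrightarrow> inverse (freq_weight \<alpha>' \<beta> l) * 0)
      (finite_subsets_at_top UNIV)"
    by (rule tendsto_mult_left)
  hence "((\<lambda>F. norm (?r F)) \<longlongrightarrow> 0) (finite_subsets_at_top UNIV)"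
    using freq_weight_pos[of \<alpha>' \<beta> l] by (simp add: mult.assoc[symmetric])
  hence "(?r \<longlongrightarrow> 0) (finite_subsets_at_top UNIV)" by (rule tendsto_norm_zero_cancel)
  hence "((\<lambda>F. fourier_coeff f l - ?r F) \<longlongrightarrow> fourier_coeff f l - 0) (finite_subsets_at_top UNIV)"
    by (intro tendsto_diff tendsto_const)
  thus ?thesis by (simp add: has_sum_def)
qed

section \<open>Reduction of the two alternatives, and the characterisation\<close>

lemma amalgam_norm_bound:
  assumes l: "l \<in> D_set j"
  shows "lq_norm r (\<lambda>\<mu>. ennreal (norm (c (l + 2 ^ j * \<mu>)))) \<le> amalgam_norm r j c"
proof (cases "r = top")
  case True
  thus ?thesis by (auto simp: amalgam_norm_def intro!: SUP_least SUP_upper)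
next
  case False
  thus ?thesis using l by (auto simp: amalgam_norm_def intro!: SUP_upper)
qed

text \<open>Both alternative hypotheses reduce to one: up to a loss \<open>e < min (\<alpha> + \<beta>) \<alpha>\<close>
  in the exponent, the amalgam norms of the coefficients are bounded.\<close>

lemma aliasing_exponent_exists:
  fixes b :: "nat \<Rightarrow> int \<Rightarrow> complex"
  assumes r: "1 \<le> r" and N: "0 \<le> N" and m: "0 < m"
    and b: "\<And>j l. norm (b j l) \<le> C * (1 + \<bar>of_int l / 2 ^ j\<bar> powr N)"
    and alt: "m > N + enn2real (1 / r) \<or> N = 0 \<and> (SUP j. amalgam_norm r j (b j)) < top"
  obtains e Cb where "0 \<le> e" "e < m" "0 \<le> Cb"
    "\<And>j l. l \<in> D_set j \<Longrightarrow>
      lq_norm r (\<lambda>\<mu>. ennreal (norm (b j (l + 2 ^ j * \<mu>)) * (1 + \<bar>of_int (l + 2 ^ j * \<mu>)\<bar> / 2 ^ j) powr (- e)))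
        \<le> ennreal Cb"
  using alt
proof
  assume *: "N = 0 \<and> (SUP j. amalgam_norm r j (b j)) < top"
  show thesis
  \<comment> \<open>With e = 0 the damping factor is 1 and the bounded amalgam norm is exactly the
    claim.\<close>
  proof (rule that[of 0 "enn2real (SUP j. amalgam_norm r j (b j))"])
    fix j l assume l: "l \<in> D_set j"
    have "1 + \<bar>of_int (l + 2 ^ j * \<mu>)\<bar> / (2::real) ^ j \<noteq> 0" for \<mu>
    proof -
      have "0 \<le> \<bar>of_int (l + 2 ^ j * \<mu>)\<bar> / (2::real) ^ j" by (intro divide_nonneg_nonneg) auto
      thus ?thesis by linarith
    qed
    hence "lq_norm r (\<lambda>\<mu>. ennreal (norm (b j (l + 2 ^ j * \<mu>)) * (1 + \<bar>of_int (l + 2 ^ j * \<mu>)\<bar> / 2 ^ j) powr (- 0)))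
        = lq_norm r (\<lambda>\<mu>. ennreal (norm (b j (l + 2 ^ j * \<mu>))))"
      by (simp only: minus_zero powr_zero_eq_one if_False mult_1_right)
    also have "\<dots> \<le> amalgam_norm r j (b j)" by (rule amalgam_norm_bound[OF l])
    also have "\<dots> \<le> (SUP j. amalgam_norm r j (b j))" by (rule SUP_upper) simp
    also have "\<dots> = ennreal (enn2real (SUP j. amalgam_norm r j (b j)))" using * by simp
    finally show "lq_norm r (\<lambda>\<mu>. ennreal (norm (b j (l + 2 ^ j * \<mu>)) * (1 + \<bar>of_int (l + 2 ^ j * \<mu>)\<bar> / 2 ^ j) powr (- 0)))
        \<le> ennreal (enn2real (SUP j. amalgam_norm r j (b j)))" .
  qed (use m in auto)
next
  assume *: "m > N + enn2real (1 / r)"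
  \<comment> \<open>Half of the gap in the hypothesis: this half makes the alias sum converge, the
    other half keeps e below m, as m - e = \<epsilon>.\<close>
  define \<epsilon> where "\<epsilon> = (m - N - enn2real (1 / r)) / 2"
  have \<epsilon>: "0 < \<epsilon>" using * by (simp add: \<epsilon>_def)
  define e where "e = N + (enn2real (1 / r) + \<epsilon>)"
  define t where "t = enn2real (1 / r) + \<epsilon>"
  have t: "0 < t" using \<epsilon> by (simp add: t_def add_nonneg_pos)
  have C: "0 \<le> C" using order_trans[OF norm_ge_zero b[of 0 0]] N by (simp add: zero_le_mult_iff)
  define S where "S = lq_norm r (\<lambda>\<mu>::int. ennreal ((1 + \<bar>of_int \<mu>\<bar>) powr (- t)))"
  have S: "S < top" unfolding S_def t_def by (rule lq_norm_polynomial_decay[OF r \<epsilon>])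
  show thesis
  proof (rule that[of e "2 * C * 2 powr t * enn2real S"])
    show "0 \<le> e" unfolding e_def using N \<epsilon> by simp
    have "m - e = \<epsilon>" unfolding e_def \<epsilon>_def by (simp add: field_simps)
    thus "e < m" using \<epsilon> by simp
    show "0 \<le> 2 * C * 2 powr t * enn2real S" using C by simp
    fix j l assume l: "l \<in> D_set j"
    have le: "norm (b j (l + 2 ^ j * \<mu>)) * (1 + \<bar>of_int (l + 2 ^ j * \<mu>)\<bar> / 2 ^ j) powr (- e)
       \<le> 2 * C * 2 powr t * (1 + \<bar>of_int \<mu>\<bar>) powr (- t)" for \<mu>
    proof -
      define y :: real where "y = \<bar>of_int (l + 2 ^ j * \<mu>)\<bar> / 2 ^ j"
      have y0: "0 \<le> y" by (simp add: y_def)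
      \<comment> \<open>Since |l| \<le> 2^j / 2, a shift by 2^j \<mu> leaves y \<ge> |\<mu>| -
        1/2.\<close>
      have y1: "(1 + \<bar>of_int \<mu>\<bar>) / 2 \<le> 1 + y"
      proof -
        have "2 ^ j * \<bar>real_of_int \<mu>\<bar> = \<bar>real_of_int (l + 2 ^ j * \<mu>) - real_of_int l\<bar>"
          by (simp add: abs_mult)
        also have "\<dots> \<le> \<bar>real_of_int (l + 2 ^ j * \<mu>)\<bar> + 2 ^ j / 2"
          using D_set_abs_le[OF l] by linarith
        finally have "\<bar>real_of_int \<mu>\<bar> \<le> y + 1 / 2" by (simp add: y_def field_simps)
        thus ?thesis by (simp add: field_simps)
      qed
      have "norm (b j (l + 2 ^ j * \<mu>)) \<le> C * (1 + y powr N)"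
        using b[of j "l + 2 ^ j * \<mu>"] by (simp add: y_def)
      also have "\<dots> \<le> C * ((1 + y) powr N + (1 + y) powr N)"
        using C N y0 by (intro mult_left_mono add_mono powr_mono2 ge_one_powr_ge_zero) auto
      finally have "norm (b j (l + 2 ^ j * \<mu>)) * (1 + y) powr (- e) \<le> C * ((1 + y) powr N + (1 + y) powr N) * (1 + y) powr (- e)"
        by (rule mult_right_mono) simp
      also have "\<dots> = 2 * C * ((1 + y) powr N * (1 + y) powr (- e))" by simp
      \<comment> \<open>As e = N + t, damping by e cancels the growth N and leaves the summable
        decay t.\<close>
      also have "(1 + y) powr N * (1 + y) powr (- e) = (1 + y) powr (- t)"
        by (simp add: e_def t_def flip: powr_add)
      also have "2 * C * (1 + y) powr (- t) \<le> 2 * C * ((1 + \<bar>of_int \<mu>\<bar>) / 2) powr (- t)"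
        using C t y1 by (intro mult_left_mono powr_mono2') auto
      also have "((1 + \<bar>real_of_int \<mu>\<bar>) / 2) powr (- t) = 2 powr t * (1 + \<bar>of_int \<mu>\<bar>) powr (- t)"
        by (subst powr_divide) (simp add: powr_minus divide_inverse)
      finally show ?thesis unfolding y_def by (simp add: mult_ac)
    qed
    have "lq_norm r (\<lambda>\<mu>. ennreal (norm (b j (l + 2 ^ j * \<mu>)) * (1 + \<bar>of_int (l + 2 ^ j * \<mu>)\<bar> / 2 ^ j) powr (- e)))
        \<le> lq_norm r (\<lambda>\<mu>. ennreal (2 * C * 2 powr t) * ennreal ((1 + \<bar>of_int \<mu>\<bar>) powr (- t)))"
    proof (rule lq_norm_mono[OF r])
      fix \<mu>
      show "ennreal (norm (b j (l + 2 ^ j * \<mu>)) * (1 + \<bar>of_int (l + 2 ^ j * \<mu>)\<bar> / 2 ^ j) powr (- e))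
          \<le> ennreal (2 * C * 2 powr t) * ennreal ((1 + \<bar>of_int \<mu>\<bar>) powr (- t))"
        using ennreal_leI[OF le[of \<mu>]] C by (subst ennreal_mult[symmetric]) auto
    qed
    also have "\<dots> = ennreal (2 * C * 2 powr t) * S"
      unfolding S_def by (rule lq_norm_cmult[OF r])
    also have "\<dots> = ennreal (2 * C * 2 powr t * enn2real S)"
      using S C by (subst ennreal_mult) auto
    finally show "lq_norm r (\<lambda>\<mu>. ennreal (norm (b j (l + 2 ^ j * \<mu>)) * (1 + \<bar>of_int (l + 2 ^ j * \<mu>)\<bar> / 2 ^ j) powr (- e)))
        \<le> ennreal (2 * C * 2 powr t * enn2real S)" .
  qed
qed

theorem theorem4p4:
  fixes q q' :: ennreal and \<alpha> \<beta> N s C\<phi>t C\<phi> Cs :: real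
    and \<phi> :: "nat \<Rightarrow> real \<Rightarrow> complex"
    and \<phi>t :: "nat \<Rightarrow> (real \<Rightarrow> complex) \<Rightarrow> complex"
  assumes "1 \<le> q" and "1 / q + 1 / q' = 1"
    and "\<alpha> > 0" and "\<alpha> + \<beta> > 0"
    and "\<And>j. \<phi>t j \<in> periodic_distributions"
    and "\<And>j. \<phi> j \<in> trig_poly j"
    and "N \<ge> 0" and "s > max (\<alpha> + \<beta>) \<alpha>"
    and "\<And>j l. norm (dist_coeff (\<phi>t j) l) \<le> C\<phi>t * (1 + \<bar>of_int l / 2 ^ j\<bar> powr N)"
    and "\<And>j l. norm (fourier_coeff1 (\<phi> j) l) \<le> C\<phi>"
    and "\<And>j l. l \<in> D_set j \<Longrightarrow>
           norm (1 - fourier_coeff1 (\<phi> j) l * dist_coeff (\<phi>t j) l) \<le> Cs * \<bar>of_int l / 2 ^ j\<bar> powr s"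
    and "min (\<alpha> + \<beta>) \<alpha> > N + enn2real (1 / q')
         \<or> N = 0 \<and> (SUP j. amalgam_norm q' j (dist_coeff (\<phi>t j))) < \<infinity>"
  shows "(\<forall>f \<in> (L1_torus :: (real ^ 'd \<Rightarrow> complex) set).
            f \<in> wiener_space q \<alpha> \<beta> \<longleftrightarrow>
              (\<forall>j. eta_well_defined \<phi>t j f)
              \<and> (\<forall>\<alpha>' < \<alpha>. has_sum_wiener q \<alpha>' \<beta> (\<lambda>j. eta \<phi> \<phi>t j f) f)
              \<and> eta_norm q \<alpha> \<beta> \<phi> \<phi>t f < \<infinity>)
       \<and> (\<exists>c > 0. \<exists>C > 0. \<forall>f \<in> (wiener_space q \<alpha> \<beta> :: (real ^ 'd \<Rightarrow> complex) set).
            ennreal c * wiener_norm q \<alpha> \<beta> f \<le> eta_norm q \<alpha> \<beta> \<phi> \<phi>t f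
            \<and> eta_norm q \<alpha> \<beta> \<phi> \<phi>t f \<le> ennreal C * wiener_norm q \<alpha> \<beta> f)"
proof -
  note q = assms(1) and conj = assms(2)
  have q': "1 \<le> q'" by (rule conjugate_exponent_ge_1[OF q conj])
  have m: "0 < min (\<alpha> + \<beta>) \<alpha>" using assms(3,4) by simp
  obtain e Cb where e: "0 \<le> e" "e < min (\<alpha> + \<beta>) \<alpha>" "0 \<le> Cb"
    "\<And>j l. l \<in> D_set j \<Longrightarrow> lq_norm q' (\<lambda>\<mu>. ennreal (norm (dist_coeff (\<phi>t j) (l + 2 ^ j * \<mu>)) *
        (1 + \<bar>of_int (l + 2 ^ j * \<mu>)\<bar> / 2 ^ j) powr (- e))) \<le> ennreal Cb"
    using aliasing_exponent_exists[OF q' assms(7) m assms(9) assms(12)[unfolded infinity_ennreal_def]] by blast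
  interpret quasi_interp_symbols q q' \<alpha> \<beta> s e C\<phi> Cs Cb "\<lambda>j. fourier_coeff1 (\<phi> j)" "\<lambda>j. dist_coeff (\<phi>t j)"
    by unfold_locales (use assms e in auto)
  let ?\<eta> = "\<lambda>f j l. fourier_coeff (eta \<phi> \<phi>t j f) l"
  have fin_iff: "f \<in> wiener_space q \<alpha> \<beta> \<longleftrightarrow> f \<in> L1_torus \<and>
      lq_norm q (\<lambda>k. ennreal (freq_weight \<alpha> \<beta> k * norm (fourier_coeff f k))) < top" for f :: "real ^ 'd \<Rightarrow> complex"
    by (auto simp: wiener_space_def wiener_norm_eq)

  \<comment> \<open>Written with the vector as a whole, so that \<open>Q_symbol_coeff\<close>
    matches both occurrences of the shifted frequency.\<close>
  have inner: "inner_term \<phi>t f m l \<mu> = fourier_coeff f (\<chi> i. l $ i + 2 ^ (m $ i) * \<mu> $ i) *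
      (\<Prod>i\<in>UNIV. dist_coeff (\<phi>t (m $ i)) ((\<chi> i. l $ i + 2 ^ (m $ i) * \<mu> $ i) $ i))"
    for f :: "real ^ 'd \<Rightarrow> complex" and m l \<mu>
    by (simp add: inner_term_def)
  have well_defined: "eta_well_defined \<phi>t j f" if "f \<in> wiener_space q \<alpha> \<beta>" for f :: "real ^ 'd \<Rightarrow> complex" and j
    unfolding eta_well_defined_def inner
    using that Q_symbol_coeff(1)[of "fourier_coeff f"] by (auto simp: fin_iff)
  have coeff: "((\<lambda>k. (\<Prod>i\<in>UNIV. eta_symbol (j $ i) (l $ i) (k $ i)) * fourier_coeff f k) has_sum ?\<eta> f j l) UNIV"
    if "f \<in> wiener_space q \<alpha> \<beta>" for f :: "real ^ 'd \<Rightarrow> complex" and j l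
  proof -
    have fin: "lq_norm q (\<lambda>k. ennreal (freq_weight \<alpha> \<beta> k * norm (fourier_coeff f k))) < top"
      using that by (simp add: fin_iff)
    show ?thesis
      using eta_symbol_coeff[OF fin, of j l]
      by (simp only: fourier_coeff_eta fourier_coeff_quasi_interp Q_symbol_coeff(3)[OF fin] inner)
  qed
  have sum: "((\<lambda>j. ?\<eta> f j l) has_sum fourier_coeff f l) UNIV"
    if f: "f \<in> wiener_space q \<alpha> \<beta>" for f :: "real ^ 'd \<Rightarrow> complex" and l
  proof -
    have fin: "lq_norm q (\<lambda>k. ennreal (freq_weight \<alpha> \<beta> k * norm (fourier_coeff f k))) < top"
      using f by (simp add: fin_iff)
    show ?thesis using has_sum_eta_coeff[OF fin, of l] by (simp only: infsumI[OF coeff[OF f]])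
  qed

  obtain A where A: "0 \<le> A" "\<And>c :: int ^ 'd \<Rightarrow> complex. lq_norm q (\<lambda>j :: nat ^ 'd. ennreal (level_weight \<alpha> \<beta> j) *
        lq_norm q (\<lambda>l. \<Sum>\<^sub>\<infinity>k\<in>UNIV. ennreal ((\<Prod>i\<in>UNIV. norm (eta_symbol (j $ i) (l $ i) (k $ i))) * norm (c k))))
      \<le> ennreal A * lq_norm q (\<lambda>k. ennreal (freq_weight \<alpha> \<beta> k * norm (c k)))"
    by (rule analysis_bound) blast
  obtain B where B: "0 \<le> B" "\<And>X :: nat ^ 'd \<Rightarrow> int ^ 'd \<Rightarrow> ennreal. (\<And>j l. l \<notin> D_box j \<Longrightarrow> X j l = 0) \<Longrightarrow>
      lq_norm q (\<lambda>l. ennreal (freq_weight \<alpha> \<beta> l) * (\<Sum>\<^sub>\<infinity>j\<in>UNIV. X j l))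
        \<le> ennreal B * lq_norm q (\<lambda>j. ennreal (level_weight \<alpha> \<beta> j) * lq_norm q (X j))"
    by (rule synthesis_bound[OF q conj assms(3,4)]) blast

  have upper: "eta_norm q \<alpha> \<beta> \<phi> \<phi>t f \<le> ennreal A * wiener_norm q \<alpha> \<beta> f"
    if f: "f \<in> wiener_space q \<alpha> \<beta>" for f :: "real ^ 'd \<Rightarrow> complex"
  proof -
    have "ennreal (norm (?\<eta> f j l)) \<le>
        (\<Sum>\<^sub>\<infinity>k\<in>UNIV. ennreal ((\<Prod>i\<in>UNIV. norm (eta_symbol (j $ i) (l $ i) (k $ i))) * norm (fourier_coeff f k)))" for j l
      using ennreal_norm_has_sum_le[OF coeff[OF f, of j l]] by (simp add: norm_mult prod_norm)
    hence "eta_norm q \<alpha> \<beta> \<phi> \<phi>t f \<le> lq_norm q (\<lambda>j :: nat ^ 'd. ennreal (level_weight \<alpha> \<beta> j) *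
        lq_norm q (\<lambda>l. \<Sum>\<^sub>\<infinity>k\<in>UNIV. ennreal ((\<Prod>i\<in>UNIV. norm (eta_symbol (j $ i) (l $ i) (k $ i))) * norm (fourier_coeff f k))))"
      unfolding eta_norm_eq by (intro lq_norm_mono[OF q] mult_left_mono) auto
    also have "\<dots> \<le> ennreal A * wiener_norm q \<alpha> \<beta> f"
      unfolding wiener_norm_eq by (rule A)
    finally show ?thesis .
  qed
  \<comment> \<open>Stated under coefficientwise convergence, which comes from membership in the
    space for the equivalence of norms and from the series representation for the converse
    implication.\<close>
  have lower: "wiener_norm q \<alpha> \<beta> f \<le> ennreal B * eta_norm q \<alpha> \<beta> \<phi> \<phi>t f"
    if sum: "\<And>l. ((\<lambda>j. ?\<eta> f j l) has_sum fourier_coeff f l) UNIV" for f :: "real ^ 'd \<Rightarrow> complex"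
  proof -
    have "wiener_norm q \<alpha> \<beta> f \<le> lq_norm q (\<lambda>l. ennreal (freq_weight \<alpha> \<beta> l) * (\<Sum>\<^sub>\<infinity>j\<in>UNIV. ennreal (norm (?\<eta> f j l))))"
      unfolding wiener_norm_eq using ennreal_norm_has_sum_le[OF sum]
      by (intro lq_norm_mono[OF q]) (simp add: ennreal_mult mult_left_mono)
    also have "\<dots> \<le> ennreal B * eta_norm q \<alpha> \<beta> \<phi> \<phi>t f"
      unfolding eta_norm_eq by (rule B) (simp add: fourier_coeff_eta_eq_0)
    finally show ?thesis .
  qed

  have char: "f \<in> wiener_space q \<alpha> \<beta> \<longleftrightarrow> (\<forall>j. eta_well_defined \<phi>t j f)
      \<and> (\<forall>\<alpha>' < \<alpha>. has_sum_wiener q \<alpha>' \<beta> (\<lambda>j. eta \<phi> \<phi>t j f) f) \<and> eta_norm q \<alpha> \<beta> \<phi> \<phi>t f < \<infinity>"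
    if f: "f \<in> L1_torus" for f :: "real ^ 'd \<Rightarrow> complex"
  proof
    assume W: "f \<in> wiener_space q \<alpha> \<beta>"
    hence "ennreal A * wiener_norm q \<alpha> \<beta> f < top"
      by (auto simp: wiener_space_def ennreal_mult_less_top)
    hence fin: "eta_norm q \<alpha> \<beta> \<phi> \<phi>t f < top" using upper[OF W] by (rule le_less_trans[rotated])
    have "has_sum_wiener q \<alpha>' \<beta> (\<lambda>j. eta \<phi> \<phi>t j f) f" if "\<alpha>' < \<alpha>" for \<alpha>'
      unfolding has_sum_wiener_def wiener_norm_diff_sum[OF f]
      by (rule synthesis_tendsto[OF q conj assms(3,4) that _ sum[OF W]])
         (use fin in \<open>auto simp: fourier_coeff_eta_eq_0 eta_norm_eq\<close>)
    thus "(\<forall>j. eta_well_defined \<phi>t j f) \<and> (\<forall>\<alpha>' < \<alpha>. has_sum_wiener q \<alpha>' \<beta> (\<lambda>j. eta \<phi> \<phi>t j f) f)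
        \<and> eta_norm q \<alpha> \<beta> \<phi> \<phi>t f < \<infinity>"
      using well_defined[OF W] fin by simp
  next
    assume *: "(\<forall>j. eta_well_defined \<phi>t j f) \<and> (\<forall>\<alpha>' < \<alpha>. has_sum_wiener q \<alpha>' \<beta> (\<lambda>j. eta \<phi> \<phi>t j f) f)
        \<and> eta_norm q \<alpha> \<beta> \<phi> \<phi>t f < \<infinity>"
    \<comment> \<open>\<alpha> - 1 is one exponent below \<alpha>; any such exponent yields
      coefficientwise convergence.\<close>
    have "has_sum_wiener q (\<alpha> - 1) \<beta> (\<lambda>j. eta \<phi> \<phi>t j f) f" using * by simp
    note lower[OF has_sum_fourier_coeff_if_has_sum_wiener[OF q f this]]
    also have "ennreal B * eta_norm q \<alpha> \<beta> \<phi> \<phi>t f < top" using * by (auto simp: ennreal_mult_less_top)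
    finally show "f \<in> wiener_space q \<alpha> \<beta>" using f by (simp add: wiener_space_def)
  qed
  \<comment> \<open>Adding 1 to A and B keeps both constants positive when A or B is 0.\<close>
  have equiv: "ennreal (1 / (B + 1)) * wiener_norm q \<alpha> \<beta> f \<le> eta_norm q \<alpha> \<beta> \<phi> \<phi>t f
      \<and> eta_norm q \<alpha> \<beta> \<phi> \<phi>t f \<le> ennreal (A + 1) * wiener_norm q \<alpha> \<beta> f"
    if f: "f \<in> wiener_space q \<alpha> \<beta>" for f :: "real ^ 'd \<Rightarrow> complex"
  proof
    have "ennreal (1 / (B + 1)) * wiener_norm q \<alpha> \<beta> f \<le> ennreal (1 / (B + 1)) * (ennreal B * eta_norm q \<alpha> \<beta> \<phi> \<phi>t f)"
      by (intro mult_left_mono lower sum[OF f]) simp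
    also have "\<dots> = ennreal (1 / (B + 1) * B) * eta_norm q \<alpha> \<beta> \<phi> \<phi>t f"
      using B(1) by (subst ennreal_mult) (auto simp: mult.assoc)
    also have "\<dots> \<le> 1 * eta_norm q \<alpha> \<beta> \<phi> \<phi>t f"
      using B(1) by (intro mult_right_mono) (auto simp: ennreal_le_1 field_simps)
    finally show "ennreal (1 / (B + 1)) * wiener_norm q \<alpha> \<beta> f \<le> eta_norm q \<alpha> \<beta> \<phi> \<phi>t f" by simp
    show "eta_norm q \<alpha> \<beta> \<phi> \<phi>t f \<le> ennreal (A + 1) * wiener_norm q \<alpha> \<beta> f"
      by (rule order_trans[OF upper[OF f]]) (intro mult_right_mono ennreal_leI, auto)
  qed
  show ?thesis
    using char equiv A(1) B(1)
    by (intro conjI exI[of _ "1 / (B + 1)"] exI[of _ "A + 1"]) auto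
qed

end
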